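(* Given a DAG $D=(V,A)$, a minimum-size set $A'\subseteq A$ such that $D-A'$ is a funnel (and hence the arc-deletion distance $d=|A'|$ of $D$ to a funnel) can be computed in $O(3^d\cdot(|V|+|A|))$ time.
   Context: A source is a vertex of in-degree $0$, a sink a vertex of out-degree $0$. In a DAG, an arc is private if exactly one directed source-to-sink path contains it. A funnel is a finite DAG in which every directed source-to-sink path contains at least one private arc. The arc-deletion distance to a funnel of a DAG $D$ is the minimum number of arcs whose deletion from $D$ yields a funnel. *)

theory Defs
  imports "Graph_Theory.Pair_Digraph"
begin

section \<open>Funnels\<close>

definition dag :: "'a pair_pre_digraph \<Rightarrow> bool" where
  "dag D \<longleftrightarrow> pair_fin_digraph D \<and> \<not> (\<exists>p. pre_digraph.cycle D p)"

definition source :: "'a pair_pre_digraph \<Rightarrow> 'a \<Rightarrow> bool" where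
  "source D v \<longleftrightarrow> v \<in> pverts D \<and> in_degree D v = 0"

definition sink :: "'a pair_pre_digraph \<Rightarrow> 'a \<Rightarrow> bool" where
  "sink D v \<longleftrightarrow> v \<in> pverts D \<and> out_degree D v = 0"

text \<open>
  A path is given by its list of arcs, which determines its vertices because it is nonempty.
  Paths of length 0 are excluded: an isolated vertex, being both a source and a sink, would
  otherwise be a source-to-sink path without arcs, and no digraph containing one could be a
  funnel or be turned into one by deleting arcs.
\<close>

definition source_sink_path :: "'a pair_pre_digraph \<Rightarrow> ('a \<times> 'a) list \<Rightarrow> bool" where
  "source_sink_path D p \<longleftrightarrow>
     p \<noteq> [] \<and> (\<exists>u v. source D u \<and> sink D v \<and> pre_digraph.apath D u p v)"

definition private_arc :: "'a pair_pre_digraph \<Rightarrow> 'a \<times> 'a \<Rightarrow> bool" where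
  "private_arc D a \<longleftrightarrow> a \<in> parcs D \<and> (\<exists>!p. source_sink_path D p \<and> a \<in> set p)"

definition funnel :: "'a pair_pre_digraph \<Rightarrow> bool" where
  "funnel D \<longleftrightarrow>
     dag D \<and> (\<forall>p. source_sink_path D p \<longrightarrow> (\<exists>a\<in>set p. private_arc D a))"

definition delete_arcs :: "'a pair_pre_digraph \<Rightarrow> ('a \<times> 'a) set \<Rightarrow> 'a pair_pre_digraph" where
  "delete_arcs D X = D\<lparr>parcs := parcs D - X\<rparr>"

definition funnel_deletion_set :: "'a pair_pre_digraph \<Rightarrow> ('a \<times> 'a) set \<Rightarrow> bool" where
  "funnel_deletion_set D X \<longleftrightarrow> X \<subseteq> parcs D \<and> funnel (delete_arcs D X)"

definition min_funnel_deletion_set :: "'a pair_pre_digraph \<Rightarrow> ('a \<times> 'a) set \<Rightarrow> bool" where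
  "min_funnel_deletion_set D X \<longleftrightarrow>
     funnel_deletion_set D X \<and> (\<forall>Y. funnel_deletion_set D Y \<longrightarrow> card X \<le> card Y)"

definition funnel_distance :: "'a pair_pre_digraph \<Rightarrow> nat" where
  "funnel_distance D = (LEAST d. \<exists>X. funnel_deletion_set D X \<and> card X = d)"

lemma ex_funnel_deletion_set:
  fixes D :: "'a pair_pre_digraph"
  assumes "dag D"
  shows "\<exists>X. funnel_deletion_set D X"
proof
  let ?E = "delete_arcs D (parcs D)"
  have "pair_fin_digraph ?E"
    using assms by (auto simp: dag_def delete_arcs_def pair_fin_digraph_def
        pair_wf_digraph_def pair_fin_digraph_axioms_def)
  moreover have "\<not> pre_digraph.awalk ?E u q v" if "q \<noteq> []" for u q v
    using that by (auto simp: pre_digraph.awalk_def delete_arcs_def)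
  ultimately show "funnel_deletion_set D (parcs D)"
    unfolding funnel_deletion_set_def funnel_def dag_def pre_digraph.cycle_def
      source_sink_path_def pre_digraph.apath_def by blast
qed


section \<open>Random access machines\<close>

text \<open>
  Running time is measured on a word RAM with structured control flow: registers and memory
  cells hold natural numbers, and every instruction and every evaluation of a test takes one
  unit of time. Subtraction is truncated. A register index is part of the program text, so a
  program only uses a fixed number of registers; memory is accessed indirectly.
\<close>

datatype test =
    Less nat nat
  | Equal nat nat

datatype com =
    Skip
  | SetConst nat nat
  | Move nat nat
  | Add nat nat nat
  | Sub nat nat nat
  | Load nat nat
  | Store nat nat
  | Seq com com
  | If test com com
  | While test com

type_synonym state = "(nat \<Rightarrow> nat) \<times> (nat \<Rightarrow> nat)"

fun holds :: "test \<Rightarrow> (nat \<Rightarrow> nat) \<Rightarrow> bool" where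
  "holds (Less i j) R \<longleftrightarrow> R i < R j"
| "holds (Equal i j) R \<longleftrightarrow> R i = R j"

text \<open>
  In \<open>exec W c s t s'\<close>, program \<open>c\<close> started in \<open>s\<close> (registers, memory) halts in \<open>s'\<close> after
  \<open>t\<close> steps. The largest number that fits into a machine word is \<open>W\<close>; a run that would produce
  a larger one is stuck. So unit cost cannot be abused by computing with huge numbers, and only
  cells with addresses up to \<open>W\<close> can be used.
\<close>

inductive exec :: "nat \<Rightarrow> com \<Rightarrow> state \<Rightarrow> nat \<Rightarrow> state \<Rightarrow> bool" for W :: nat where
  exec_Skip: "exec W Skip s 1 s"
| exec_SetConst: "a \<le> W \<Longrightarrow> exec W (SetConst i a) (R, M) 1 (R(i := a), M)"
| exec_Move: "exec W (Move i j) (R, M) 1 (R(i := R j), M)"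
| exec_Add: "R j + R k \<le> W \<Longrightarrow> exec W (Add i j k) (R, M) 1 (R(i := R j + R k), M)"
| exec_Sub: "exec W (Sub i j k) (R, M) 1 (R(i := R j - R k), M)"
| exec_Load: "exec W (Load i j) (R, M) 1 (R(i := M (R j)), M)"
| exec_Store: "exec W (Store i j) (R, M) 1 (R, M(R i := R j))"
| exec_Seq: "exec W c1 s t1 s' \<Longrightarrow> exec W c2 s' t2 s'' \<Longrightarrow>
    exec W (Seq c1 c2) s (t1 + t2) s''"
| exec_IfTrue: "holds b (fst s) \<Longrightarrow> exec W c1 s t s' \<Longrightarrow> exec W (If b c1 c2) s (t + 1) s'"
| exec_IfFalse: "\<not> holds b (fst s) \<Longrightarrow> exec W c2 s t s' \<Longrightarrow> exec W (If b c1 c2) s (t + 1) s'"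
| exec_WhileTrue: "holds b (fst s) \<Longrightarrow> exec W c s t1 s' \<Longrightarrow> exec W (While b c) s' t2 s'' \<Longrightarrow>
    exec W (While b c) s (t1 + t2 + 1) s''"
| exec_WhileFalse: "\<not> holds b (fst s) \<Longrightarrow> exec W (While b c) s 1 s"

inductive_cases exec_elims:
  "exec W Skip s t s'" "exec W (SetConst i a) s t s'" "exec W (Move i j) s t s'"
  "exec W (Add i j k) s t s'" "exec W (Sub i j k) s t s'" "exec W (Load i j) s t s'"
  "exec W (Store i j) s t s'" "exec W (Seq c1 c2) s t s'" "exec W (If b c1 c2) s t s'"
  "exec W (While b c) s t s'"

lemma exec_deterministic:
  "exec W c s t s' \<Longrightarrow> exec W c s u r \<Longrightarrow> u = t \<and> r = s'"
proof (induction arbitrary: u r rule: exec.induct)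
  case (exec_Seq c1 s t1 s' c2 t2 s'')
  from exec_Seq.prems show ?case
    by (rule exec_elims(8)) (metis exec_Seq.IH)
next
  case (exec_IfTrue b s c1 t s' c2)
  from exec_IfTrue.prems show ?case
    by (rule exec_elims(9)) (auto simp: exec_IfTrue.hyps dest!: exec_IfTrue.IH)
next
  case (exec_IfFalse b s c2 t s' c1)
  from exec_IfFalse.prems show ?case
    by (rule exec_elims(9)) (auto simp: exec_IfFalse.hyps dest!: exec_IfFalse.IH)
next
  case (exec_WhileTrue b s c t1 s' t2 s'')
  from exec_WhileTrue.prems show ?case
    by (rule exec_elims(10)) (metis exec_WhileTrue.hyps(1) exec_WhileTrue.IH Suc_eq_plus1)+
next
  case (exec_WhileFalse b s c)
  from exec_WhileFalse.prems show ?case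
    by (rule exec_elims(10)) (auto simp: exec_WhileFalse.hyps)
qed (auto elim: exec_elims(1-7))

definition arc_list_code :: "(nat \<times> nat) list \<Rightarrow> nat list" where
  "arc_list_code es = length es # concat (map (\<lambda>(u, v). [u, v]) es)"

definition initial_state :: "nat list \<Rightarrow> state" where
  "initial_state xs = ((\<lambda>_. 0), (\<lambda>i. if i < length xs then xs ! i else 0))"

definition memory_starts_with :: "(nat \<Rightarrow> nat) \<Rightarrow> nat list \<Rightarrow> bool" where
  "memory_starts_with M xs \<longleftrightarrow> (\<forall>i < length xs. M i = xs ! i)"

text \<open>
  A digraph with vertex set \<open>{0, ..., n - 1}\<close> is presented by \<open>n\<close> and a list of its arcs in
  an arbitrary order. This is interchangeable with adjacency lists, since each is obtained
  from the other in linear time.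
\<close>

definition presents :: "nat \<Rightarrow> (nat \<times> nat) list \<Rightarrow> nat pair_pre_digraph \<Rightarrow> bool" where
  "presents n es D \<longleftrightarrow> pverts D = {..<n} \<and> distinct es \<and> set es = parcs D"

end

theory Submission
  imports Defs
begin

text \<open>
  A DAG is a funnel iff no vertex of in-degree at least 2 reaches (in zero or more steps) a vertex
  of out-degree at least 2. If this fails, call a vertex bad if it is reachable from a vertex of
  in-degree at least 2, and let \<open>w\<close> be a bad vertex of out-degree at least 2 with no bad proper
  ancestor of this kind. Let \<open>b\<close> and \<open>c\<close> be two arcs leaving \<open>w\<close>, and \<open>a\<close> an arc entering \<open>w\<close>, with a
  bad tail if possible. By an exchange argument, some minimum deletion set contains \<open>a\<close>, \<open>b\<close> or \<open>c\<close>,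
  so a search tree with three children per node and depth \<open>d\<close> finds one. Once the arcs are sorted
  by the topological position of their tails, a single scan over the arcs finds \<open>a\<close>, \<open>b\<close> and \<open>c\<close>,
  so every node costs linear time. As \<open>d\<close> is not known, the depth is
  increased from 0 until a funnel is found, which costs a constant factor.
\<close>

section \<open>Private arcs in terms of merging and branching vertices\<close>

section \<open>Funnels via degrees\<close>

text \<open>The obstacle is that the connection between a merging and a branching vertex can be
  arbitrarily long, and that many arcs may enter \<open>w\<close>, so deleting an arc of the
  obstruction is not a choice among boundedly many. The choice of \<open>w\<close> removes both
  difficulties. Every bad proper ancestor of \<open>w\<close> has out-degree at most 1, so once
  inside the bad region there is no alternative on the way down: a deletion made further up can be
  pushed down to \<open>a\<close>. If no in-neighbour of \<open>w\<close> is bad, then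
  \<open>w\<close> itself merges, a solution that leaves \<open>w\<close> branching keeps at most
  one arc entering \<open>w\<close>, and these arcs are interchangeable. Either way a single
  entering arc represents all ways of making \<open>w\<close> good. The order of the arcs survives
  deletions, so sorting is done only once. Each arc stores the level at which it was deleted instead
  of a mark; moving to any pending node of the search tree is then one linear pass over the arcs.
  The rounds of the deepening search cost a geometric sum, dominated by the last one.\<close>

definition merging :: "'a rel \<Rightarrow> 'a \<Rightarrow> bool" where
  "merging E v \<longleftrightarrow> (\<exists>x y. x \<noteq> y \<and> (x, v) \<in> E \<and> (y, v) \<in> E)"

definition branching :: "'a rel \<Rightarrow> 'a \<Rightarrow> bool" where
  "branching E v \<longleftrightarrow> (\<exists>x y. x \<noteq> y \<and> (v, x) \<in> E \<and> (v, y) \<in> E)"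

text \<open>These are the bad vertices. The closure is reflexive, so a merging vertex is itself
  bad.\<close>

definition after_merge :: "'a rel \<Rightarrow> 'a \<Rightarrow> bool" where
  "after_merge E v \<longleftrightarrow> (\<exists>u. merging E u \<and> (u, v) \<in> E\<^sup>*)"

definition merge_branch_free :: "'a rel \<Rightarrow> bool" where
  "merge_branch_free E \<longleftrightarrow> (\<forall>v. after_merge E v \<longrightarrow> \<not> branching E v)"

text \<open>\<open>pre_digraph.apath\<close> also asks for distinct vertices and for a start in the
  vertex set. In a DAG the former is automatic, and for nonempty walks so is the latter; paths thus
  become plain arc lists over a relation.\<close>

definition walk :: "'a rel \<Rightarrow> 'a \<Rightarrow> ('a \<times> 'a) list \<Rightarrow> 'a \<Rightarrow> bool" where
  "walk E u p v \<longleftrightarrow> set p \<subseteq> E \<and> pcas u p v"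

lemma walk_Nil [simp]: "walk E u [] v \<longleftrightarrow> u = v"
  by (simp add: walk_def)

lemma walk_Cons [simp]: "walk E u (a # p) v \<longleftrightarrow> a \<in> E \<and> fst a = u \<and> walk E (snd a) p v"
  by (auto simp: walk_def)

lemma walk_append: "walk E u (p @ q) v \<longleftrightarrow> (\<exists>w. walk E u p w \<and> walk E w q v)"
  by (induction p arbitrary: u) auto

lemma walk_imp_rtrancl: "walk E u p v \<Longrightarrow> (u, v) \<in> E\<^sup>*"
  by (induction p arbitrary: u) (auto intro: converse_rtrancl_into_rtrancl)

lemma walk_imp_trancl: "walk E u p v \<Longrightarrow> p \<noteq> [] \<Longrightarrow> (u, v) \<in> E\<^sup>+"
  by (cases p) (auto dest: walk_imp_rtrancl intro: rtrancl_into_trancl2)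

lemma rtrancl_imp_walk: "(u, v) \<in> E\<^sup>* \<Longrightarrow> \<exists>p. walk E u p v"
proof (induction rule: converse_rtrancl_induct)
  case base
  then show ?case using walk_Nil by metis
next
  case (step y z)
  then obtain p where "walk E z p v" by blast
  then have "walk E y ((y, z) # p) v" using step by simp
  then show ?case by blast
qed

definition source_sink_walk :: "'a rel \<Rightarrow> ('a \<times> 'a) list \<Rightarrow> bool" where
  "source_sink_walk E p \<longleftrightarrow>
     p \<noteq> [] \<and> (\<exists>u v. walk E u p v \<and> u \<notin> Range E \<and> v \<notin> Domain E)"

text \<open>If the start recurred, the first arc followed by the walk back to the start would be a
  cycle.\<close>

lemma acyclic_distinct_pawalk_verts:
  assumes "acyclic E" "walk E u p v"
  shows "distinct (pawalk_verts u p)"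
  using assms(2)
proof (induction p arbitrary: u)
  case (Cons a p)
  have reach: "(x, w) \<in> E\<^sup>*" if "w \<in> set (pawalk_verts x q)" "walk E x q v" for x w q
    using that
    by (induction q arbitrary: x) (auto intro: converse_rtrancl_into_rtrancl)
  have "u \<notin> set (pawalk_verts (snd a) p)"
  proof
    assume "u \<in> set (pawalk_verts (snd a) p)"
    then have "(snd a, u) \<in> E\<^sup>*" using reach Cons.prems by auto
    moreover have "(u, snd a) \<in> E" using Cons.prems by (cases a) auto
    ultimately show False using assms(1) by (meson acyclic_def rtrancl_into_trancl2)
  qed
  then show ?case using Cons by auto
qed simp

lemma dag_imp_acyclic:
  assumes "dag D" shows "acyclic (parcs D)"
proof (rule ccontr)
  interpret pair_fin_digraph D using assms by (simp add: dag_def)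
  assume "\<not> acyclic (parcs D)"
  then obtain u where "(u, u) \<in> (parcs D)\<^sup>+" by (auto simp: acyclic_def)
  then obtain x where x: "(u, x) \<in> parcs D" "(x, u) \<in> (parcs D)\<^sup>*" by (meson tranclD)
  then obtain p where "walk (parcs D) x p u" using rtrancl_imp_walk by metis
  then have "closed_w ((u, x) # p)"
    using x by (auto simp: closed_w_def awalk_def walk_def dest: in_arcsD1 intro!: exI[of _ u])
  then have "\<exists>p. cycle p" by (rule closed_w_imp_cycle)
  then show False using assms by (auto simp: dag_def)
qed

lemma dag_delete_arcs:
  assumes "dag D" shows "dag (delete_arcs D X)"
  using assms
  unfolding dag_def pre_digraph.cycle_def pre_digraph.awalk_def cas_with_proj_eq
    awalk_verts_with_proj_eq
  by (auto simp: delete_arcs_def pair_fin_digraph_def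
        pair_wf_digraph_def pair_fin_digraph_axioms_def; blast)

text \<open>This is the bridge that lets everything below speak of the arc relation alone.\<close>

lemma source_sink_path_iff_walk:
  assumes "dag D"
  shows "source_sink_path D p \<longleftrightarrow> source_sink_walk (parcs D) p"
proof -
  interpret pair_fin_digraph D using assms by (simp add: dag_def)
  have ac: "acyclic (parcs D)" using dag_imp_acyclic assms .
  have fin: "finite (parcs D)" using pair_finite_arcs .
  have src: "source D v \<longleftrightarrow> v \<in> pverts D \<and> v \<notin> Range (parcs D)" for v
    using fin by (auto simp: source_def in_degree_def in_arcs_def)
  have snk: "sink D v \<longleftrightarrow> v \<in> pverts D \<and> v \<notin> Domain (parcs D)" for v
    using fin by (auto simp: sink_def out_degree_def out_arcs_def)
  have verts: "u \<in> pverts D \<and> v \<in> pverts D" if "walk (parcs D) u p v" "p \<noteq> []" for u v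
  proof -
    have "(u, v) \<in> (parcs D)\<^sup>+" using that walk_imp_trancl by metis
    then show ?thesis using in_arcsD1 in_arcsD2 by (meson tranclD tranclD2)
  qed
  have ap: "apath u p v \<longleftrightarrow> u \<in> pverts D \<and> walk (parcs D) u p v" for u v
    using acyclic_distinct_pawalk_verts[OF ac]
    by (auto simp: apath_def awalk_def walk_def)
  show ?thesis
    unfolding source_sink_path_def source_sink_walk_def src snk ap using verts by blast
qed

text \<open>Walking forward must stop because the converse relation is well-founded. Together with
  its mirror image, this completes any walk to a source-to-sink walk.\<close>

lemma ex_sink_walk:
  assumes "finite E" "acyclic E"
  shows "\<exists>p v. walk E u p v \<and> v \<notin> Domain E"
proof -
  have "wf (E\<inverse>)" using assms by (simp add: finite_acyclic_wf_converse)
  then show ?thesis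
  proof (induction u rule: wf_induct_rule)
    case (less u)
    show ?case
    proof (cases "u \<in> Domain E")
      case False
      then show ?thesis by (intro exI[of _ "[]"]) auto
    next
      case True
      then obtain w where w: "(u, w) \<in> E" by blast
      then obtain p v where "walk E w p v" "v \<notin> Domain E" using less by blast
      then show ?thesis using w by (intro exI[of _ "(u, w) # p"]) auto
    qed
  qed
qed

lemma ex_source_walk:
  assumes "finite E" "acyclic E"
  shows "\<exists>p u. walk E u p v \<and> u \<notin> Range E"
proof -
  have "wf E" using assms by (simp add: finite_acyclic_wf)
  then show ?thesis
  proof (induction v rule: wf_induct_rule)
    case (less v)
    show ?case
    proof (cases "v \<in> Range E")
      case False
      then show ?thesis by (intro exI[of _ "[]"]) auto
    next
      case True
      then obtain w where w: "(w, v) \<in> E" by blast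
      then obtain p u where "walk E u p w" "u \<notin> Range E" using less by blast
      then show ?thesis using w by (intro exI[of _ "p @ [(w, v)]"]) (auto simp: walk_append)
    qed
  qed
qed

text \<open>Without branching, the next arc is forced at each step. Both walks end outside
  \<open>Domain E\<close>, so neither can be a proper prefix of the other.\<close>

lemma walk_forward_unique:
  assumes "\<forall>w. (u, w) \<in> E\<^sup>* \<longrightarrow> \<not> branching E w"
    "walk E u p v" "v \<notin> Domain E" "walk E u q v'" "v' \<notin> Domain E"
  shows "p = q"
  using assms
proof (induction p arbitrary: u q)
  case Nil
  then show ?case by (cases q) auto
next
  case (Cons a p)
  show ?case
  proof (cases q)
    case Nil
    then show ?thesis using Cons.prems by auto (metis DomainI prod.collapse)
  next
    case (Cons b r)
    have "a = b"
      using Cons.prems(1,2,4) unfolding Cons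
      by (cases a; cases b) (auto simp: branching_def)
    moreover have "p = r"
    proof (rule Cons.IH)
      have "(u, snd a) \<in> E" using Cons.prems by (cases a) auto
      then show "\<forall>w. (snd a, w) \<in> E\<^sup>* \<longrightarrow> \<not> branching E w"
        using Cons.prems(1) by (meson converse_rtrancl_into_rtrancl)
    qed (use Cons.prems Cons \<open>a = b\<close> in auto)
    ultimately show ?thesis using Cons by simp
  qed
qed

lemma walk_backward_unique:
  assumes "\<forall>w. (w, v) \<in> E\<^sup>* \<longrightarrow> \<not> merging E w"
    "walk E u p v" "u \<notin> Range E" "walk E u' q v" "u' \<notin> Range E"
  shows "p = q"
  using assms
proof (induction p arbitrary: v q rule: rev_induct)
  case Nil
  then show ?case by (cases q rule: rev_cases) (auto simp: walk_append)
next
  case (snoc a p)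
  show ?case
  proof (cases q rule: rev_cases)
    case Nil
    then show ?thesis using snoc.prems by (auto simp: walk_append) (metis RangeI prod.collapse)
  next
    case (snoc r b)
    have "a = b"
      using snoc.prems(1,2,4) unfolding snoc
      by (cases a; cases b) (auto simp: merging_def walk_append)
    moreover have "p = r"
    proof (rule snoc.IH)
      have "(fst a, v) \<in> E" using snoc.prems by (cases a) (auto simp: walk_append)
      then show "\<forall>w. (w, fst a) \<in> E\<^sup>* \<longrightarrow> \<not> merging E w"
        using snoc.prems(1) by (meson rtrancl.rtrancl_into_rtrancl)
    qed (use snoc.prems snoc \<open>a = b\<close> in \<open>auto simp: walk_append\<close>)
    ultimately show ?thesis using snoc by simp
  qed
qed

text \<open>
  The private arc of a path is the one entering its first merging vertex, or its last arc.
\<close>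

lemma ex_private_split:
  assumes "merge_branch_free E" "walk E u p v" "p \<noteq> []" "v \<notin> Domain E"
    "\<forall>w. (w, u) \<in> E\<^sup>* \<longrightarrow> \<not> merging E w"
  shows "\<exists>p1 a p2. p = p1 @ a # p2 \<and> (\<forall>w. (w, fst a) \<in> E\<^sup>* \<longrightarrow> \<not> merging E w) \<and>
     (\<forall>w. (snd a, w) \<in> E\<^sup>* \<longrightarrow> \<not> branching E w)"
  using assms(2,3,5)
proof (induction p arbitrary: u)
  case (Cons a p)
  have a: "(u, snd a) \<in> E" "fst a = u" using Cons.prems by (cases a; auto)+
  \<comment> \<open>The current arc serves if its head is a sink or a merging vertex: nothing
    branches from there on, in the second case by \<open>merge_branch_free\<close>. Otherwise
    \<open>u\<close> is the only predecessor of the head, so no merging vertex reaches the head and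
    the search moves on.\<close>
  consider "p = []" | "merging E (snd a)" | "p \<noteq> []" "\<not> merging E (snd a)" by blast
  then show ?case
  proof cases
    case 1
    then have "\<not> branching E w" if "(snd a, w) \<in> E\<^sup>*" for w
      using that Cons.prems assms(4) by (auto simp: branching_def elim: converse_rtranclE)
    then show ?thesis using Cons.prems a 1 by (intro exI[of _ "[]"] exI[of _ a]) auto
  next
    case 2
    then have "\<not> branching E w" if "(snd a, w) \<in> E\<^sup>*" for w
      using that assms(1) by (auto simp: merge_branch_free_def after_merge_def)
    then show ?thesis using Cons.prems a
      by (intro exI[of _ "[]"] exI[of _ a] exI[of _ p]) auto
  next
    case 3
    have "\<not> merging E w" if "(w, snd a) \<in> E\<^sup>*" for w
    proof (cases "w = snd a")
      case False
      with that obtain x where "(w, x) \<in> E\<^sup>*" "(x, snd a) \<in> E" by (auto elim: rtranclE)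
      moreover have "x = u" using 3(2) a \<open>(x, snd a) \<in> E\<close> by (auto simp: merging_def)
      ultimately show ?thesis using Cons.prems by auto
    qed (use 3 in simp)
    then obtain p1 b p2 where "p = p1 @ b # p2" "\<forall>w. (w, fst b) \<in> E\<^sup>* \<longrightarrow> \<not> merging E w"
      "\<forall>w. (snd b, w) \<in> E\<^sup>* \<longrightarrow> \<not> branching E w"
      using Cons.IH[of "snd a"] Cons.prems 3 by (simp del: split_paired_Ex) blast
    then show ?thesis by (intro exI[of _ "a # p1"] exI[of _ b] exI[of _ p2]) auto
  qed
qed simp

text \<open>The part before \<open>a\<close> is determined backwards from its tail, the part after
  \<open>a\<close> forwards from its head.\<close>

lemma walk_through_unique:
  assumes "\<forall>w. (w, fst a) \<in> E\<^sup>* \<longrightarrow> \<not> merging E w"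
    "\<forall>w. (snd a, w) \<in> E\<^sup>* \<longrightarrow> \<not> branching E w"
    "source_sink_walk E p" "a \<in> set p" "source_sink_walk E q" "a \<in> set q"
  shows "p = q"
proof -
  obtain p1 p2 where p: "p = p1 @ a # p2" using assms(4) by (meson split_list)
  obtain q1 q2 where q: "q = q1 @ a # q2" using assms(6) by (meson split_list)
  obtain u v where uv: "walk E u p1 (fst a)" "walk E (snd a) p2 v" "u \<notin> Range E" "v \<notin> Domain E"
    using assms(3) unfolding source_sink_walk_def p by (auto simp: walk_append)
  obtain u' v' where uv': "walk E u' q1 (fst a)" "walk E (snd a) q2 v'" "u' \<notin> Range E"
    "v' \<notin> Domain E"
    using assms(5) unfolding source_sink_walk_def q by (auto simp: walk_append)
  have "p1 = q1" using walk_backward_unique[OF assms(1)] uv uv' by metis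
  moreover have "p2 = q2" using walk_forward_unique[OF assms(2)] uv uv' by metis
  ultimately show ?thesis using p q by simp
qed

lemma funnel_iff_merge_branch_free:
  assumes "dag D"
  shows "funnel D \<longleftrightarrow> merge_branch_free (parcs D)"
proof
  let ?E = "parcs D"
  interpret pair_fin_digraph D using assms by (simp add: dag_def)
  have ac: "acyclic ?E" using dag_imp_acyclic assms .
  have fin: "finite ?E" using pair_finite_arcs .
  note iff = source_sink_path_iff_walk[OF assms]
  show "merge_branch_free ?E" if "funnel D"
  proof (rule ccontr)
    assume "\<not> merge_branch_free ?E"
    then obtain m b where m: "merging ?E m" and b: "branching ?E b" and "(m, b) \<in> ?E\<^sup>*"
      by (auto simp: merge_branch_free_def after_merge_def)
    then obtain q where q: "walk ?E m q b" using rtrancl_imp_walk by metis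
    obtain x y where xy: "x \<noteq> y" "(x, m) \<in> ?E" "(y, m) \<in> ?E" using m by (auto simp: merging_def)
    obtain s t where st: "s \<noteq> t" "(b, s) \<in> ?E" "(b, t) \<in> ?E" using b by (auto simp: branching_def)
    obtain px ux where px: "walk ?E ux px x" "ux \<notin> Range ?E" using ex_source_walk[OF fin ac] by blast
    obtain py uy where py: "walk ?E uy py y" "uy \<notin> Range ?E" using ex_source_walk[OF fin ac] by blast
    obtain ps vs where ps: "walk ?E s ps vs" "vs \<notin> Domain ?E" using ex_sink_walk[OF fin ac] by blast
    obtain pt vt where pt: "walk ?E t pt vt" "vt \<notin> Domain ?E" using ex_sink_walk[OF fin ac] by blast
    let ?X = "px @ [(x, m)]" and ?Y = "py @ [(y, m)]"
      and ?S = "(b, s) # ps" and ?T = "(b, t) # pt"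
    \<comment> \<open>Each arc of the first walk lies on one of the other two: those of
      \<open>?X\<close> and \<open>q\<close> on the second, those of \<open>?S\<close> on the third.
      Hence none of them is private.\<close>
    have *: "source_sink_walk ?E (?X @ q @ ?S)" "source_sink_walk ?E (?X @ q @ ?T)"
      "source_sink_walk ?E (?Y @ q @ ?S)"
      using px py ps pt q xy st by (auto simp: source_sink_walk_def walk_append)
    obtain a where a: "a \<in> set (?X @ q @ ?S)" "private_arc D a"
      using \<open>funnel D\<close> *(1) by (auto simp only: funnel_def iff)
    have uniq: "r = r'" if "source_sink_walk ?E r" "source_sink_walk ?E r'" "a \<in> set r" "a \<in> set r'"
      for r r'
      using a(2) that by (auto simp: private_arc_def iff)
    have "a \<in> set ?X \<or> a \<in> set q \<or> a \<in> set ?S" using a(1) by auto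
    then show False
    proof (elim disjE)
      assume "a \<in> set ?S"
      then have "?X @ q @ ?S = ?Y @ q @ ?S" by (intro uniq *) auto
      then have "?X = ?Y" by (simp only: append_same_eq)
      then show False using xy by simp
    qed (use uniq[OF *(1,2)] st in auto)
  qed
  show "funnel D" if mbf: "merge_branch_free ?E"
    unfolding funnel_def iff
  proof (intro conjI allI impI assms)
    fix p assume p: "source_sink_walk ?E p"
    then obtain u v where uv: "walk ?E u p v" "u \<notin> Range ?E" "v \<notin> Domain ?E" "p \<noteq> []"
      by (auto simp: source_sink_walk_def)
    have "\<not> merging ?E w" if "(w, u) \<in> ?E\<^sup>*" for w
      using that uv(2) by (auto simp: merging_def elim: rtranclE)
    then obtain p1 a p2 where a: "p = p1 @ a # p2" "\<forall>w. (w, fst a) \<in> ?E\<^sup>* \<longrightarrow> \<not> merging ?E w"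
     "\<forall>w. (snd a, w) \<in> ?E\<^sup>* \<longrightarrow> \<not> branching ?E w"
      using ex_private_split[OF mbf uv(1,4,3)] by metis
    have "a \<in> ?E" using a(1) uv(1) by (auto simp: walk_append)
    then have "private_arc D a"
      unfolding private_arc_def iff
      using walk_through_unique[OF a(2,3)] p a(1) by (auto intro!: ex1I[of _ p])
    then show "\<exists>a\<in>set p. private_arc D a" using a(1) by auto
  qed
qed

definition deletion_set :: "'a rel \<Rightarrow> 'a rel \<Rightarrow> bool" where
  "deletion_set E X \<longleftrightarrow> X \<subseteq> E \<and> merge_branch_free (E - X)"

lemma funnel_deletion_set_iff:
  assumes "dag D"
  shows "funnel_deletion_set D X \<longleftrightarrow> deletion_set (parcs D) X"
  using funnel_iff_merge_branch_free[OF dag_delete_arcs[OF assms, of X]]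
  by (simp add: funnel_deletion_set_def deletion_set_def delete_arcs_def)


section \<open>Exchange of deletions and the three-way branching\<close>

section \<open>The branching rule\<close>

text \<open>Here \<open>snd a\<close> is the vertex \<open>w\<close>. The last conjunct admits a
  good tail of \<open>a\<close> only if all in-neighbours of \<open>w\<close> are good;
  \<open>w\<close> is then bad by merging itself.\<close>

definition branch_arcs :: "'a rel \<Rightarrow> 'a \<times> 'a \<Rightarrow> 'a \<times> 'a \<Rightarrow> 'a \<times> 'a \<Rightarrow> bool" where
  "branch_arcs E a b c \<longleftrightarrow> a \<in> E \<and> b \<in> E \<and> c \<in> E \<and> b \<noteq> c \<and> fst b = snd a \<and> fst c = snd a \<and>
     after_merge E (snd a) \<and> (\<forall>u. after_merge E u \<and> (u, snd a) \<in> E\<^sup>+ \<longrightarrow> \<not> branching E u) \<and>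
     (after_merge E (fst a) \<or> (\<forall>u. (u, snd a) \<in> E \<longrightarrow> \<not> after_merge E u))"

lemma merging_mono: "merging E v \<Longrightarrow> E \<subseteq> F \<Longrightarrow> merging F v"
  by (auto simp: merging_def)

lemma branching_mono: "branching E v \<Longrightarrow> E \<subseteq> F \<Longrightarrow> branching F v"
  by (auto simp: branching_def)

lemma after_merge_step: "after_merge E u \<Longrightarrow> (u, v) \<in> E\<^sup>* \<Longrightarrow> after_merge E v"
  by (auto simp: after_merge_def intro: rtrancl_trans)

text \<open>This is the recursion that the scan evaluates along the topological order.\<close>

lemma after_merge_iff:
  "after_merge E v \<longleftrightarrow> merging E v \<or> (\<exists>u. (u, v) \<in> E \<and> after_merge E u)"
  unfolding after_merge_def by (metis rtrancl.simps)

text \<open>The deletion of (\<open>g\<close>, \<open>h\<close>) is traded for that of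
  \<open>a\<close>. A merging \<open>p\<close> that reaches a branching \<open>q\<close> in
  \<open>E'\<close> would do so in \<open>E - X\<close> already: by the condition on
  \<open>g\<close>, the restored arc does not leave \<open>q\<close>; by the condition on
  \<open>h\<close>, it is not on the way from \<open>p\<close> to \<open>q\<close>, and either it
  does not enter \<open>p\<close> or \<open>a\<close> can stand in for it there.\<close>

lemma merge_branch_free_exchange:
  assumes "merge_branch_free (E - X)" "X \<subseteq> E" "(g, h) \<in> X" "a \<notin> X" "a \<in> E"
    and E': "E' = E - insert a (X - {(g, h)})"
    and g: "\<not> after_merge E g \<or> \<not> branching E g"
    and h: "(\<forall>q. (h, q) \<in> E'\<^sup>* \<longrightarrow> \<not> branching E' q) \<or> snd a = h \<and> \<not> after_merge E g"
  shows "merge_branch_free E'"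
  unfolding merge_branch_free_def
proof (intro allI impI notI)
  fix q assume "after_merge E' q" and bq: "branching E' q"
  then obtain p where p: "merging E' p" "(p, q) \<in> E'\<^sup>*" by (auto simp: after_merge_def)
  have sub: "E' \<subseteq> E" "E' - {(g, h)} \<subseteq> E - X" "E' = insert (g, h) (E' - {(g, h)})"
    using assms(2-4) unfolding E' by auto
  have bad: "after_merge E r" if "(p, r) \<in> E'\<^sup>*" for r
    using p(1) that sub(1) rtrancl_mono[OF sub(1)] merging_mono
    unfolding after_merge_def by (metis subsetD)
  have "q \<noteq> g" using g bad p(2) bq branching_mono sub(1) by metis
  then have bq': "branching (E - X) q" using bq sub(2) by (auto simp: branching_def)
  have "p \<noteq> h \<or> snd a = h" using h p bq by blast
  then have mp: "merging (E - X) p"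
  proof
    assume "p \<noteq> h"
    then show ?thesis using p(1) sub(2) by (auto simp: merging_def)
  next
    assume "snd a = h"
    obtain x y where xy: "x \<noteq> y" "(x, p) \<in> E'" "(y, p) \<in> E'" using p(1) by (auto simp: merging_def)
    show ?thesis
    proof (cases "p = h \<and> (x = g \<or> y = g)")
      case True
      \<comment> \<open>The restored arc is one of the two witnesses for merging, and
        \<open>z\<close> is the tail of the other. In \<open>E - X\<close> its place is taken by
        \<open>a\<close>, which is absent from \<open>E'\<close> and so differs from the arc leaving
        \<open>z\<close>.\<close>
      then obtain z where "z \<noteq> g" "(z, p) \<in> E'" using xy by metis
      then have "(z, p) \<in> E - X" using sub(2) by auto
      moreover have "(fst a, p) \<in> E - X" using assms(4,5) True \<open>snd a = h\<close> by (cases a) auto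
      moreover have "z \<noteq> fst a" using \<open>(z, p) \<in> E'\<close> E' True \<open>snd a = h\<close> by (cases a) auto
      ultimately show ?thesis by (auto simp: merging_def)
    next
      case False
      then have "(x, p) \<in> E - X" "(y, p) \<in> E - X" using xy sub(2) by auto
      then show ?thesis using xy(1) by (auto simp: merging_def)
    qed
  qed
  have "(p, q) \<in> (E' - {(g, h)})\<^sup>*"
  proof (rule ccontr)
    assume "(p, q) \<notin> (E' - {(g, h)})\<^sup>*"
    moreover have "(p, q) \<in> (insert (g, h) (E' - {(g, h)}))\<^sup>*" using p(2) sub(3) by simp
    ultimately have "(p, g) \<in> (E' - {(g, h)})\<^sup>*" "(h, q) \<in> (E' - {(g, h)})\<^sup>*"
      unfolding rtrancl_insert by blast+
    then have "(p, g) \<in> E'\<^sup>*" "(h, q) \<in> E'\<^sup>*" using rtrancl_mono[of "E' - {(g, h)}" E'] by auto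
    then show False using h bq bad by blast
  qed
  then have "(p, q) \<in> (E - X)\<^sup>*" using rtrancl_mono[OF sub(2)] by auto
  then show False
    using assms(1) mp bq' by (auto simp: merge_branch_free_def after_merge_def)
qed

text \<open>A merging ancestor that is minimal for \<open>E\<^sup>+\<close> will do: a merging
  ancestor of one of its predecessors would be smaller. It is a vertex where the bad region is
  entered from good tails only.\<close>

lemma ex_first_merging:
  assumes "finite E" "acyclic E" "after_merge E v"
  shows "\<exists>z. merging E z \<and> (z, v) \<in> E\<^sup>* \<and> (\<forall>u. (u, z) \<in> E \<longrightarrow> \<not> after_merge E u)"
proof -
  have "wf (E\<^sup>+)" using assms by (simp add: finite_acyclic_wf wf_trancl)
  moreover obtain z0 where "z0 \<in> {z. merging E z \<and> (z, v) \<in> E\<^sup>*}"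
    using assms(3) by (auto simp: after_merge_def)
  ultimately obtain z where z: "z \<in> {z. merging E z \<and> (z, v) \<in> E\<^sup>*}"
    "\<And>y. (y, z) \<in> E\<^sup>+ \<Longrightarrow> y \<notin> {z. merging E z \<and> (z, v) \<in> E\<^sup>*}"
    by (rule wfE_min) blast
  have "\<not> after_merge E u" if u: "(u, z) \<in> E" for u
  proof
    assume "after_merge E u"
    then obtain y where y: "merging E y" "(y, u) \<in> E\<^sup>*" by (auto simp: after_merge_def)
    then have "(y, z) \<in> E\<^sup>+" using u by auto
    moreover have "(y, v) \<in> E\<^sup>*" using \<open>(y, z) \<in> E\<^sup>+\<close> z(1) by auto
    ultimately show False using z(2) y(1) by blast
  qed
  then show ?thesis using z(1) by blast
qed

lemma rtrancl_cut:
  assumes "(u, v) \<in> E\<^sup>*" "(u, v) \<notin> (E - X)\<^sup>*"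
  shows "\<exists>g h. (g, h) \<in> X \<and> (g, h) \<in> E \<and> (u, g) \<in> E\<^sup>* \<and> (h, v) \<in> E\<^sup>*"
  using assms
proof (induction rule: rtrancl_induct)
  case (step y z)
  show ?case
  proof (cases "(u, y) \<in> (E - X)\<^sup>*")
    case True
    then have "(y, z) \<in> X" using step by (meson DiffI rtrancl.rtrancl_into_rtrancl)
    then show ?thesis using step by blast
  next
    case False
    then obtain g h where "(g, h) \<in> X" "(g, h) \<in> E" "(u, g) \<in> E\<^sup>*" "(h, y) \<in> E\<^sup>*" using step by blast
    then show ?thesis using step(2) by (meson rtrancl.rtrancl_into_rtrancl)
  qed
qed simp

text \<open>
  If a solution keeps \<open>b\<close> and \<open>c\<close>, it deletes an arc on every way from a merging vertex to
  \<open>snd a\<close>; one of these arcs is exchanged for \<open>a\<close>.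
\<close>

lemma deletion_set_meets_branch_arcs:
  assumes fin: "finite E" and ac: "acyclic E" and X: "deletion_set E X" and tri: "branch_arcs E a b c"
  shows "\<exists>X'. deletion_set E X' \<and> card X' \<le> card X \<and> X' \<inter> {a, b, c} \<noteq> {}"
proof (cases "X \<inter> {a, b, c} = {}")
  case True
  obtain x w where a: "a = (x, w)" by fastforce
  have tri': "(x, w) \<in> E" "b \<in> E" "c \<in> E" "b \<noteq> c" "fst b = w" "fst c = w" "after_merge E w"
    "\<And>u. after_merge E u \<Longrightarrow> (u, w) \<in> E\<^sup>+ \<Longrightarrow> \<not> branching E u"
    "after_merge E x \<or> (\<forall>u. (u, w) \<in> E \<longrightarrow> \<not> after_merge E u)"
    using tri unfolding branch_arcs_def a by auto
  have XE: "X \<subseteq> E" "finite X" "merge_branch_free (E - X)"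
    using X fin by (auto simp: deletion_set_def finite_subset)
  have "branching (E - X) w"
    using tri'(2-6) True by (cases b; cases c) (auto simp: branching_def)
  \<comment> \<open>The arcs \<open>b\<close> and \<open>c\<close> survive, so \<open>w\<close>
    still branches and can no longer be bad.\<close>
  then have nw: "\<not> after_merge (E - X) w" using XE by (auto simp: merge_branch_free_def)
  have "\<exists>g h. (g, h) \<in> X \<and> merge_branch_free (E - insert a (X - {(g, h)}))"
  proof (cases "after_merge E x")
    case True
    define E' where "E' = E - {a}"
    have B: "\<not> branching E u" if "after_merge E u" "(u, x) \<in> E\<^sup>*" for u
      using tri'(1,8) that by (meson rtrancl_into_trancl1)
    \<comment> \<open>A bad ancestor of \<open>x\<close> has one outgoing arc at most, so a walk
      starting there is on a fixed track to \<open>x\<close>. The only arc leaving \<open>x\<close>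
      is \<open>a\<close>, which is missing from \<open>E'\<close>: the track ends before any
      branching vertex.\<close>
    have dead: "\<not> branching E' q" if "(h, q) \<in> E''\<^sup>*" "E'' \<subseteq> E'" "after_merge E h" "(h, x) \<in> E\<^sup>*" for h q E''
    proof -
      have "after_merge E q \<and> (q, x) \<in> E\<^sup>*"
        using that(1)
      proof (induction rule: rtrancl_induct)
        case base
        then show ?case using that by simp
      next
        case (step y z)
        then have y: "\<not> branching E y" and yz: "(y, z) \<in> E" "(y, z) \<noteq> a" using B that(2) E'_def by auto
        then have "y \<noteq> x" using tri'(1) a by (auto simp: branching_def)
        then obtain y' where "(y, y') \<in> E" "(y', x) \<in> E\<^sup>*" using step by (meson converse_rtranclE)
        then have "(z, x) \<in> E\<^sup>*" using y yz by (auto simp: branching_def)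
        then show ?case using step yz after_merge_step by (metis r_into_rtrancl)
      qed
      then show ?thesis using B branching_mono[of E' q E] E'_def by blast
    qed
    \<comment> \<open>Going up to the first merging vertex secures the condition on \<open>g\<close>
      in the exchange: a deleted arc entering \<open>z\<close> has a good tail, and one deleted on
      the way from \<open>z\<close> to \<open>x\<close> has a bad and hence non-branching
      tail.\<close>
    obtain z where z: "merging E z" "(z, x) \<in> E\<^sup>*" "\<And>u. (u, z) \<in> E \<Longrightarrow> \<not> after_merge E u"
      using ex_first_merging[OF fin ac True] by blast
    have az: "after_merge E z" using z(1) by (auto simp: after_merge_def)
    have "\<exists>g h. (g, h) \<in> X \<and> (\<not> after_merge E g \<or> \<not> branching E g) \<and> after_merge E h \<and> (h, x) \<in> E\<^sup>*"
    proof (cases "(z, x) \<in> (E - X)\<^sup>*")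
      case True
      moreover have "(x, w) \<in> E - X" using tri'(1) \<open>X \<inter> {a, b, c} = {}\<close> a by auto
      ultimately have "(z, w) \<in> (E - X)\<^sup>*" by (rule rtrancl_into_rtrancl)
      then have "\<not> merging (E - X) z" using nw by (auto simp: after_merge_def)
      then obtain g where "(g, z) \<in> X" using z(1) by (auto simp: merging_def)
      then show ?thesis using z az XE by blast
    next
      case False
      then obtain g h where "(g, h) \<in> X" "(g, h) \<in> E" "(z, g) \<in> E\<^sup>*" "(h, x) \<in> E\<^sup>*"
        using rtrancl_cut z(2) by metis
      moreover from this have "(g, x) \<in> E\<^sup>*" "after_merge E g" "after_merge E h"
        using after_merge_step az by (meson converse_rtrancl_into_rtrancl r_into_rtrancl)+
      ultimately show ?thesis using B by blast
    qed
    then obtain g h where gh: "(g, h) \<in> X" "\<not> after_merge E g \<or> \<not> branching E g"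
      "after_merge E h" "(h, x) \<in> E\<^sup>*" by blast
    have sub: "E - insert a (X - {(g, h)}) \<subseteq> E'" by (auto simp: E'_def)
    have "merge_branch_free (E - insert a (X - {(g, h)}))"
    proof (rule merge_branch_free_exchange[OF XE(3,1) gh(1) _ _ refl gh(2) disjI1])
      show "\<forall>q. (h, q) \<in> (E - insert a (X - {(g, h)}))\<^sup>* \<longrightarrow> \<not> branching (E - insert a (X - {(g, h)})) q"
        using dead[OF _ sub gh(3,4)] branching_mono[OF _ sub] by blast
    qed (use \<open>X \<inter> {a, b, c} = {}\<close> tri in \<open>auto simp: branch_arcs_def\<close>)
    then show ?thesis using gh(1) by blast
  next
    case False
    \<comment> \<open>Now \<open>w\<close> merges by itself. Since \<open>a\<close> is kept and
      \<open>w\<close> has become good, every other arc entering \<open>w\<close> is deleted; any of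
      these can be traded for \<open>a\<close>.\<close>
    then have none: "\<And>u. (u, w) \<in> E \<Longrightarrow> \<not> after_merge E u" using tri'(9) by blast
    then have "merging E w" using tri'(7) after_merge_iff by metis
    then obtain y where y: "y \<noteq> x" "(y, w) \<in> E" unfolding merging_def by metis
    have "(y, w) \<in> X"
    proof (rule ccontr)
      assume "(y, w) \<notin> X"
      then have "merging (E - X) w"
        using y tri'(1) True a by (auto simp: merging_def)
      then show False using nw by (auto simp: after_merge_def)
    qed
    moreover have "merge_branch_free (E - insert a (X - {(y, w)}))"
      by (rule merge_branch_free_exchange[OF XE(3,1) calculation _ _ refl])
         (use True tri'(1) none y a in auto)
    ultimately show ?thesis by blast
  qed
  then obtain f where f: "f \<in> X" "merge_branch_free (E - insert a (X - {f}))" by blast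
  have "a \<notin> X" using True by auto
  then have "card (insert a (X - {f})) = card X"
    using f(1) XE(2) by (metis DiffD1 card.insert card_Suc_Diff1 finite_Diff)
  moreover have "deletion_set E (insert a (X - {f}))"
    using f XE tri' a by (auto simp: deletion_set_def)
  ultimately show ?thesis by (intro exI[of _ "insert a (X - {f})"]) auto
qed (use X in auto)

text \<open>The previous lemma is applied to what remains after deleting \<open>C\<close>, with
  \<open>X - C\<close> as the solution, and \<open>C\<close> is added back.\<close>

lemma deletion_set_extend:
  assumes "finite E" "acyclic E" "deletion_set E X" "C \<subseteq> X" "branch_arcs (E - C) a b c"
  shows "\<exists>e\<in>{a, b, c}. \<exists>X'. deletion_set E X' \<and> insert e C \<subseteq> X' \<and> card X' \<le> card X"
proof -
  have fX: "finite X" "X \<subseteq> E" using assms by (auto simp: deletion_set_def intro: finite_subset)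
  have eq: "E - C - (X - C) = E - X" using assms(4) by auto
  have "deletion_set (E - C) (X - C)"
    using assms(3,4) eq by (auto simp: deletion_set_def)
  then obtain Y where Y: "deletion_set (E - C) Y" "card Y \<le> card (X - C)" "Y \<inter> {a, b, c} \<noteq> {}"
    using deletion_set_meets_branch_arcs[OF _ _ _ assms(5)] assms(1,2) by (meson acyclic_subset Diff_subset finite_Diff)
  have "E - C - Y = E - (Y \<union> C)" by auto
  then have "deletion_set E (Y \<union> C)" using Y(1) assms(4) fX by (auto simp: deletion_set_def)
  moreover have "card (Y \<union> C) \<le> card X"
  proof -
    have "card (Y \<union> C) \<le> card Y + card C" by (rule card_Un_le)
    also have "\<dots> \<le> card (X - C) + card C" using Y(2) by simp
    also have "\<dots> = card X"
      using fX assms(4) by (simp add: card_Diff_subset card_mono finite_subset)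
    finally show ?thesis .
  qed
  ultimately show ?thesis using Y(3) by blast
qed

section \<open>Timed weakest preconditions, and arrays on the random access machine\<close>

section \<open>Programs on arrays\<close>

text \<open>The argument \<open>t\<close> is the time already spent, and the postcondition sees the
  total. Asking for a run gives total correctness, including the absence of word overflow.\<close>

definition wp :: "nat \<Rightarrow> com \<Rightarrow> ((nat \<Rightarrow> nat) \<Rightarrow> (nat \<Rightarrow> nat) \<Rightarrow> nat \<Rightarrow> bool) \<Rightarrow>
    (nat \<Rightarrow> nat) \<Rightarrow> (nat \<Rightarrow> nat) \<Rightarrow> nat \<Rightarrow> bool" where
  "wp W c Q R M t \<longleftrightarrow> (\<exists>u R' M'. exec W c (R, M) u (R', M') \<and> Q R' M' (t + u))"

lemma wp_Skip: "Q R M (t + 1) \<Longrightarrow> wp W Skip Q R M t"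
  unfolding wp_def by (blast intro: exec_Skip)

lemma wp_SetConst: "a \<le> W \<Longrightarrow> Q (R(i := a)) M (t + 1) \<Longrightarrow> wp W (SetConst i a) Q R M t"
  unfolding wp_def by (blast intro: exec_SetConst)

lemma wp_Add:
  "R j + R k \<le> W \<Longrightarrow> Q (R(i := R j + R k)) M (t + 1) \<Longrightarrow> wp W (Add i j k) Q R M t"
  unfolding wp_def by (blast intro: exec_Add)

lemma wp_Sub: "Q (R(i := R j - R k)) M (t + 1) \<Longrightarrow> wp W (Sub i j k) Q R M t"
  unfolding wp_def by (blast intro: exec_Sub)

lemma wp_Load: "Q (R(i := M (R j))) M (t + 1) \<Longrightarrow> wp W (Load i j) Q R M t"
  unfolding wp_def by (blast intro: exec_Load)

lemma wp_Store: "Q R (M(R i := R j)) (t + 1) \<Longrightarrow> wp W (Store i j) Q R M t"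
  unfolding wp_def by (blast intro: exec_Store)

lemma wp_mono:
  assumes "wp W c Q R M t" "\<And>R M t. Q R M t \<Longrightarrow> Q' R M t"
  shows "wp W c Q' R M t"
  using assms unfolding wp_def by blast

lemma wp_Seq:
  assumes "wp W c1 (wp W c2 Q) R M t"
  shows "wp W (Seq c1 c2) Q R M t"
  using assms unfolding wp_def by (metis add.assoc exec_Seq)

lemma wp_If:
  assumes "wp W (if holds b R then c1 else c2) Q R M (t + 1)"
  shows "wp W (If b c1 c2) Q R M t"
proof -
  obtain u R' M' where "exec W (if holds b R then c1 else c2) (R, M) u (R', M')" "Q R' M' (t + 1 + u)"
    using assms unfolding wp_def by blast
  moreover from this have "exec W (If b c1 c2) (R, M) (u + 1) (R', M')"
    by (cases "holds b R") (auto intro: exec_IfTrue exec_IfFalse simp del: add_Suc_right One_nat_def)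
  ultimately show ?thesis unfolding wp_def by (intro exI[of _ "u + 1"]) (auto simp: add_ac)
qed

text \<open>The variant \<open>z\<close> is an argument of the invariant rather than a function of
  the state, so each iteration may choose its new value. Time bounds are part of the
  invariant.\<close>

lemma wp_While:
  assumes "I (z :: nat) R M t"
    and step: "\<And>z R M t. I z R M t \<Longrightarrow> holds b R \<Longrightarrow> wp W c (\<lambda>R M t. \<exists>z'<z. I z' R M t) R M (t + 1)"
    and exit: "\<And>z R M t. I z R M t \<Longrightarrow> \<not> holds b R \<Longrightarrow> Q R M (t + 1)"
  shows "wp W (While b c) Q R M t"
  using assms(1)
proof (induction z arbitrary: R M t rule: less_induct)
  case (less z)
  show ?case
  proof (cases "holds b R")
    case True
    from step[OF less.prems True] obtain u R' M' z' where u: "exec W c (R, M) u (R', M')"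
      "z' < z" "I z' R' M' (t + 1 + u)" unfolding wp_def by blast
    from less.IH[OF u(2,3)] obtain u' R'' M'' where
      "exec W (While b c) (R', M') u' (R'', M'')" "Q R'' M'' (t + 1 + u + u')"
      unfolding wp_def by blast
    moreover from this(1) u(1) True have "exec W (While b c) (R, M) (u + u' + 1) (R'', M'')"
      by (auto intro!: exec_WhileTrue simp del: add_Suc_right One_nat_def)
    ultimately show ?thesis unfolding wp_def by (intro exI[of _ "u + u' + 1"]) (auto simp: add_ac)
  next
    case False
    then have "exec W (While b c) (R, M) 1 (R, M)" by (intro exec_WhileFalse) simp
    then show ?thesis using exit[OF less.prems False] unfolding wp_def by blast
  qed
qed

text \<open>
  The memory is divided into twelve arrays of the same length \<open>S\<close>. Registers below 39 are
  available to array programs; register 39 holds addresses and register \<open>40 + k\<close> the address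
  at which array \<open>k\<close> starts.
\<close>

datatype acom =
    AConst nat nat
  | AAdd nat nat nat
  | ASub nat nat nat
  | ALoad nat nat nat
  | AStore nat nat nat
  | ASkip
  | ASeq acom acom (infixr \<open>;;\<close> 60)
  | AIf test acom acom
  | AWhile test acom

primrec compile :: "acom \<Rightarrow> com" where
  "compile (AConst d a) = SetConst d a"
| "compile (AAdd d i j) = Add d i j"
| "compile (ASub d i j) = Sub d i j"
| "compile (ALoad d k i) = Seq (Add 39 (40 + k) i) (Load d 39)"
| "compile (AStore k i j) = Seq (Add 39 (40 + k) i) (Store 39 j)"
| "compile ASkip = Skip"
| "compile (c1 ;; c2) = Seq (compile c1) (compile c2)"
| "compile (AIf b c1 c2) = If b (compile c1) (compile c2)"
| "compile (AWhile b c) = While b (compile c)"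

primrec test_regs :: "test \<Rightarrow> nat set" where
  "test_regs (Less i j) = {i, j}"
| "test_regs (Equal i j) = {i, j}"

type_synonym apost = "(nat \<Rightarrow> nat) \<Rightarrow> (nat \<Rightarrow> nat \<Rightarrow> nat) \<Rightarrow> nat \<Rightarrow> bool"

text \<open>Defined by recursion on the program so that the simplifier can execute loop-free code
  symbolically. For a loop, some invariant with a variant must exist; the side conditions keep
  registers and indices within the layout.\<close>

primrec pre :: "nat \<Rightarrow> nat \<Rightarrow> acom \<Rightarrow> apost \<Rightarrow> apost" where
  "pre W S (AConst d a) Q R A t \<longleftrightarrow> d < 39 \<and> a \<le> W \<and> Q (R(d := a)) A (t + 1)"
| "pre W S (AAdd d i j) Q R A t \<longleftrightarrow> d < 39 \<and> i < 39 \<and> j < 39 \<and> R i + R j \<le> W \<and>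
    Q (R(d := R i + R j)) A (t + 1)"
| "pre W S (ASub d i j) Q R A t \<longleftrightarrow> d < 39 \<and> i < 39 \<and> j < 39 \<and>
    Q (R(d := R i - R j)) A (t + 1)"
| "pre W S (ALoad d k i) Q R A t \<longleftrightarrow> d < 39 \<and> i < 39 \<and> k < 12 \<and> R i < S \<and>
    Q (R(d := A k (R i))) A (t + 2)"
| "pre W S (AStore k i j) Q R A t \<longleftrightarrow> i < 39 \<and> j < 39 \<and> k < 12 \<and> R i < S \<and>
    Q R (A(k := (A k)(R i := R j))) (t + 2)"
| "pre W S ASkip Q R A t \<longleftrightarrow> Q R A (t + 1)"
| "pre W S (c1 ;; c2) Q R A t \<longleftrightarrow> pre W S c1 (pre W S c2 Q) R A t"
| "pre W S (AIf b c1 c2) Q R A t \<longleftrightarrow> test_regs b \<subseteq> {..<39} \<and>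
    (holds b R \<longrightarrow> pre W S c1 Q R A (t + 1)) \<and> (\<not> holds b R \<longrightarrow> pre W S c2 Q R A (t + 1))"
| "pre W S (AWhile b c) Q R A t \<longleftrightarrow> test_regs b \<subseteq> {..<39} \<and>
    (\<exists>I. (\<exists>z::nat. I z R A t) \<and>
      (\<forall>z R A t. I z R A t \<longrightarrow>
         (holds b R \<longrightarrow> pre W S c (\<lambda>R A t. \<exists>z'<z. I z' R A t) R A (t + 1)) \<and>
         (\<not> holds b R \<longrightarrow> Q R A (t + 1))))"

declare pre.simps(9) [simp del]

lemma pre_While:
  assumes "I (z :: nat) R A t" "test_regs b \<subseteq> {..<39}"
    and "\<And>z R A t. I z R A t \<Longrightarrow> holds b R \<Longrightarrow> pre W S c (\<lambda>R A t. \<exists>z'<z. I z' R A t) R A (t + 1)"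
    and "\<And>z R A t. I z R A t \<Longrightarrow> \<not> holds b R \<Longrightarrow> Q R A (t + 1)"
  shows "pre W S (AWhile b c) Q R A t"
  unfolding pre.simps using assms by (intro conjI exI[of _ I]) blast+

lemma pre_Seq: "pre W S (c1 ;; c2) Q = pre W S c1 (pre W S c2 Q)"
  by (intro ext) simp

text \<open>Register 39 is left free as scratch space for addresses, and memory beyond the twelve
  arrays is unconstrained.\<close>

definition represents :: "nat \<Rightarrow> (nat \<Rightarrow> nat) \<Rightarrow> (nat \<Rightarrow> nat \<Rightarrow> nat) \<Rightarrow>
    (nat \<Rightarrow> nat) \<Rightarrow> (nat \<Rightarrow> nat) \<Rightarrow> bool" where
  "represents S R A R' M' \<longleftrightarrow> (\<forall>r<39. R' r = R r) \<and> (\<forall>k<12. R' (40 + k) = k * S) \<and>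
     (\<forall>k<12. \<forall>i<S. M' (k * S + i) = A k i)"

lemma array_index_inject:
  assumes "(i::nat) < S" "j < S"
  shows "k * S + i = l * S + j \<longleftrightarrow> k = l \<and> i = j"
proof
  assume eq: "k * S + i = l * S + j"
  have "(k * S + i) div S = k" "(l * S + j) div S = l" using assms by auto
  then show "k = l \<and> i = j" using eq by auto
qed simp

lemma array_address:
  assumes "(k::nat) < 12" "i < S" shows "k * S + i < 12 * S"
proof -
  have "k * S + i < (k + 1) * S" using assms by simp
  also have "\<dots> \<le> 12 * S" using assms by (intro mult_le_mono1) simp
  finally show ?thesis .
qed

lemma holds_cong: "test_regs b \<subseteq> {..<39} \<Longrightarrow> \<forall>r<39. R' r = R r \<Longrightarrow> holds b R' = holds b R"
  by (cases b) auto

text \<open>The bound on \<open>W\<close> makes every address computation fit into a word. For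
  loops, the concrete invariant says that some represented array state satisfies the abstract one,
  with the same variant.\<close>

lemma compile_sound:
  assumes "pre W S c Q R A t" "represents S R A R' M'" "12 * S \<le> W"
  shows "wp W (compile c) (\<lambda>R' M' t. \<exists>R A. represents S R A R' M' \<and> Q R A t) R' M' t"
  using assms(1,2)
proof (induction c arbitrary: Q R A t R' M')
  case (AConst d a)
  then show ?case
    by (auto simp: represents_def intro!: wp_SetConst exI[of _ "R(d := a)"] exI[of _ A])
next
  case (AAdd d i j)
  then show ?case
    by (auto simp: represents_def intro!: wp_Add exI[of _ "R(d := R i + R j)"] exI[of _ A])
next
  case (ASub d i j)
  then show ?case
    by (auto simp: represents_def intro!: wp_Sub exI[of _ "R(d := R i - R j)"] exI[of _ A])
next
  case (ALoad d k i)
  have "represents S (R(d := A k (R i))) A (R'(39 := k * S + R i, d := M' (k * S + R i))) M'"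
    using ALoad by (auto simp: represents_def)
  moreover have "R' (40 + k) + R' i = k * S + R i" "k * S + R i \<le> W"
    using ALoad array_address[of k "R i" S] assms(3) by (auto simp: represents_def)
  ultimately show ?case
    unfolding compile.simps using ALoad.prems(1)
    by (intro wp_Seq wp_Add wp_Load) (auto simp del: fun_upd_apply simp: fun_upd_same)
next
  case (AStore k i j)
  have "represents S R (A(k := (A k)(R i := R j))) (R'(39 := k * S + R i))
      (M'(k * S + R i := R' j))"
    using AStore by (auto simp: represents_def array_index_inject)
  moreover have "R' (40 + k) + R' i = k * S + R i" "k * S + R i \<le> W" "j \<noteq> 39"
    using AStore array_address[of k "R i" S] assms(3) by (auto simp: represents_def)
  ultimately show ?case
    unfolding compile.simps using AStore.prems(1)
    by (intro wp_Seq wp_Add wp_Store) (auto simp del: fun_upd_apply simp: fun_upd_same fun_upd_other)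
next
  case ASkip
  then show ?case unfolding compile.simps by (intro wp_Skip exI[of _ R] exI[of _ A]) simp
next
  case (ASeq c1 c2)
  have "pre W S c1 (pre W S c2 Q) R A t" using ASeq.prems(1) by simp
  from ASeq.IH(1)[OF this ASeq.prems(2)] show ?case
    unfolding compile.simps by (intro wp_Seq) (erule wp_mono, blast intro: ASeq.IH(2))
next
  case (AIf b c1 c2)
  have "holds b R' = holds b R" using AIf.prems holds_cong by (auto simp: represents_def)
  then show ?case
    unfolding compile.simps
    using AIf.prems(1) AIf.IH(1)[OF _ AIf.prems(2)] AIf.IH(2)[OF _ AIf.prems(2)]
    by (intro wp_If) simp
next
  case (AWhile b c)
  from AWhile.prems(1) obtain I z where b: "test_regs b \<subseteq> {..<39}" and "I (z::nat) R A t"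
    and I: "\<And>z R A t. I z R A t \<Longrightarrow>
         (holds b R \<longrightarrow> pre W S c (\<lambda>R A t. \<exists>z'<z. I z' R A t) R A (t + 1)) \<and>
         (\<not> holds b R \<longrightarrow> Q R A (t + 1))"
    unfolding pre.simps by blast
  let ?J = "\<lambda>z R' M' t. \<exists>R A. represents S R A R' M' \<and> I z R A t"
  have h: "holds b R' = holds b R" if "represents S R A R' M'" for R A R' M'
    using holds_cong[OF b] that by (auto simp: represents_def)
  show ?case
    unfolding compile.simps
  proof (rule wp_While[of ?J z])
    show "?J z R' M' t" using \<open>I z R A t\<close> AWhile.prems by blast
  next
    fix z R' M' t assume "?J z R' M' t" "holds b R'"
    then obtain R A where RA: "represents S R A R' M'" "I z R A t" "holds b R" using h by blast
    then have "pre W S c (\<lambda>R A t. \<exists>z'<z. I z' R A t) R A (t + 1)" using I by blast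
    from AWhile.IH[OF this RA(1)]
    show "wp W (compile c) (\<lambda>R M t. \<exists>z'<z. ?J z' R M t) R' M' (t + 1)"
      by (rule wp_mono) blast
  next
    fix z R' M' t assume "?J z R' M' t" "\<not> holds b R'"
    then show "\<exists>R A. represents S R A R' M' \<and> Q R A (t + 1)" using h I by blast
  qed
qed

section \<open>Kahn's algorithm, listing the arcs by the position of their tails\<close>

section \<open>Topological sorting\<close>

abbreviation (input) "rN \<equiv> 2::nat"
abbreviation (input) "rM \<equiv> 3::nat"
abbreviation (input) "rOne \<equiv> 4::nat"
abbreviation (input) "rZero \<equiv> 5::nat"
abbreviation (input) "rI \<equiv> 6::nat"
abbreviation (input) "rA \<equiv> 7::nat"
abbreviation (input) "rB \<equiv> 8::nat"
abbreviation (input) "rC \<equiv> 9::nat"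
abbreviation (input) "rD \<equiv> 10::nat"

abbreviation (input) "aIN \<equiv> 2::nat"
abbreviation (input) "aLAST \<equiv> 3::nat"
abbreviation (input) "aPREV \<equiv> 4::nat"
abbreviation (input) "aQUEUE \<equiv> 5::nat"
abbreviation (input) "aTAIL \<equiv> 6::nat"
abbreviation (input) "aHEAD \<equiv> 7::nat"

abbreviation (input) "rFront \<equiv> 11::nat"
abbreviation (input) "rBack \<equiv> 12::nat"
abbreviation (input) "rPtr \<equiv> 13::nat"
abbreviation (input) "rX \<equiv> 14::nat"

text \<open>Array 0 holds the input: \<open>n\<close>, \<open>m\<close>, then arc \<open>i\<close>
  in cells \<open>2 * i + 2\<close> and \<open>2 * i + 3\<close>. Besides counting in-degrees, the
  loop threads the arcs with the same tail into a linked list. \<open>aLAST\<close> points to its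
  end and \<open>aPREV\<close> to the predecessor; a pointer is an index plus 1, and 0 means
  none.\<close>

definition index_arcs :: acom where
  "index_arcs = AWhile (Less rI rM)
    (AAdd rA rI rI ;; AAdd rA rA rOne ;; AAdd rA rA rOne ;; ALoad rB 0 rA ;;
     AAdd rA rA rOne ;; ALoad rC 0 rA ;;
     ALoad rD aIN rC ;; AAdd rD rD rOne ;; AStore aIN rC rD ;;
     ALoad rD aLAST rB ;; AStore aPREV rI rD ;; AAdd rI rI rOne ;; AStore aLAST rB rI)"

definition enqueue_sources :: acom where
  "enqueue_sources = AWhile (Less rI rN)
    (ALoad rA aIN rI ;;
     AIf (Equal rA rZero) (AStore aQUEUE rBack rI ;; AAdd rBack rBack rOne) ASkip ;;
     AAdd rI rI rOne)"

text \<open>The loops over the queue and over the arcs of a vertex are flattened into one, so that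
  each iteration either dequeues a vertex or emits an arc.\<close>

definition emit_arcs :: acom where
  "emit_arcs = AWhile (Less rI rM)
    (AIf (Equal rPtr rZero)
      (ALoad rX aQUEUE rFront ;; AAdd rFront rFront rOne ;; ALoad rPtr aLAST rX)
      (ASub rPtr rPtr rOne ;; AAdd rA rPtr rPtr ;; AAdd rA rA rOne ;; AAdd rA rA rOne ;;
       AAdd rA rA rOne ;; ALoad rB 0 rA ;;
       AStore aTAIL rI rX ;; AStore aHEAD rI rB ;; AAdd rI rI rOne ;;
       ALoad rD aIN rB ;; ASub rD rD rOne ;; AStore aIN rB rD ;;
       AIf (Equal rD rZero) (AStore aQUEUE rBack rB ;; AAdd rBack rBack rOne) ASkip ;;
       ALoad rPtr aPREV rPtr))"

text \<open>The pointer value of the linked lists, shifted by 1 so that 0 ends a list.\<close>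

primrec prev_arc :: "('a \<times> 'b) list \<Rightarrow> 'a \<Rightarrow> nat \<Rightarrow> nat" where
  "prev_arc es u 0 = 0"
| "prev_arc es u (Suc i) = (if fst (es ! i) = u then Suc i else prev_arc es u i)"

lemma prev_arc_le: "prev_arc es u i \<le> i"
  by (induction i) auto

lemma prev_arc_greatest: "prev_arc es u i \<le> j \<Longrightarrow> j < i \<Longrightarrow> fst (es ! j) \<noteq> u"
  by (induction i) (auto split: if_splits simp: less_Suc_eq)

lemma prev_arc_tail: "prev_arc es u i = Suc j \<Longrightarrow> fst (es ! j) = u"
  by (induction i) (auto split: if_splits)

definition in_count :: "('a \<times> 'b) list \<Rightarrow> 'b \<Rightarrow> nat \<Rightarrow> nat" where
  "in_count es v i = card {j. j < i \<and> snd (es ! j) = v}"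

lemma in_count_0 [simp]: "in_count es v 0 = 0"
  by (simp add: in_count_def)

lemma in_count_Suc [simp]:
  "in_count es v (Suc i) = in_count es v i + (if snd (es ! i) = v then 1 else 0)"
proof -
  have "{j. j < Suc i \<and> snd (es ! j) = v} =
      {j. j < i \<and> snd (es ! j) = v} \<union> (if snd (es ! i) = v then {i} else {})"
    by (auto simp: less_Suc_eq)
  then show ?thesis by (auto simp: in_count_def card_insert_if)
qed

lemma in_count_le: "in_count es v i \<le> i"
  by (induction i) auto

definition std_regs :: "nat \<Rightarrow> nat \<Rightarrow> (nat \<Rightarrow> nat) \<Rightarrow> bool" where
  "std_regs n m R \<longleftrightarrow> R rN = n \<and> R rM = m \<and> R rOne = 1 \<and> R rZero = 0"

text \<open>One length \<open>S\<close> serves all arrays: the input takes \<open>2 * m + 2\<close>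
  cells, a vertex array \<open>n\<close>, the deletion levels \<open>m + 1\<close>, and the search
  stack will stay within \<open>2 * m + 1\<close> entries.\<close>

locale ram_dag =
  fixes n m W S :: nat and es :: "(nat \<times> nat) list"
  assumes len: "length es = m"
    and verts: "\<And>u v. (u, v) \<in> set es \<Longrightarrow> u < n \<and> v < n"
    and dist: "distinct es"
    and acyc: "acyclic (set es)"
    and size: "n + 3 * m + 8 \<le> S" "12 * S \<le> W"
begin

lemma arc_in: "i < m \<Longrightarrow> es ! i \<in> set es"
  using len by simp

lemma tail_less: "i < m \<Longrightarrow> fst (es ! i) < n"
  and head_less: "i < m \<Longrightarrow> snd (es ! i) < n"
  using verts arc_in by (metis prod.collapse)+

definition input_arcs :: "(nat \<Rightarrow> nat) \<Rightarrow> bool" where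
  "input_arcs a \<longleftrightarrow> (\<forall>i<m. a (Suc (Suc (i + i))) = fst (es ! i) \<and> a (Suc (Suc (Suc (i + i)))) = snd (es ! i))"

text \<open>The factor 30 per arc is a generous bound on the cost of one iteration, as are the
  corresponding factors of the other loops; only linearity matters.\<close>

lemma index_arcs_correct:
  assumes "std_regs n m R" "R rI = 0" "input_arcs (A 0)" "\<And>v. v < n \<Longrightarrow> A aIN v = 0" "\<And>v. v < n \<Longrightarrow> A aLAST v = 0"
    and Q: "\<And>R' A' t'. std_regs n m R' \<Longrightarrow> \<forall>r\<in>{rFront, rBack, rPtr}. R' r = R r \<Longrightarrow>
      \<forall>k. k \<notin> {aIN, aLAST, aPREV} \<longrightarrow> A' k = A k \<Longrightarrow>
      (\<forall>v<n. A' aIN v = in_count es v m) \<Longrightarrow>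
      (\<forall>v<n. A' aLAST v = prev_arc es v m) \<Longrightarrow>
      (\<forall>i<m. A' aPREV i = prev_arc es (fst (es ! i)) i) \<Longrightarrow>
      t' \<le> t + 30 * m + 1 \<Longrightarrow> Q R' A' t'"
  shows "pre W S index_arcs Q R A t"
proof -
  define I where "I z R' A' t' \<longleftrightarrow> z = m - R' rI \<and> R' rI \<le> m \<and> std_regs n m R' \<and>
      (\<forall>r\<in>{rFront, rBack, rPtr}. R' r = R r) \<and>
      (\<forall>k. k \<notin> {aIN, aLAST, aPREV} \<longrightarrow> A' k = A k) \<and>
      (\<forall>v<n. A' aIN v = in_count es v (R' rI)) \<and>
      (\<forall>v<n. A' aLAST v = prev_arc es v (R' rI)) \<and>
      (\<forall>i<R' rI. A' aPREV i = prev_arc es (fst (es ! i)) i) \<and>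
      t' \<le> t + 30 * R' rI" for z R' A' t'
  show ?thesis
    unfolding index_arcs_def
  proof (rule pre_While[of I m])
    show "I m R A t" using assms(1-5) by (simp add: I_def)
  next
    fix z R' A' t' assume I: "I z R' A' t'" and h: "holds (Less rI rM) R'"
    define i where "i = R' rI"
    have i: "i < m" using h I by (simp add: I_def std_regs_def i_def)
    have c: "A' 0 (Suc (Suc (i + i))) = fst (es ! i)" "A' 0 (Suc (Suc (Suc (i + i)))) = snd (es ! i)"
      using I assms(3) i by (auto simp: I_def input_arcs_def)
    show "pre W S (AAdd rA rI rI ;; AAdd rA rA rOne ;; AAdd rA rA rOne ;; ALoad rB 0 rA ;;
     AAdd rA rA rOne ;; ALoad rC 0 rA ;;
     ALoad rD aIN rC ;; AAdd rD rD rOne ;; AStore aIN rC rD ;;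
     ALoad rD aLAST rB ;; AStore aPREV rI rD ;; AAdd rI rI rOne ;; AStore aLAST rB rI)
      (\<lambda>R A t. \<exists>z'<z. I z' R A t) R' A' (t' + 1)"
      using I i c tail_less[OF i] head_less[OF i] size in_count_le[of es "snd (es ! i)" i] i_def[symmetric]
      by (auto simp: I_def std_regs_def less_Suc_eq)
  next
    fix z R' A' t' assume I: "I z R' A' t'" and h: "\<not> holds (Less rI rM) R'"
    then have "R' rI = m" by (auto simp: I_def std_regs_def)
    then show "Q R' A' (t' + 1)"
      using I unfolding I_def by (intro Q) auto
  qed simp
qed

lemma enqueue_sources_correct:
  assumes "std_regs n m R" "R rI = 0" "R rBack = 0"
    and Q: "\<And>R' A' t'. std_regs n m R' \<Longrightarrow> \<forall>r\<in>{rFront, rPtr}. R' r = R r \<Longrightarrow>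
      \<forall>k. k \<noteq> aQUEUE \<longrightarrow> A' k = A k \<Longrightarrow> R' rBack \<le> n \<Longrightarrow>
      set (map (A' aQUEUE) [0..<R' rBack]) = {v. v < n \<and> A aIN v = 0} \<Longrightarrow>
      distinct (map (A' aQUEUE) [0..<R' rBack]) \<Longrightarrow>
      t' \<le> t + 30 * n + 1 \<Longrightarrow> Q R' A' t'"
  shows "pre W S enqueue_sources Q R A t"
proof -
  define I where "I z R' A' t' \<longleftrightarrow> z = n - R' rI \<and> R' rI \<le> n \<and> std_regs n m R' \<and>
      (\<forall>r\<in>{rFront, rPtr}. R' r = R r) \<and>
      (\<forall>k. k \<noteq> aQUEUE \<longrightarrow> A' k = A k) \<and> R' rBack \<le> R' rI \<and>
      set (map (A' aQUEUE) [0..<R' rBack]) = {v. v < R' rI \<and> A aIN v = 0} \<and>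
      distinct (map (A' aQUEUE) [0..<R' rBack]) \<and>
      t' \<le> t + 30 * R' rI" for z R' A' t'
  show ?thesis
    unfolding enqueue_sources_def
  proof (rule pre_While[of I n])
    show "I n R A t" using assms(1-3) by (simp add: I_def)
  next
    fix z R' A' t' assume I: "I z R' A' t'" and h: "holds (Less rI rN) R'"
    show "pre W S (ALoad rA aIN rI ;;
     AIf (Equal rA rZero) (AStore aQUEUE rBack rI ;; AAdd rBack rBack rOne) ASkip ;;
     AAdd rI rI rOne) (\<lambda>R A t. \<exists>z'<z. I z' R A t) R' A' (t' + 1)"
      using I h size
      by (auto simp: I_def std_regs_def less_Suc_eq simp del: set_map)
  next
    fix z R' A' t' assume I: "I z R' A' t'" and h: "\<not> holds (Less rI rN) R'"
    then have "R' rI = n" by (auto simp: I_def std_regs_def)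
    then show "Q R' A' (t' + 1)"
      using I unfolding I_def by (intro Q) auto
  qed simp
qed


text \<open>
  In \<open>kahn Q f x p a T\<close>, \<open>Q\<close> lists the vertices queued so far, \<open>f\<close> of which have been taken
  out; \<open>x\<close> is the last of these, and its outgoing arcs with an index below \<open>p\<close> are still to be
  appended to the output \<open>T\<close>. The number of arcs entering \<open>v\<close> that are not yet in \<open>T\<close> is \<open>a v\<close>.
\<close>

definition emitted :: "nat list \<Rightarrow> nat \<Rightarrow> nat \<Rightarrow> nat \<Rightarrow> nat set" where
  "emitted Q f x p = {j. j < m \<and> fst (es ! j) \<in> set (take f Q) \<and> \<not> (fst (es ! j) = x \<and> j < p)}"

definition kahn :: "nat list \<Rightarrow> nat \<Rightarrow> nat \<Rightarrow> nat \<Rightarrow> (nat \<Rightarrow> nat) \<Rightarrow> (nat \<times> nat) list \<Rightarrow> bool" where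
  "kahn Q f x p a T \<longleftrightarrow> f \<le> length Q \<and> distinct Q \<and>
     (f = 0 \<longrightarrow> p = 0) \<and> (f > 0 \<longrightarrow> x = Q ! (f - 1)) \<and>
     p \<le> m \<and> (p > 0 \<longrightarrow> fst (es ! (p - 1)) = x) \<and>
     (\<forall>v<n. a v = card {i. i < m \<and> i \<notin> emitted Q f x p \<and> snd (es ! i) = v}) \<and>
     set Q = {v. v < n \<and> a v = 0} \<and>
     (\<forall>b<length Q. \<forall>i<m. snd (es ! i) = Q ! b \<longrightarrow> (\<exists>c<b. Q ! c = fst (es ! i))) \<and>
     set T = (!) es ` emitted Q f x p \<and> length T = card (emitted Q f x p) \<and>
     (\<forall>j<length T. \<forall>i\<le>j. \<exists>c d. c \<le> d \<and> d < f \<and> fst (T ! i) = Q ! c \<and> fst (T ! j) = Q ! d)"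

lemma kahnD:
  assumes "kahn Q f x p a T"
  shows "f \<le> length Q" "distinct Q" "set Q = {v. v < n \<and> a v = 0}"
    "v < n \<Longrightarrow> a v = card {i. i < m \<and> i \<notin> emitted Q f x p \<and> snd (es ! i) = v}"
    "b < length Q \<Longrightarrow> i < m \<Longrightarrow> snd (es ! i) = Q ! b \<Longrightarrow> \<exists>c<b. Q ! c = fst (es ! i)"
    "set T = (!) es ` emitted Q f x p" "length T = card (emitted Q f x p)"
    "j < length T \<Longrightarrow> i \<le> j \<Longrightarrow>
      \<exists>c d. c \<le> d \<and> d < f \<and> fst (T ! i) = Q ! c \<and> fst (T ! j) = Q ! d"
  using assms unfolding kahn_def by blast+

lemma finite_emitted [simp]: "finite (emitted Q f x p)"
  by (simp add: emitted_def)

lemma kahn_bounds: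
  assumes "kahn Q f x p a T"
  shows "length Q \<le> n" "length T \<le> m"
proof -
  have "length Q = card (set Q)" using assms distinct_card[of Q] unfolding kahn_def by metis
  also have "\<dots> \<le> card {..<n}" using assms by (intro card_mono) (auto simp: kahn_def)
  finally show "length Q \<le> n" by simp
  have "card (emitted Q f x p) \<le> card {..<m}"
    by (intro card_mono) (auto simp: emitted_def)
  then show "length T \<le> m" using assms by (simp add: kahn_def)
qed

lemma kahn_init:
  assumes "distinct Q" "set Q = {v. v < n \<and> a v = 0}" "\<And>v. v < n \<Longrightarrow> a v = in_count es v m"
  shows "kahn Q 0 x 0 a []"
proof -
  have em: "emitted Q 0 x 0 = {}" by (simp add: emitted_def)
  have "False" if "b < length Q" "i < m" "snd (es ! i) = Q ! b" for b i
  proof -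
    have "Q ! b \<in> set Q" using that by simp
    then have "in_count es (Q ! b) m = 0" using assms by auto
    then show False using that by (auto simp: in_count_def)
  qed
  then show ?thesis
    using assms em by (auto simp: kahn_def in_count_def)
qed

text \<open>All arcs leaving the dequeued vertex become pending at once, because their indices lie
  below the pointer to the end of its list. So \<open>emitted\<close> does not change.\<close>

lemma kahn_pop:
  assumes "kahn Q f x 0 a T" "f < length Q"
  shows "kahn Q (Suc f) (Q ! f) (prev_arc es (Q ! f) m) a T"
proof -
  have tk: "take (Suc f) Q = take f Q @ [Q ! f]" using assms(2) by (rule take_Suc_conv_app_nth)
  have new: "Q ! f \<notin> set (take f Q)"
    using assms unfolding kahn_def by (auto simp: in_set_conv_nth nth_eq_iff_index_eq)
  have em: "emitted Q (Suc f) (Q ! f) (prev_arc es (Q ! f) m) = emitted Q f x 0"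
    using new prev_arc_greatest[of es "Q ! f" m] unfolding emitted_def tk
    by (auto simp: not_less)
  note K = assms(1)[unfolded kahn_def]
  show ?thesis
    unfolding kahn_def em
  proof (intro conjI)
    show "Suc f \<le> length Q" using assms(2) by simp
    show "0 < prev_arc es (Q ! f) m \<longrightarrow> fst (es ! (prev_arc es (Q ! f) m - 1)) = Q ! f"
      using prev_arc_tail[of es "Q ! f" m "prev_arc es (Q ! f) m - 1"] by simp
    show "\<forall>j<length T. \<forall>i\<le>j. \<exists>c d. c \<le> d \<and> d < Suc f \<and> fst (T ! i) = Q ! c \<and> fst (T ! j) = Q ! d"
      using kahnD(8)[OF assms(1)] less_SucI by meson
  qed (use K prev_arc_le[of es "Q ! f" m] in \<open>simp; fail\<close> | use K in blast)+
qed

text \<open>The pointer skips from \<open>i\<close> to the previous arc with the same tail, so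
  \<open>emitted\<close> gains exactly \<open>i\<close>. If the counter of \<open>y\<close> was 1,
  this was the last pending arc entering \<open>y\<close>, which may now be queued.\<close>

lemma kahn_emit:
  assumes "kahn Q f x (Suc i) a T" and y: "y = snd (es ! i)"
  shows "i < m" "fst (es ! i) = x" "0 < a y" "length T < m" "a y = 1 \<Longrightarrow> length Q < n"
    "kahn (if a y = 1 then Q @ [y] else Q) f x (prev_arc es x i) (a(y := a y - 1)) (T @ [(x, y)])"
proof -
  note K = assms(1)[unfolded kahn_def]
  note Kpar = kahnD(5)[OF assms(1)] and KT = kahnD(6,7)[OF assms(1)] and Kord = kahnD(8)[OF assms(1)]
  show i: "i < m" using K by simp
  show x: "fst (es ! i) = x" using K by simp
  have f: "f > 0" "f \<le> length Q" "x = Q ! (f - 1)" using K by auto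
  have "x \<in> set (take f Q)" using f by (auto simp: in_set_conv_nth intro!: exI[of _ "f - 1"])
  have yn: "y < n" using head_less[OF i] y by simp
  let ?E = "emitted Q f x (Suc i)" and ?p = "prev_arc es x i"
  have i': "i \<notin> ?E" using x by (simp add: emitted_def)
  have E: "emitted Q f x ?p = insert i ?E"
    using \<open>x \<in> _\<close> x i prev_arc_le[of es x i] prev_arc_greatest[of es x i] unfolding emitted_def
    by (auto simp: less_Suc_eq not_less) (metis linorder_not_less)
  have ay: "a y = card {k. k < m \<and> k \<notin> ?E \<and> snd (es ! k) = y}" using K yn by simp
  have "i \<in> {k. k < m \<and> k \<notin> ?E \<and> snd (es ! k) = y}" using i i' y by simp
  then show pos: "0 < a y" unfolding ay by (auto simp: card_gt_0_iff)
  have nQ: "y \<notin> set Q" using pos K by simp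
  have "card (insert i ?E) \<le> card {..<m}"
    using i by (intro card_mono) (auto simp: emitted_def)
  then show lenT: "length T < m" using K i' by simp
  let ?Q = "if a y = 1 then Q @ [y] else Q" and ?a = "a(y := a y - 1)"
  have lenQ: "length Q < n"
  proof -
    have Qn: "set Q \<subseteq> {..<n}" using K by blast
    have "length Q = card (set Q)" using K distinct_card[of Q] by metis
    also have "\<dots> < card {..<n}" using Qn yn nQ by (intro psubset_card_mono) auto
    finally show ?thesis by simp
  qed
  then show "a y = 1 \<Longrightarrow> length Q < n" .
  have E': "emitted ?Q f x ?p = insert i ?E" using E f by (simp add: emitted_def)
  have cnt: "?a v = card {k. k < m \<and> k \<notin> insert i ?E \<and> snd (es ! k) = v}" if "v < n" for v
  proof (cases "v = y")
    case True
    have "{k. k < m \<and> k \<notin> insert i ?E \<and> snd (es ! k) = y} =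
        {k. k < m \<and> k \<notin> ?E \<and> snd (es ! k) = y} - {i}" by auto
    then show ?thesis
      using True ay \<open>i \<in> {k. k < m \<and> k \<notin> ?E \<and> snd (es ! k) = y}\<close> by simp
  next
    case False
    have "{k. k < m \<and> k \<notin> insert i ?E \<and> snd (es ! k) = v} =
        {k. k < m \<and> k \<notin> ?E \<and> snd (es ! k) = v}" using False y by auto
    then show ?thesis using False that K by simp
  qed
  have setQ: "set ?Q = {v. v < n \<and> ?a v = 0}"
    using K yn pos by auto
  have par: "\<exists>c<b. ?Q ! c = fst (es ! k)" if b: "b < length ?Q" "k < m" "snd (es ! k) = ?Q ! b" for b k
  proof (cases "b < length Q")
    case True
    then have Q': "?Q ! c = Q ! c" if "c \<le> b" for c using that by (simp add: nth_append)
    then obtain c where "c < b" "Q ! c = fst (es ! k)" using Kpar[OF True b(2)] b(3) by auto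
    then show ?thesis using Q' by (intro exI[of _ c]) simp
  next
    case False
    \<comment> \<open>The entry in question is the newly queued \<open>y\<close>. All arcs entering
      it have been emitted, so their tails were dequeued and stand earlier in the queue.\<close>
    then have "a y = 1" "b = length Q" using b by (auto split: if_splits)
    then have "snd (es ! k) = y" using b by (simp add: nth_append)
    moreover have "?a y = 0" using \<open>a y = 1\<close> by simp
    then have "{k. k < m \<and> k \<notin> insert i ?E \<and> snd (es ! k) = y} = {}" using cnt[OF yn] by simp
    ultimately have "k \<in> insert i ?E" using b by blast
    then have "fst (es ! k) \<in> set (take f Q)" using \<open>x \<in> _\<close> x by (auto simp: emitted_def)
    then obtain c where "c < f" "Q ! c = fst (es ! k)" using f by (auto simp: in_set_conv_nth)
    then show ?thesis using f \<open>b = length Q\<close> by (intro exI[of _ c]) (auto simp: nth_append)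
  qed
  have ord: "\<exists>c d. c \<le> d \<and> d < f \<and> fst ((T @ [(x, y)]) ! k) = ?Q ! c \<and> fst ((T @ [(x, y)]) ! j) = ?Q ! d"
    if j: "j < length (T @ [(x, y)])" "k \<le> j" for j k
  proof -
    have Q': "c < f \<Longrightarrow> ?Q ! c = Q ! c" for c using f by (auto simp: nth_append)
    show ?thesis
    proof (cases "j < length T")
      case True
      then obtain c d where "c \<le> d" "d < f" "fst (T ! k) = Q ! c" "fst (T ! j) = Q ! d"
        using Kord[of j k] j by blast
      then show ?thesis using True j Q' by (intro exI[of _ c] exI[of _ d]) (auto simp: nth_append)
    next
      case False
      then have jT: "j = length T" using j by simp
      have "\<exists>c<f. fst ((T @ [(x, y)]) ! k) = Q ! c"
      proof (cases "k < length T")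
        case True
        then obtain c d where "c \<le> d" "d < f" "fst (T ! k) = Q ! c" using Kord[of k k] by blast
        then show ?thesis using True by (intro exI[of _ c]) (auto simp: nth_append)
      next
        case False
        then show ?thesis using jT j f by (intro exI[of _ "f - 1"]) auto
      qed
      then obtain c where "c < f" "fst ((T @ [(x, y)]) ! k) = Q ! c" by blast
      then show ?thesis using f jT Q' by (intro exI[of _ c] exI[of _ "f - 1"]) auto
    qed
  qed
  have "es ! i = (x, y)" using x y by (cases "es ! i") auto
  then have T: "set (T @ [(x, y)]) = (!) es ` insert i ?E" "length (T @ [(x, y)]) = card (insert i ?E)"
    using KT i' by auto
  show "kahn ?Q f x ?p ?a (T @ [(x, y)])"
    unfolding kahn_def E'
  proof (intro conjI)
    show "f \<le> length ?Q" "f = 0 \<longrightarrow> ?p = 0" using f by auto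
    show "distinct ?Q" using K nQ by auto
    show "0 < f \<longrightarrow> x = ?Q ! (f - 1)" using f by (auto simp: nth_append)
    show "?p \<le> m" using prev_arc_le[of es x i] i by simp
    show "0 < ?p \<longrightarrow> fst (es ! (?p - 1)) = x" using prev_arc_tail[of es x i "?p - 1"] by simp
  qed (use cnt setQ par ord T in blast)+
qed

text \<open>Suppose the queue were exhausted with arcs left, and let \<open>u\<close> be a minimal
  tail of such an arc. As \<open>u\<close> was never queued, some unemitted arc enters it, and the
  tail of that arc contradicts minimality.\<close>

lemma kahn_progress:
  assumes K: "kahn Q f x 0 a T" and "length T < m"
  shows "f < length Q"
proof (rule ccontr)
  assume "\<not> f < length Q"
  then have em: "emitted Q f x 0 = {j. j < m \<and> fst (es ! j) \<in> set Q}"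
    by (simp add: emitted_def)
  let ?U = "{u. \<exists>j<m. j \<notin> emitted Q f x 0 \<and> fst (es ! j) = u}"
  have "emitted Q f x 0 \<noteq> {..<m}" using assms by (auto simp: kahn_def)
  then obtain j where "j < m" "j \<notin> emitted Q f x 0" by (auto simp: emitted_def)
  then have "fst (es ! j) \<in> ?U" by auto
  with finite_acyclic_wf[OF finite_set acyc] obtain u where u: "u \<in> ?U" "\<And>v. (v, u) \<in> set es \<Longrightarrow> v \<notin> ?U"
    by (rule wfE_min) blast
  then obtain j where j: "j < m" "j \<notin> emitted Q f x 0" "fst (es ! j) = u" by auto
  then have "u \<notin> set Q" "u < n" using em tail_less by auto
  then have "a u \<noteq> 0" "a u = card {i. i < m \<and> i \<notin> emitted Q f x 0 \<and> snd (es ! i) = u}"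
    using kahnD(3,4)[OF K] by auto
  then have "{i. i < m \<and> i \<notin> emitted Q f x 0 \<and> snd (es ! i) = u} \<noteq> {}" by fastforce
  then obtain i where i: "i < m" "i \<notin> emitted Q f x 0" "snd (es ! i) = u" by blast
  then have "(fst (es ! i), u) \<in> set es" using arc_in[of i] by (metis prod.collapse)
  then show False using u(2) i by blast
qed

text \<open>No program reads \<open>pos\<close>; it only serves to reason about the order of the arc
  list.\<close>

definition (in -) topo_sorted :: "(nat \<times> nat) list \<Rightarrow> (nat \<Rightarrow> nat) \<Rightarrow> bool" where
  "topo_sorted T pos \<longleftrightarrow> (\<forall>(u, v) \<in> set T. pos u < pos v) \<and>
     (\<forall>j<length T. \<forall>i\<le>j. pos (fst (T ! i)) \<le> pos (fst (T ! j)))"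

text \<open>Once all arcs are emitted, all counters are 0 and every vertex has been queued. The
  position in the queue is the required numbering.\<close>

lemma kahn_final:
  assumes K: "kahn Q f x p a T" and "length T = m"
  shows "distinct T" "set T = set es" "\<exists>pos. topo_sorted T pos"
proof -
  note K' = K[unfolded kahn_def]
  have sub: "emitted Q f x p \<subseteq> {..<m}" by (auto simp: emitted_def)
  then have em: "emitted Q f x p = {..<m}"
    using K' assms(2) by (intro card_subset_eq) auto
  have "set T = (!) es ` {..<m}" using K' em by simp
  then show set: "set T = set es" using len by (auto simp: set_conv_nth)
  then show "distinct T" using assms(2) len dist by (simp add: card_distinct distinct_card)
  have "a v = 0" if "v < n" for v using K' that em by auto
  then have Q: "set Q = {..<n}" using K' by auto
  define pos where "pos v = (THE c. c < length Q \<and> Q ! c = v)" for v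
  have pos: "pos (Q ! c) = c" if "c < length Q" for c
    unfolding pos_def using that K' by (intro the_equality) (auto simp: nth_eq_iff_index_eq)
  have "pos u < pos v" if "(u, v) \<in> set T" for u v
  proof -
    have "v \<in> set Q" using that set Q verts by auto
    then obtain b where b: "b < length Q" "v = Q ! b" by (auto simp: in_set_conv_nth)
    have "(u, v) \<in> set es" using that set by simp
    then obtain i where i: "i < m" "es ! i = (u, v)" using len by (auto simp: in_set_conv_nth)
    then have "snd (es ! i) = Q ! b" using b by simp
    then obtain c where "c < b" "Q ! c = u" using kahnD(5)[OF K b(1) i(1)] i(2) by auto
    then show ?thesis using pos b by auto
  qed
  moreover have "pos (fst (T ! i)) \<le> pos (fst (T ! j))" if ij: "j < length T" "i \<le> j" for i j
  proof -
    obtain c d where "c \<le> d" "d < f" "fst (T ! i) = Q ! c" "fst (T ! j) = Q ! d"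
      using kahnD(8)[OF K ij] by blast
    then show ?thesis using pos kahnD(1)[OF K] by auto
  qed
  ultimately have "topo_sorted T pos" by (auto simp: topo_sorted_def)
  then show "\<exists>pos. topo_sorted T pos" by blast
qed

end

context ram_dag begin

definition arc_array :: "(nat \<Rightarrow> nat \<Rightarrow> nat) \<Rightarrow> nat \<Rightarrow> (nat \<times> nat) list" where
  "arc_array A i = map (\<lambda>j. (A aTAIL j, A aHEAD j)) [0..<i]"

lemma length_arc_array [simp]: "length (arc_array A i) = i"
  by (simp add: arc_array_def)

lemma arc_array_snoc:
  "A' aTAIL = (A aTAIL)(i := x) \<Longrightarrow> A' aHEAD = (A aHEAD)(i := y) \<Longrightarrow>
    arc_array A' (Suc i) = arc_array A i @ [(x, y)]"
  by (simp add: arc_array_def)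

lemma emit_arcs_correct:
  assumes "std_regs n m R" "R rI = 0" "R rFront = 0" "R rPtr = 0" "input_arcs (A 0)"
    and "\<forall>v<n. A aLAST v = prev_arc es v m" "\<forall>i<m. A aPREV i = prev_arc es (fst (es ! i)) i"
    and "\<forall>v<n. A aIN v = in_count es v m"
    and "set (map (A aQUEUE) [0..<R rBack]) = {v. v < n \<and> A aIN v = 0}"
    and "distinct (map (A aQUEUE) [0..<R rBack])"
    and Q: "\<And>R' A' t'. std_regs n m R' \<Longrightarrow>
      \<forall>k. k \<notin> {aIN, aQUEUE, aTAIL, aHEAD} \<longrightarrow> A' k = A k \<Longrightarrow>
      distinct (arc_array A' m) \<Longrightarrow> set (arc_array A' m) = set es \<Longrightarrow>
      \<exists>pos. topo_sorted (arc_array A' m) pos \<Longrightarrow>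
      t' \<le> t + 40 * (n + m) + 1 \<Longrightarrow> Q R' A' t'"
  shows "pre W S emit_arcs Q R A t"
proof -
  \<comment> \<open>The variant counts the arcs still to be emitted plus the vertices not yet
    dequeued, matching the two kinds of iterations.\<close>
  define I where "I z R' A' t' \<longleftrightarrow> z = (m - R' rI) + (n - R' rFront) \<and> std_regs n m R' \<and>
      (\<forall>k. k \<notin> {aIN, aQUEUE, aTAIL, aHEAD} \<longrightarrow> A' k = A k) \<and>
      kahn (map (A' aQUEUE) [0..<R' rBack]) (R' rFront) (R' rX) (R' rPtr) (A' aIN) (arc_array A' (R' rI)) \<and>
      t' \<le> t + 40 * (R' rI + R' rFront)" for z R' A' t'
  show ?thesis
    unfolding emit_arcs_def
  proof (rule pre_While[of I "m + n"])
    have "kahn (map (A aQUEUE) [0..<R rBack]) 0 (R rX) 0 (A aIN) []"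
      using assms by (intro kahn_init) auto
    then show "I (m + n) R A t" using assms by (simp add: I_def arc_array_def)
  next
    fix z R' A' t' assume I: "I z R' A' t'" and h: "holds (Less rI rM) R'"
    let ?Q = "map (A' aQUEUE) [0..<R' rBack]" and ?T = "arc_array A' (R' rI)"
    have K: "kahn ?Q (R' rFront) (R' rX) (R' rPtr) (A' aIN) ?T" using I by (simp add: I_def)
    have rI: "R' rI < m" and fr: "std_regs n m R'" using h I by (auto simp: I_def std_regs_def)
    have same: "A' 0 = A 0" "A' aLAST = A aLAST" "A' aPREV = A aPREV" using I by (auto simp: I_def)
    have bk: "R' rBack \<le> n" using kahn_bounds(1)[OF K] by simp
    show "pre W S (AIf (Equal rPtr rZero)
      (ALoad rX aQUEUE rFront ;; AAdd rFront rFront rOne ;; ALoad rPtr aLAST rX)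
      (ASub rPtr rPtr rOne ;; AAdd rA rPtr rPtr ;; AAdd rA rA rOne ;; AAdd rA rA rOne ;;
       AAdd rA rA rOne ;; ALoad rB 0 rA ;;
       AStore aTAIL rI rX ;; AStore aHEAD rI rB ;; AAdd rI rI rOne ;;
       ALoad rD aIN rB ;; ASub rD rD rOne ;; AStore aIN rB rD ;;
       AIf (Equal rD rZero) (AStore aQUEUE rBack rB ;; AAdd rBack rBack rOne) ASkip ;;
       ALoad rPtr aPREV rPtr)) (\<lambda>R A t. \<exists>z'<z. I z' R A t) R' A' (t' + 1)"
    proof (cases "R' rPtr")
      case 0
      then have K0: "kahn ?Q (R' rFront) (R' rX) 0 (A' aIN) ?T" using K by simp
      have f: "R' rFront < R' rBack" using kahn_progress[OF K0] rI by simp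
      note pop = kahn_pop[OF K0, simplified, OF f]
      have "?Q ! R' rFront \<in> set ?Q" using f by simp
      then have "A' aQUEUE (R' rFront) < n" using kahnD(3)[OF K0] f by auto
      then show ?thesis
        using I 0 f fr pop size bk same assms(6)
        by (auto simp: I_def std_regs_def arc_array_def)
    next
      case (Suc i)
      then have Ki: "kahn ?Q (R' rFront) (R' rX) (Suc i) (A' aIN) ?T" using K by simp
      define y where "y = snd (es ! i)"
      note em = kahn_emit[OF Ki y_def]
      have y: "y < n" using head_less[OF em(1)] y_def by simp
      have inp: "A 0 (Suc (Suc (Suc (i + i)))) = y" "A aPREV i = prev_arc es (R' rX) i"
        using assms(5,7) em(1,2) y_def by (auto simp: input_arcs_def)
      have fn: "R' rFront \<le> n" using kahnD(1)[OF K] bk by simp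
      have aux: "arc_array A'' (Suc (R' rI)) = ?T @ [(R' rX, y)]"
        if "A'' aTAIL = (A' aTAIL)(R' rI := R' rX)" "A'' aHEAD = (A' aHEAD)(R' rI := y)" for A''
        using that by (rule arc_array_snoc)
      show ?thesis
      proof (cases "A' aIN y = 1")
        case True
        then show ?thesis
          using I Suc em y fr size bk same inp rI
          by (auto simp: I_def std_regs_def aux)
      next
        case False
        then show ?thesis
          using I Suc em y fr size bk same inp rI
          by (auto simp: I_def std_regs_def aux)
      qed
    qed
  next
    fix z R' A' t' assume I: "I z R' A' t'" and h: "\<not> holds (Less rI rM) R'"
    then have K: "kahn (map (A' aQUEUE) [0..<R' rBack]) (R' rFront) (R' rX) (R' rPtr) (A' aIN)
        (arc_array A' (R' rI))"
      by (simp add: I_def)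
    have rI: "R' rI = m" using kahn_bounds(2)[OF K] h I by (simp add: I_def std_regs_def)
    have "R' rFront \<le> n" using kahnD(1)[OF K] kahn_bounds(1)[OF K] by simp
    then show "Q R' A' (t' + 1)"
      using I rI kahn_final[OF K] unfolding I_def by (intro Q) auto
  qed simp
qed

definition (in -) topo_sort :: acom where
  "topo_sort = index_arcs ;; AConst rI 0 ;; enqueue_sources ;; AConst rI 0 ;; emit_arcs"

lemma topo_sort_correct:
  assumes "std_regs n m R" "\<And>r. r \<in> {rI, rFront, rBack, rPtr} \<Longrightarrow> R r = 0" "input_arcs (A 0)"
    and "\<And>v. v < n \<Longrightarrow> A aIN v = 0" "\<And>v. v < n \<Longrightarrow> A aLAST v = 0"
    and Q: "\<And>R' A' t'. std_regs n m R' \<Longrightarrow> \<forall>k>aHEAD. A' k = A k \<Longrightarrow>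
      distinct (arc_array A' m) \<Longrightarrow> set (arc_array A' m) = set es \<Longrightarrow>
      \<exists>pos. topo_sorted (arc_array A' m) pos \<Longrightarrow>
      t' \<le> t + 100 * (n + m + 1) \<Longrightarrow> Q R' A' t'"
  shows "pre W S topo_sort Q R A t"
  unfolding topo_sort_def pre_Seq
proof (rule index_arcs_correct)
  fix R1 A1 t1
  assume 1: "std_regs n m R1" "\<forall>r\<in>{rFront, rBack, rPtr}. R1 r = R r"
    "\<forall>k. k \<notin> {aIN, aLAST, aPREV} \<longrightarrow> A1 k = A k"
    "\<forall>v<n. A1 aIN v = in_count es v m"
    "\<forall>v<n. A1 aLAST v = prev_arc es v m"
    "\<forall>i<m. A1 aPREV i = prev_arc es (fst (es ! i)) i" "t1 \<le> t + 30 * m + 1"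
  have "pre W S enqueue_sources (pre W S (AConst rI 0) (pre W S emit_arcs Q)) (R1(rI := 0)) A1 (t1 + 1)"
  proof (rule enqueue_sources_correct)
    fix R2 A2 t2
    assume 2: "std_regs n m R2" "\<forall>r\<in>{rFront, rPtr}. R2 r = (R1(rI := 0)) r"
      "\<forall>k. k \<noteq> aQUEUE \<longrightarrow> A2 k = A1 k" "R2 rBack \<le> n"
      "set (map (A2 aQUEUE) [0..<R2 rBack]) = {v. v < n \<and> A1 aIN v = 0}"
      "distinct (map (A2 aQUEUE) [0..<R2 rBack])" "t2 \<le> t1 + 1 + 30 * n + 1"
    have "pre W S emit_arcs Q (R2(rI := 0)) A2 (t2 + 1)"
    proof (rule emit_arcs_correct)
      fix R3 A3 t3
      assume 3: "std_regs n m R3" "\<forall>k. k \<notin> {aIN, aQUEUE, aTAIL, aHEAD} \<longrightarrow> A3 k = A2 k"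
        "distinct (arc_array A3 m)" "set (arc_array A3 m) = set es"
        "\<exists>pos. topo_sorted (arc_array A3 m) pos" "t3 \<le> t2 + 1 + 40 * (n + m) + 1"
      then show "Q R3 A3 t3" using 1 2 by (intro Q) auto
    qed (use assms 1 2 in \<open>auto simp: std_regs_def simp del: set_map\<close>)
    then show "pre W S (AConst rI 0) (pre W S emit_arcs Q) R2 A2 t2" by simp
  qed (use assms 1 in \<open>auto simp: std_regs_def\<close>)
  then show "pre W S (AConst rI 0)
     (pre W S enqueue_sources (pre W S (AConst rI 0) (pre W S emit_arcs Q))) R1 A1 t1"
    by simp
qed (use assms in auto)

end

section \<open>One-pass search for the arcs \<open>a\<close>, \<open>b\<close> and \<open>c\<close>
  in a sorted arc list\<close>

section \<open>Finding the arcs to branch on\<close>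

locale sorted_arcs =
  fixes n m W S :: nat and as :: "(nat \<times> nat) list" and pos :: "nat \<Rightarrow> nat"
  assumes len: "length as = m"
    and verts: "\<And>u v. (u, v) \<in> set as \<Longrightarrow> u < n \<and> v < n"
    and dist: "distinct as"
    and sorted: "topo_sorted as pos"
    and size: "n + 3 * m + 8 \<le> S" "12 * S \<le> W"
begin

text \<open>Throughout, \<open>d\<close> maps an arc index to the level at which the arc was
  deleted; 0 means that the arc is present.\<close>

definition alive :: "(nat \<Rightarrow> nat) \<Rightarrow> nat \<Rightarrow> nat set" where
  "alive d i = {j. j < i \<and> d j = 0}"

definition alive_arcs :: "(nat \<Rightarrow> nat) \<Rightarrow> (nat \<times> nat) set" where
  "alive_arcs d = (!) as ` alive d m"

lemma alive_less: "j \<in> alive d i \<Longrightarrow> j < i"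
  by (simp add: alive_def)

lemma alive_Suc: "alive d (Suc i) = (if d i = 0 then insert i (alive d i) else alive d i)"
  by (auto simp: alive_def less_Suc_eq)

lemma alive_mono: "j \<in> alive d i \<Longrightarrow> i \<le> m \<Longrightarrow> j \<in> alive d m"
  by (auto simp: alive_def)

lemma nth_tail_less: "i < m \<Longrightarrow> fst (as ! i) < n"
  and nth_head_less: "i < m \<Longrightarrow> snd (as ! i) < n"
  using verts[of "fst (as ! i)" "snd (as ! i)"] len by auto

lemma nth_inj: "i < m \<Longrightarrow> j < m \<Longrightarrow> as ! i = as ! j \<longleftrightarrow> i = j"
  using dist len by (simp add: nth_eq_iff_index_eq)

lemma pos_less: "i < m \<Longrightarrow> pos (fst (as ! i)) < pos (snd (as ! i))"
  using sorted len unfolding topo_sorted_def by (metis case_prodD nth_mem prod.collapse)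

lemma pos_mono: "i \<le> j \<Longrightarrow> j < m \<Longrightarrow> pos (fst (as ! i)) \<le> pos (fst (as ! j))"
  using sorted len unfolding topo_sorted_def by blast

lemma alive_arcs_iff: "(u, v) \<in> alive_arcs d \<longleftrightarrow> (\<exists>j\<in>alive d m. fst (as ! j) = u \<and> snd (as ! j) = v)"
  unfolding alive_arcs_def image_iff by (metis fst_conv prod.collapse snd_conv)

lemma alive_arcs_pos: "(u, v) \<in> (alive_arcs d)\<^sup>+ \<Longrightarrow> pos u < pos v"
proof (induction rule: trancl_induct)
  case (base v)
  then show ?case using pos_less by (auto simp: alive_arcs_iff alive_def)
next
  case (step v w)
  then have "pos v < pos w" using pos_less by (auto simp: alive_arcs_iff alive_def)
  then show ?case using step by simp
qed

lemma merging_alive_iff: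
  "merging (alive_arcs d) v \<longleftrightarrow>
    (\<exists>j\<in>alive d m. \<exists>k\<in>alive d m. j \<noteq> k \<and> snd (as ! j) = v \<and> snd (as ! k) = v)"
  using nth_inj unfolding merging_def alive_arcs_iff
  by (metis (no_types, lifting) alive_less prod_eqI)

lemma branching_alive_iff:
  "branching (alive_arcs d) v \<longleftrightarrow>
    (\<exists>j\<in>alive d m. \<exists>k\<in>alive d m. j \<noteq> k \<and> fst (as ! j) = v \<and> fst (as ! k) = v)"
  using nth_inj unfolding branching_def alive_arcs_iff
  by (metis (no_types, lifting) alive_less prod_eqI)

text \<open>This is what sorting achieves: when an arc is scanned, all arcs entering its tail have
  been seen, so the status of the tail is final.\<close>

lemma in_arcs_before:
  assumes "i < m" "k < m" "snd (as ! k) = fst (as ! i)"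
  shows "k < i"
  using pos_mono[of i k] pos_less[of k] assms by (cases "k < i") auto

lemma out_arcs_before:
  assumes "i < m" "k < m" "pos (fst (as ! k)) < pos (fst (as ! i))"
  shows "k < i"
  using pos_mono[of i k] assms by (cases "k < i") auto

abbreviation bad :: "(nat \<Rightarrow> nat) \<Rightarrow> nat \<Rightarrow> bool" where
  "bad d \<equiv> after_merge (alive_arcs d)"

text \<open>
  Among the first \<open>i\<close> arcs, \<open>c v\<close> is 0, 1 or 2 according as no arc, one arc with a good tail,
  or more enter \<open>v\<close>. As the arcs are sorted, \<open>c v = 2\<close> means that \<open>v\<close> is bad once an arc leaving
  \<open>v\<close> is reached.
\<close>

definition scanned_in :: "(nat \<Rightarrow> nat) \<Rightarrow> nat \<Rightarrow> (nat \<Rightarrow> nat) \<Rightarrow> (nat \<Rightarrow> nat) \<Rightarrow> nat \<Rightarrow> bool" where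
  "scanned_in d i c e v \<longleftrightarrow> c v \<le> 2 \<and>
     (c v = 0 \<longleftrightarrow> (\<forall>j\<in>alive d i. snd (as ! j) \<noteq> v)) \<and>
     (c v = 2 \<longleftrightarrow>
       (\<exists>j\<in>alive d i. \<exists>k\<in>alive d i. j \<noteq> k \<and> snd (as ! j) = v \<and> snd (as ! k) = v) \<or>
       (\<exists>j\<in>alive d i. snd (as ! j) = v \<and> bad d (fst (as ! j)))) \<and>
     (c v \<noteq> 0 \<longrightarrow> e v \<in> alive d i \<and> snd (as ! e v) = v \<and>
       (bad d (fst (as ! e v)) \<or> (\<forall>j\<in>alive d i. snd (as ! j) = v \<longrightarrow> \<not> bad d (fst (as ! j)))))"

text \<open>A nonzero \<open>l v\<close> is 1 plus the index of some scanned arc leaving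
  \<open>v\<close>, which can act as \<open>b\<close> when another one turns up.\<close>

definition scanned_out :: "(nat \<Rightarrow> nat) \<Rightarrow> nat \<Rightarrow> (nat \<Rightarrow> nat) \<Rightarrow> nat \<Rightarrow> bool" where
  "scanned_out d i l v \<longleftrightarrow> (if l v = 0 then \<forall>j\<in>alive d i. fst (as ! j) \<noteq> v
     else l v - 1 \<in> alive d i \<and> fst (as ! (l v - 1)) = v)"

definition no_hit :: "(nat \<Rightarrow> nat) \<Rightarrow> nat \<Rightarrow> bool" where
  "no_hit d i \<longleftrightarrow> (\<forall>j\<in>alive d i. \<forall>k\<in>alive d i. j \<noteq> k \<and> fst (as ! j) = fst (as ! k) \<longrightarrow>
     \<not> bad d (fst (as ! j)))"

definition good_triple :: "(nat \<Rightarrow> nat) \<Rightarrow> nat \<Rightarrow> nat \<Rightarrow> nat \<Rightarrow> bool" where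
  "good_triple d a b c \<longleftrightarrow> a \<in> alive d m \<and> b \<in> alive d m \<and> c \<in> alive d m \<and>
     branch_arcs (alive_arcs d) (as ! a) (as ! b) (as ! c)"

definition scanned :: "(nat \<Rightarrow> nat) \<Rightarrow> nat \<Rightarrow> (nat \<Rightarrow> nat) \<Rightarrow> (nat \<Rightarrow> nat) \<Rightarrow> (nat \<Rightarrow> nat) \<Rightarrow>
    nat \<Rightarrow> nat \<Rightarrow> nat \<Rightarrow> nat \<Rightarrow> bool" where
  "scanned d i c e l h ta tb tc \<longleftrightarrow>
     (\<forall>v<n. scanned_in d i c e v \<and> scanned_out d i l v) \<and>
     (if h = 0 then no_hit d i else good_triple d ta tb tc)"

text \<open>All arcs entering the tail precede \<open>i\<close>, so the right-hand side of
  \<open>after_merge_iff\<close> is exactly what the counter records.\<close>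

lemma scanned_bad_iff:
  assumes "scanned_in d i c e (fst (as ! i))" "i < m"
  shows "bad d (fst (as ! i)) \<longleftrightarrow> c (fst (as ! i)) = 2"
proof -
  let ?x = "fst (as ! i)"
  have bef: "j \<in> alive d m \<and> snd (as ! j) = ?x \<longleftrightarrow> j \<in> alive d i \<and> snd (as ! j) = ?x" for j
    using in_arcs_before[OF assms(2), of j] assms(2) by (auto simp: alive_def)
  have "bad d ?x \<longleftrightarrow> merging (alive_arcs d) ?x \<or> (\<exists>u. (u, ?x) \<in> alive_arcs d \<and> bad d u)"
    by (rule after_merge_iff)
  also have "\<dots> \<longleftrightarrow> (\<exists>j\<in>alive d i. \<exists>k\<in>alive d i. j \<noteq> k \<and> snd (as ! j) = ?x \<and> snd (as ! k) = ?x) \<or>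
       (\<exists>j\<in>alive d i. snd (as ! j) = ?x \<and> bad d (fst (as ! j)))"
    unfolding merging_alive_iff alive_arcs_iff using bef by blast
  finally show ?thesis using assms(1) unfolding scanned_in_def by blast
qed

text \<open>The first hit is topmost: both arcs leaving a bad branching proper ancestor have a tail
  at a smaller position, were scanned before, and would have contradicted \<open>no_hit\<close>. All
  arcs entering \<open>x\<close> were scanned too, so \<open>e x\<close> is bad-tailed if
  possible.\<close>

lemma scanned_hit:
  assumes i: "i < m" "d i = 0" and x: "x = fst (as ! i)"
    and si: "scanned_in d i c e x" and so: "scanned_out d i l x" and nh: "no_hit d i"
    and hit: "c x = 2" "l x \<noteq> 0"
  shows "good_triple d (e x) (l x - 1) i"
proof -
  have bx: "bad d x" using scanned_bad_iff si hit i x by metis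
  have e: "e x \<in> alive d i" "snd (as ! e x) = x"
    "bad d (fst (as ! e x)) \<or> (\<forall>j\<in>alive d i. snd (as ! j) = x \<longrightarrow> \<not> bad d (fst (as ! j)))"
    using si hit unfolding scanned_in_def by auto
  have l: "l x - 1 \<in> alive d i" "fst (as ! (l x - 1)) = x"
    using so hit unfolding scanned_out_def by auto
  have i': "i \<in> alive d m" using i by (simp add: alive_def)
  have al: "e x \<in> alive d m" "l x - 1 \<in> alive d m"
    using e(1) l(1) i(1) alive_mono by (auto simp: alive_def)
  have "as ! (l x - 1) \<noteq> as ! i" using l(1) i nth_inj by (auto simp: alive_def)
  moreover have "\<not> branching (alive_arcs d) u" if "bad d u" "(u, x) \<in> (alive_arcs d)\<^sup>+" for u
  proof
    assume "branching (alive_arcs d) u"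
    then obtain j k where jk: "j \<in> alive d m" "k \<in> alive d m" "j \<noteq> k" "fst (as ! j) = u" "fst (as ! k) = u"
      unfolding branching_alive_iff by blast
    have "pos u < pos x" using alive_arcs_pos that(2) .
    moreover have "j < m" "k < m" using jk alive_less by auto
    ultimately have "j < i" "k < i"
      using out_arcs_before[OF i(1), of j] out_arcs_before[OF i(1), of k] jk x by simp_all
    then have "j \<in> alive d i" "k \<in> alive d i" using jk by (auto simp: alive_def)
    then show False using nh[unfolded no_hit_def, rule_format, of j k] jk that(1) by simp
  qed
  moreover have "bad d (fst (as ! e x)) \<or> (\<forall>u. (u, x) \<in> alive_arcs d \<longrightarrow> \<not> bad d u)"
  proof -
    have "j \<in> alive d i" if "j \<in> alive d m" "snd (as ! j) = x" for j
      using in_arcs_before[OF i(1), of j] that x by (auto simp: alive_def)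
    then show ?thesis using e(3) unfolding alive_arcs_iff by blast
  qed
  ultimately have "branch_arcs (alive_arcs d) (as ! e x) (as ! (l x - 1)) (as ! i)"
    unfolding branch_arcs_def using al i' bx e(2) l(2) x
    by (auto simp: alive_arcs_def)
  then show ?thesis using al i' by (simp add: good_triple_def)
qed

lemma scanned_init: "(\<And>v. v < n \<Longrightarrow> c v = 0) \<Longrightarrow> (\<And>v. v < n \<Longrightarrow> l v = 0) \<Longrightarrow> scanned d 0 c e l 0 ta tb tc"
  by (simp add: scanned_def scanned_in_def scanned_out_def no_hit_def alive_def)

lemma scanned_dead:
  assumes "scanned d i c e l h ta tb tc" "d i \<noteq> 0"
  shows "scanned d (Suc i) c e l h ta tb tc"
proof -
  have "alive d (Suc i) = alive d i" using assms(2) by (simp add: alive_Suc)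
  then show ?thesis
    using assms(1) unfolding scanned_def scanned_in_def scanned_out_def no_hit_def by (simp only:)
qed

lemma scanned_le_2: "scanned d i c e l h ta tb tc \<Longrightarrow> v < n \<Longrightarrow> c v \<le> 2"
  by (simp add: scanned_def scanned_in_def)

text \<open>An arc with a bad tail counts as two and always becomes the recorded entry. One with a
  good tail is recorded only if it is the first, so a bad-tailed entry is never lost.\<close>

lemma scanned_in_step:
  assumes si: "scanned_in d i c e y" and y: "y = snd (as ! i)" and i: "d i = 0"
    and b: "b \<longleftrightarrow> bad d (fst (as ! i))"
  shows "scanned_in d (Suc i) (c(y := if b then 2 else if c y = 0 then 1 else 2))
    (if b \<or> c y = 0 then e(y := i) else e) y"
proof -
  have i': "i \<notin> alive d i" by (simp add: alive_def)
  consider "b" | "\<not> b" "c y = 0" | "\<not> b" "c y \<noteq> 0" by blast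
  then show ?thesis
  proof cases
    case 1
    then show ?thesis using b y i by (simp add: scanned_in_def alive_Suc)
  next
    case 2
    then have "\<forall>j\<in>alive d i. snd (as ! j) \<noteq> y" using si by (simp add: scanned_in_def)
    then show ?thesis using 2 b y i i' by (auto simp: scanned_in_def alive_Suc)
  next
    case 3
    then obtain j where "j \<in> alive d i" "snd (as ! j) = y" using si by (auto simp: scanned_in_def)
    moreover from this have "j \<noteq> i" using i' by blast
    ultimately have "\<exists>j\<in>insert i (alive d i). \<exists>k\<in>insert i (alive d i). j \<noteq> k \<and> snd (as ! j) = y \<and> snd (as ! k) = y"
      using y by (intro bexI[of _ j] bexI[of _ i]) auto
    then show ?thesis
      using 3 b y i i' si by (simp add: scanned_in_def alive_Suc)
  qed
qed

lemma scanned_step: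
  assumes sc: "scanned d i c e l h ta tb tc" and i: "i < m" "d i = 0"
    and x: "x = fst (as ! i)" and y: "y = snd (as ! i)"
    and hit: "hit \<longleftrightarrow> c x = 2 \<and> l x \<noteq> 0 \<and> h = 0"
  shows "scanned d (Suc i) (c(y := if c x = 2 then 2 else if c y = 0 then 1 else 2))
    (if c x = 2 \<or> c y = 0 then e(y := i) else e) (l(x := Suc i))
    (if hit then 1 else h) (if hit then e x else ta) (if hit then l x - 1 else tb) (if hit then i else tc)"
proof -
  have xy: "x < n" "y < n" using nth_tail_less nth_head_less i x y by auto
  have si: "\<And>v. v < n \<Longrightarrow> scanned_in d i c e v" and so: "\<And>v. v < n \<Longrightarrow> scanned_out d i l v"
    using sc by (auto simp: scanned_def)
  have bad: "c x = 2 \<longleftrightarrow> bad d (fst (as ! i))" using scanned_bad_iff si xy i x by metis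
  let ?c = "c(y := if c x = 2 then 2 else if c y = 0 then 1 else 2)"
    and ?e = "if c x = 2 \<or> c y = 0 then e(y := i) else e"
  have 1: "scanned_in d (Suc i) ?c ?e v" if "v < n" for v
  proof (cases "v = y")
    case True
    then show ?thesis using scanned_in_step[OF si[OF xy(2)] y i(2) bad] by simp
  next
    case False
    then show ?thesis using si[OF that] y i by (auto simp: scanned_in_def alive_Suc)
  qed
  have 2: "scanned_out d (Suc i) (l(x := Suc i)) v" if "v < n" for v
    using so[OF that] x i by (auto simp: scanned_out_def alive_Suc)
  have 3: "good_triple d (e x) (l x - 1) i" if hit
    using scanned_hit[OF i x si[OF xy(1)] so[OF xy(1)]] sc that hit by (simp add: scanned_def)
  have 4: "no_hit d (Suc i)" if "\<not> hit" "h = 0"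
  proof -
    have nh: "no_hit d i" using sc that by (simp add: scanned_def)
    have "\<not> bad d x" if j: "j \<in> alive d i" "fst (as ! j) = x" for j
    proof -
      have "l x \<noteq> 0" using so[OF xy(1)] j unfolding scanned_out_def by metis
      then show ?thesis using \<open>\<not> hit\<close> \<open>h = 0\<close> hit bad x by auto
    qed
    then show ?thesis using nh i x unfolding no_hit_def alive_Suc by auto metis+
  qed
  show ?thesis
    using 1 2 3 4 sc by (auto simp: scanned_def)
qed

lemma scanned_final:
  assumes "scanned d m c e l h ta tb tc"
  shows "if h = 0 then merge_branch_free (alive_arcs d) else good_triple d ta tb tc"
  using assms
  by (auto simp: scanned_def merge_branch_free_def branching_alive_iff no_hit_def)

end

section \<open>Programs for visiting a node of the search tree and for writing the result\<close>

abbreviation (input) "aDEL \<equiv> 8::nat"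
abbreviation (input) "aLEVEL \<equiv> 9::nat"
abbreviation (input) "aARC \<equiv> 10::nat"
abbreviation (input) "aENTRY \<equiv> 11::nat"

abbreviation (input) "rK \<equiv> 11::nat"
abbreviation (input) "rSp \<equiv> 12::nat"
abbreviation (input) "rL \<equiv> 13::nat"
abbreviation (input) "rE \<equiv> 15::nat"
abbreviation (input) "rHit \<equiv> 16::nat"
abbreviation (input) "rTa \<equiv> 17::nat"
abbreviation (input) "rTb \<equiv> 18::nat"
abbreviation (input) "rTc \<equiv> 19::nat"
abbreviation (input) "rFound \<equiv> 20::nat"
abbreviation (input) "rY \<equiv> 21::nat"

text \<open>Since each deletion carries its level, returning to a node of level \<open>rL\<close>
  means clearing all levels from \<open>rL\<close> upwards; no log of changes is kept.\<close>

definition undo_loop :: acom where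
  "undo_loop = AWhile (Less rI rM)
    (ALoad rA aDEL rI ;; AIf (Less rA rL) ASkip (AStore aDEL rI rZero) ;; AAdd rI rI rOne)"

definition reset_loop :: acom where
  "reset_loop = AWhile (Less rI rN)
    (AStore aIN rI rZero ;; AStore aLAST rI rZero ;; AAdd rI rI rOne)"

definition scan_loop :: acom where
  "scan_loop = AWhile (Less rI rM)
    (ALoad rA aDEL rI ;;
     AIf (Equal rA rZero)
       (ALoad rX aTAIL rI ;; ALoad rY aHEAD rI ;;
        ALoad rA aLAST rX ;; ALoad rB aIN rX ;; ALoad rC aIN rY ;;
        AIf (Less rOne rB)
          (AIf (Equal rA rZero) ASkip
            (AIf (Equal rHit rZero)
              (AConst rHit 1 ;; ALoad rTa aENTRY rX ;; ASub rTb rA rOne ;; AAdd rTc rI rZero)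
              ASkip) ;;
           AConst rC 2 ;; AStore aENTRY rY rI)
          (AIf (Equal rC rZero)
            (AConst rC 1 ;; AStore aENTRY rY rI)
            (AConst rC 2)) ;;
        AStore aIN rY rC ;; AAdd rI rI rOne ;; AStore aLAST rX rI)
       (AAdd rI rI rOne))"

definition write_loop :: acom where
  "write_loop = AWhile (Less rI rM)
    (ALoad rD aDEL rI ;;
     AIf (Equal rD rZero) ASkip
       (ALoad rX aTAIL rI ;; AStore 0 rA rX ;; AAdd rA rA rOne ;;
        ALoad rX aHEAD rI ;; AStore 0 rA rX ;; AAdd rA rA rOne ;; AAdd rC rC rOne) ;;
     AAdd rI rI rOne)"

context sorted_arcs begin

definition arcs_stored :: "(nat \<Rightarrow> nat \<Rightarrow> nat) \<Rightarrow> bool" where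
  "arcs_stored A \<longleftrightarrow> (\<forall>i<m. A aTAIL i = fst (as ! i) \<and> A aHEAD i = snd (as ! i))"

lemma undo_loop_correct:
  assumes "std_regs n m R" "R rI = 0"
    and Q: "\<And>R' A' t'. std_regs n m R' \<Longrightarrow> \<forall>r>rD. R' r = R r \<Longrightarrow>
      A' = A(aDEL := (\<lambda>i. if i < m \<and> R rL \<le> A aDEL i then 0 else A aDEL i)) \<Longrightarrow>
      t' \<le> t + 30 * m + 1 \<Longrightarrow> Q R' A' t'"
  shows "pre W S undo_loop Q R A t"
proof -
  define I where "I z R' A' t' \<longleftrightarrow> z = m - R' rI \<and> R' rI \<le> m \<and> std_regs n m R' \<and>
      (\<forall>r>rD. R' r = R r) \<and>
      A' = A(aDEL := (\<lambda>i. if i < R' rI \<and> R rL \<le> A aDEL i then 0 else A aDEL i)) \<and>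
      t' \<le> t + 30 * R' rI" for z R' A' t'
  show ?thesis
    unfolding undo_loop_def
  proof (rule pre_While[of I m])
    show "I m R A t" using assms(1,2) by (simp add: I_def)
  next
    fix z R' A' t' assume I: "I z R' A' t'" and h: "holds (Less rI rM) R'"
    then show "pre W S (ALoad rA aDEL rI ;; AIf (Less rA rL) ASkip (AStore aDEL rI rZero) ;;
        AAdd rI rI rOne) (\<lambda>R A t. \<exists>z'<z. I z' R A t) R' A' (t' + 1)"
      using size by (auto simp: I_def std_regs_def fun_eq_iff less_Suc_eq)
  next
    fix z R' A' t' assume I: "I z R' A' t'" and h: "\<not> holds (Less rI rM) R'"
    then have "R' rI = m" by (auto simp: I_def std_regs_def)
    then show "Q R' A' (t' + 1)" using I unfolding I_def by (intro Q) auto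
  qed simp
qed

lemma reset_loop_correct:
  assumes "std_regs n m R" "R rI = 0"
    and Q: "\<And>R' A' t'. std_regs n m R' \<Longrightarrow> \<forall>r>rD. R' r = R r \<Longrightarrow>
      \<forall>k. k \<notin> {aIN, aLAST} \<longrightarrow> A' k = A k \<Longrightarrow> \<forall>v<n. A' aIN v = 0 \<and> A' aLAST v = 0 \<Longrightarrow>
      t' \<le> t + 30 * n + 1 \<Longrightarrow> Q R' A' t'"
  shows "pre W S reset_loop Q R A t"
proof -
  define I where "I z R' A' t' \<longleftrightarrow> z = n - R' rI \<and> R' rI \<le> n \<and> std_regs n m R' \<and>
      (\<forall>r>rD. R' r = R r) \<and> (\<forall>k. k \<notin> {aIN, aLAST} \<longrightarrow> A' k = A k) \<and>
      (\<forall>v<R' rI. A' aIN v = 0 \<and> A' aLAST v = 0) \<and> t' \<le> t + 30 * R' rI" for z R' A' t'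
  show ?thesis
    unfolding reset_loop_def
  proof (rule pre_While[of I n])
    show "I n R A t" using assms(1,2) by (simp add: I_def)
  next
    fix z R' A' t' assume I: "I z R' A' t'" and h: "holds (Less rI rN) R'"
    then show "pre W S (AStore aIN rI rZero ;; AStore aLAST rI rZero ;; AAdd rI rI rOne)
        (\<lambda>R A t. \<exists>z'<z. I z' R A t) R' A' (t' + 1)"
      using size by (auto simp: I_def std_regs_def less_Suc_eq)
  next
    fix z R' A' t' assume I: "I z R' A' t'" and h: "\<not> holds (Less rI rN) R'"
    then have "R' rI = n" by (auto simp: I_def std_regs_def)
    then show "Q R' A' (t' + 1)" using I unfolding I_def by (intro Q) auto
  qed simp
qed

lemma scan_loop_correct:
  assumes "std_regs n m R" "R rI = 0" "R rHit = 0" "arcs_stored A"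
    and "\<forall>v<n. A aIN v = 0 \<and> A aLAST v = 0"
    and Q: "\<And>R' A' t'. std_regs n m R' \<Longrightarrow> \<forall>r\<in>{rK, rSp, rL, rE, rFound}. R' r = R r \<Longrightarrow>
      \<forall>k. k \<notin> {aIN, aLAST, aENTRY} \<longrightarrow> A' k = A k \<Longrightarrow>
      (if R' rHit = 0 then merge_branch_free (alive_arcs (A aDEL))
       else good_triple (A aDEL) (R' rTa) (R' rTb) (R' rTc)) \<Longrightarrow>
      t' \<le> t + 40 * m + 1 \<Longrightarrow> Q R' A' t'"
  shows "pre W S scan_loop Q R A t"
proof -
  define I where "I z R' A' t' \<longleftrightarrow> z = m - R' rI \<and> R' rI \<le> m \<and> std_regs n m R' \<and>
      (\<forall>r\<in>{rK, rSp, rL, rE, rFound}. R' r = R r) \<and>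
      (\<forall>k. k \<notin> {aIN, aLAST, aENTRY} \<longrightarrow> A' k = A k) \<and>
      scanned (A aDEL) (R' rI) (A' aIN) (A' aENTRY) (A' aLAST) (R' rHit) (R' rTa) (R' rTb) (R' rTc) \<and>
      t' \<le> t + 40 * R' rI" for z R' A' t'
  show ?thesis
    unfolding scan_loop_def
  proof (rule pre_While[of I m])
    show "I m R A t" using assms(1-3,5) by (auto simp: I_def intro!: scanned_init)
  next
    fix z R' A' t' assume I: "I z R' A' t'" and h: "holds (Less rI rM) R'"
    define i where "i = R' rI"
    have i: "i < m" "R' rI = i" using h I by (auto simp: I_def std_regs_def i_def)
    define x y where xy: "x = fst (as ! i)" "y = snd (as ! i)"
    have sc: "scanned (A aDEL) i (A' aIN) (A' aENTRY) (A' aLAST) (R' rHit) (R' rTa) (R' rTb) (R' rTc)"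
      using I i by (simp add: I_def)
    have ld: "A' aTAIL i = x" "A' aHEAD i = y" "A' aDEL = A aDEL"
      using I assms(4) i by (auto simp: I_def arcs_stored_def xy)
    have lt: "x < n" "y < n" "A' aIN x \<le> 2"
      using nth_tail_less nth_head_less i xy scanned_le_2[OF sc] by auto
    have ne: "x \<noteq> y" using pos_less[OF i(1)] xy by auto
    \<comment> \<open>The program tests for a bad tail by comparing with 1, as counters do not
      exceed 2.\<close>
    have bad: "Suc 0 < A' aIN x \<longleftrightarrow> A' aIN x = 2" using lt by auto
    have fr: "z = m - i" "std_regs n m R'" "t' \<le> t + 40 * i" "\<forall>r\<in>{rK, rSp, rL, rE, rFound}. R' r = R r"
      "\<forall>k. k \<notin> {aIN, aLAST, aENTRY} \<longrightarrow> A' k = A k"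
      using I i by (auto simp: I_def)
    show "pre W S (ALoad rA aDEL rI ;;
     AIf (Equal rA rZero)
       (ALoad rX aTAIL rI ;; ALoad rY aHEAD rI ;;
        ALoad rA aLAST rX ;; ALoad rB aIN rX ;; ALoad rC aIN rY ;;
        AIf (Less rOne rB)
          (AIf (Equal rA rZero) ASkip
            (AIf (Equal rHit rZero)
              (AConst rHit 1 ;; ALoad rTa aENTRY rX ;; ASub rTb rA rOne ;; AAdd rTc rI rZero)
              ASkip) ;;
           AConst rC 2 ;; AStore aENTRY rY rI)
          (AIf (Equal rC rZero)
            (AConst rC 1 ;; AStore aENTRY rY rI)
            (AConst rC 2)) ;;
        AStore aIN rY rC ;; AAdd rI rI rOne ;; AStore aLAST rX rI)
       (AAdd rI rI rOne)) (\<lambda>R A t. \<exists>z'<z. I z' R A t) R' A' (t' + 1)"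
    proof (cases "A aDEL i = 0")
      case False
      then show ?thesis
        using fr i size ld scanned_dead[OF sc False]
        by (simp add: I_def std_regs_def)
    next
      case True
      note st = scanned_step[OF sc i(1) True xy refl]
      consider "A' aIN x = 2" "A' aLAST x \<noteq> 0" "R' rHit = 0" | "A' aIN x = 2" "A' aLAST x = 0 \<or> R' rHit \<noteq> 0"
        | "A' aIN x \<noteq> 2" "A' aIN y = 0" | "A' aIN x \<noteq> 2" "A' aIN y \<noteq> 0" by metis
      then show ?thesis
      proof cases
        case 1
        then show ?thesis
          using fr i size ld lt ne st True by (simp add: I_def std_regs_def bad)
      next
        case 2
        then show ?thesis
          using fr i size ld lt ne st True by (auto simp: I_def std_regs_def bad)
      next
        case 3
        then show ?thesis
          using fr i size ld lt ne st True by (simp add: I_def std_regs_def bad)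
      next
        case 4
        then show ?thesis
          using fr i size ld lt ne st True by (simp add: I_def std_regs_def bad)
      qed
    qed
  next
    fix z R' A' t' assume I: "I z R' A' t'" and h: "\<not> holds (Less rI rM) R'"
    then have "R' rI = m" by (auto simp: I_def std_regs_def)
    then show "Q R' A' (t' + 1)"
      using I scanned_final unfolding I_def by (intro Q) auto
  qed simp
qed

end

section \<open>Iterative deepening on an explicit stack, and its potential\<close>

section \<open>The search tree\<close>

primrec tree_size :: "nat \<Rightarrow> nat" where
  "tree_size 0 = 1"
| "tree_size (Suc j) = 1 + 3 * tree_size j"

lemma tree_size_le: "1 + tree_size j \<le> 2 * 3 ^ j"
  by (induction j) auto

text \<open>Geometric growth makes all rounds together cost no more than a constant times the last.
  The summand 1 pays for the iteration that starts a round.\<close>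

lemma sum_tree_size_le: "(\<Sum>j<k. 1 + tree_size j) \<le> 3 ^ k"
proof (induction k)
  case (Suc k)
  then show ?case using tree_size_le[of k] by simp
qed simp

context sorted_arcs begin

definition ctx :: "(nat \<Rightarrow> nat) \<Rightarrow> nat \<Rightarrow> nat set" where
  "ctx d l = {i. i < m \<and> 1 \<le> d i \<and> d i < l}"

text \<open>The filter \<open>i < m\<close> drops the pseudo-index of the root entry, so the root
  deletes nothing.\<close>

definition node :: "(nat \<Rightarrow> nat) \<Rightarrow> nat \<Rightarrow> nat \<Rightarrow> (nat \<times> nat) set" where
  "node d l e = (!) as ` {i \<in> insert e (ctx d l). i < m}"

text \<open>
  A stack entry \<open>(l, e)\<close> stands for the node of the search tree reached by deleting the
  arcs of level below \<open>l\<close> and arc \<open>e\<close>. The entry \<open>(1, m)\<close> is the root, where \<open>m\<close> is not the index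
  of an arc; so \<open>l - 1\<close> arcs are deleted at a node of level \<open>l\<close>. The budget of the current round is
  \<open>K - 1\<close>.
\<close>

definition search_inv :: "nat \<Rightarrow> (nat \<times> nat) list \<Rightarrow> (nat \<Rightarrow> nat) \<Rightarrow> bool" where
  "search_inv K st d \<longleftrightarrow>
     (\<forall>(l, e) \<in> set st. 1 \<le> l \<and> l \<le> K \<and> card (ctx d l) = l - 2 \<and>
        (if l = 1 then e = m else e < m \<and> e \<notin> ctx d l)) \<and>
     List.sorted (map fst st) \<and>
     (\<forall>p<length st. p \<le> 2 * (fst (st ! p) - 1)) \<and>
     (\<forall>X. deletion_set (set as) X \<longrightarrow> K \<le> card X + 1) \<and>
     (\<forall>X. deletion_set (set as) X \<and> card X < K \<longrightarrow>
        (\<exists>(l, e) \<in> set st. \<exists>X'. deletion_set (set as) X' \<and> card X' < K \<and> node d l e \<subseteq> X'))"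

definition undo :: "(nat \<Rightarrow> nat) \<Rightarrow> nat \<Rightarrow> nat \<Rightarrow> nat \<Rightarrow> nat" where
  "undo d l e = (\<lambda>i. if i < m \<and> l \<le> d i then 0 else d i)(e := l)"

lemma search_inv_init: "search_inv 0 [] d"
  by (simp add: search_inv_def)

text \<open>An empty stack leaves no room for a solution of fewer than \<open>K\<close> arcs, so the
  lower bound in the invariant can be raised along with the budget.\<close>

lemma search_inv_refill:
  assumes "search_inv K [] d"
  shows "search_inv (Suc K) [(1, m)] d"
proof -
  have c: "ctx d 1 = {}" by (auto simp: ctx_def)
  then have nd: "node d 1 m = {}" by (simp add: node_def)
  have "K \<le> card X" if "deletion_set (set as) X" for X
    using assms that by (fastforce simp: search_inv_def)
  then show ?thesis using c nd by (auto simp: search_inv_def)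
qed

lemma finite_ctx [simp]: "finite (ctx d l)"
  by (simp add: ctx_def)

lemma ctx_less: "i \<in> ctx d l \<Longrightarrow> i < m"
  by (simp add: ctx_def)

text \<open>The stack is sorted by level, so its top is a deepest node. An expansion replaces one
  entry by three of the next level, a gain of two per level; hence the bound on the height.\<close>

lemma search_inv_popD:
  assumes "search_inv K (st @ [(l, e)]) d"
  shows "1 \<le> l" "l \<le> K" "card (ctx d l) = l - 2" "if l = 1 then e = m else e < m \<and> e \<notin> ctx d l"
    "\<And>l' e'. (l', e') \<in> set st \<Longrightarrow> l' \<le> l" "length st \<le> 2 * (l - 1)"
  using assms by (auto simp: search_inv_def sorted_append nth_append split: if_splits)

lemma acyclic_as: "acyclic (set as)"
proof (rule acyclicI, intro allI notI)
  have eq: "alive_arcs (\<lambda>_. 0) = set as"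
    using len by (auto simp: alive_arcs_def alive_def set_conv_nth)
  fix x assume "(x, x) \<in> (set as)\<^sup>+"
  then show False using alive_arcs_pos[of x x "\<lambda>_. 0"] eq by simp
qed

context
  fixes K st l e d d'
  assumes inv: "search_inv K (st @ [(l, e)]) d" and d': "d' = undo d l e"
begin

text \<open>Pending entries have levels up to \<open>l\<close>, and levels below \<open>l\<close>
  are untouched by \<open>undo\<close>. The level \<open>l\<close> written at \<open>e\<close>
  destroys none of them, as \<open>e\<close> was not deleted at a lower level. So the other entries
  keep their meaning.\<close>

lemma ctx_undo:
  assumes "l' \<le> l"
  shows "ctx d' l' = ctx d l'"
proof -
  have "e \<notin> ctx d l'" using search_inv_popD(4)[OF inv] assms by (auto simp: ctx_def split: if_splits)
  then show ?thesis using assms by (auto simp: ctx_def d' undo_def)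
qed

lemma ctx_undo_Suc: "ctx d' (Suc l) = {i \<in> insert e (ctx d l). i < m}"
  using search_inv_popD(1)[OF inv] by (auto simp: ctx_def d' undo_def)

lemma node_undo: "(l', e') \<in> set st \<Longrightarrow> node d' l' e' = node d l' e'"
  using search_inv_popD(5)[OF inv] ctx_undo by (simp add: node_def)

text \<open>A node below the root adds its own arc to the \<open>l - 2\<close> arcs of its
  ancestors. At the root, truncated subtraction gives 0 in both places, and nothing is
  deleted.\<close>

lemma card_ctx_undo_Suc: "card (ctx d' (Suc l)) = l - 1"
proof (cases "l = 1")
  case True
  then have "ctx d' (Suc l) = {}" using search_inv_popD(4)[OF inv] unfolding ctx_undo_Suc
    by (auto simp: ctx_def)
  then show ?thesis using True by simp
next
  case False
  then have e: "e < m" "e \<notin> ctx d l" using search_inv_popD(4)[OF inv] by auto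
  then have "ctx d' (Suc l) = insert e (ctx d l)" unfolding ctx_undo_Suc using ctx_less by auto
  then show ?thesis using e search_inv_popD(1,3)[OF inv] False by simp
qed

lemma node_eq: "node d l e = (!) as ` ctx d' (Suc l)"
  by (simp add: node_def ctx_undo_Suc)

lemma node_subset: "node d l e \<subseteq> set as"
  using len by (auto simp: node_def)

lemma card_node: "card (node d l e) = l - 1"
  unfolding node_eq card_ctx_undo_Suc[symmetric]
  by (intro card_image) (auto simp: inj_on_def nth_inj ctx_def)

lemma alive_undo: "alive d' m = {..<m} - ctx d' (Suc l)"
  using search_inv_popD(1)[OF inv] unfolding alive_def ctx_undo_Suc
  by (auto simp: d' undo_def ctx_def)

lemma alive_arcs_undo: "alive_arcs d' = set as - node d l e"
proof -
  have "set as = (!) as ` {..<m}" using len by (auto simp: set_conv_nth)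
  moreover have "inj_on ((!) as) {..<m}" by (simp add: inj_on_def nth_inj)
  ultimately show ?thesis
    unfolding alive_arcs_def alive_undo node_eq
    by (simp add: inj_on_image_set_diff[of _ "{..<m}"] ctx_less subset_iff)
qed

text \<open>The node deletes \<open>l - 1\<close> arcs, which is at most \<open>K - 1\<close> and
  hence at most the size of any solution.\<close>

lemma search_inv_found:
  assumes "merge_branch_free (alive_arcs d')"
  shows "deletion_set (set as) (node d l e)" "deletion_set (set as) X \<Longrightarrow> card (node d l e) \<le> card X"
proof -
  show "deletion_set (set as) (node d l e)"
    using assms node_subset by (simp add: deletion_set_def alive_arcs_undo)
  assume "deletion_set (set as) X"
  then have "K \<le> card X + 1" using inv by (simp add: search_inv_def)
  then show "card (node d l e) \<le> card X" using card_node search_inv_popD(2)[OF inv] by simp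
qed

text \<open>A solution within the budget that extends the node can be turned into one extending a
  child, and the children replace the node. If \<open>l = K\<close>, no solution within the budget
  extends the node, and it is dropped.\<close>

lemma search_inv_branch:
  assumes tri: "good_triple d' a b c"
  shows "l < K \<Longrightarrow> search_inv K (st @ [(Suc l, a), (Suc l, b), (Suc l, c)]) d'"
    and "\<not> l < K \<Longrightarrow> search_inv K st d'"
proof -
  have al: "a \<in> alive d' m" "b \<in> alive d' m" "c \<in> alive d' m"
    and br: "branch_arcs (set as - node d l e) (as ! a) (as ! b) (as ! c)"
    using tri by (auto simp: good_triple_def alive_arcs_undo)
  have abc: "a < m \<and> a \<notin> ctx d' (Suc l)" "b < m \<and> b \<notin> ctx d' (Suc l)" "c < m \<and> c \<notin> ctx d' (Suc l)"
    using al unfolding alive_undo by auto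
  have new: "node d' (Suc l) f = insert (as ! f) (node d l e)" if "f < m" for f
  proof -
    have "{i \<in> insert f (ctx d' (Suc l)). i < m} = insert f (ctx d' (Suc l))"
      using that ctx_less by auto
    then show ?thesis by (simp add: node_eq node_def[of d' "Suc l" f])
  qed
  have ent: "1 \<le> l' \<and> l' \<le> K \<and> card (ctx d' l') = l' - 2 \<and>
        (if l' = 1 then e' = m else e' < m \<and> e' \<notin> ctx d' l')" if "(l', e') \<in> set st" for l' e'
    using inv that ctx_undo[OF search_inv_popD(5)[OF inv that]] by (auto simp: search_inv_def)
  have srt: "List.sorted (map fst st)" using inv by (simp add: search_inv_def sorted_append)
  have idx: "p \<le> 2 * (fst (st ! p) - 1)" if "p < length st" for p
  proof -
    have "\<forall>p<length (st @ [(l, e)]). p \<le> 2 * (fst ((st @ [(l, e)]) ! p) - 1)"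
      using inv unfolding search_inv_def by blast
    then show ?thesis using that by (auto simp: nth_append dest!: spec[of _ p])
  qed
  have low: "K \<le> card X + 1" if "deletion_set (set as) X" for X
    using inv that by (simp add: search_inv_def)
  have sol: "(\<exists>(l', e') \<in> set st. \<exists>X'. deletion_set (set as) X' \<and> card X' < K \<and> node d' l' e' \<subseteq> X') \<or>
      (l < K \<and> (\<exists>f\<in>{a, b, c}. \<exists>X'. deletion_set (set as) X' \<and> card X' < K \<and> node d' (Suc l) f \<subseteq> X'))"
    if X: "deletion_set (set as) X" "card X < K" for X
  proof -
    have "\<exists>(l', e') \<in> set (st @ [(l, e)]). \<exists>X'. deletion_set (set as) X' \<and> card X' < K \<and> node d l' e' \<subseteq> X'"
      using inv X unfolding search_inv_def by blast
    then consider l' e' X' where "(l', e') \<in> set st" "deletion_set (set as) X'" "card X' < K" "node d l' e' \<subseteq> X'"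
      | X' where "deletion_set (set as) X'" "card X' < K" "node d l e \<subseteq> X'"
      by auto
    then show ?thesis
    proof cases
      case 1
      then show ?thesis using node_undo by blast
    next
      case 2
      obtain f X'' where f: "f \<in> {as ! a, as ! b, as ! c}" "deletion_set (set as) X''"
        "insert f (node d l e) \<subseteq> X''" "card X'' \<le> card X'"
        using deletion_set_extend[OF finite_set acyclic_as 2(1,3) br] by blast
      then obtain g where g: "g \<in> {a, b, c}" "f = as ! g" by blast
      then have gm: "g < m" using abc by auto
      have "f \<notin> node d l e" using br f(1) unfolding branch_arcs_def by auto
      moreover have "finite X''" using f(2) by (auto simp: deletion_set_def intro: finite_subset)
      ultimately have "card (node d l e) < card X''"
        using f(3) by (intro psubset_card_mono) auto
      \<comment> \<open>The new solution contains the \<open>l - 1\<close> arcs of the node and one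
        more, so it has at least \<open>l\<close> arcs, yet fewer than \<open>K\<close>.\<close>
      then have "l < K" using card_node f(4) 2(2) search_inv_popD(1)[OF inv] by linarith
      moreover have "node d' (Suc l) g \<subseteq> X''" using f(3) g new[OF gm] by simp
      ultimately show ?thesis using f g 2(2) by (meson order_le_less_trans)
    qed
  qed
  show "search_inv K st d'" if "\<not> l < K"
    unfolding search_inv_def using ent srt idx low sol that by (intro conjI) fast+
  show "search_inv K (st @ [(Suc l, a), (Suc l, b), (Suc l, c)]) d'" if "l < K"
    unfolding search_inv_def
  proof (intro conjI)
    let ?P = "\<lambda>l' e'. 1 \<le> l' \<and> l' \<le> K \<and> card (ctx d' l') = l' - 2 \<and>
        (if l' = 1 then e' = m else e' < m \<and> e' \<notin> ctx d' l')"
    have ne: "?P (Suc l) f" if "f \<in> {a, b, c}" for f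
      using that abc \<open>l < K\<close> card_ctx_undo_Suc search_inv_popD(1)[OF inv] by auto
    show "\<forall>(l', e') \<in> set (st @ [(Suc l, a), (Suc l, b), (Suc l, c)]). ?P l' e'"
    proof (intro ballI)
      fix q assume q: "q \<in> set (st @ [(Suc l, a), (Suc l, b), (Suc l, c)])"
      obtain l' e' where "q = (l', e')" by fastforce
      moreover from this q have "(l', e') \<in> set st \<or> l' = Suc l \<and> e' \<in> {a, b, c}" by auto
      then have "?P l' e'" using ent ne by blast
      ultimately show "case q of (l', e') \<Rightarrow> ?P l' e'" by simp
    qed
    show "List.sorted (map fst (st @ [(Suc l, a), (Suc l, b), (Suc l, c)]))"
      using srt search_inv_popD(5)[OF inv] by (auto simp: sorted_append intro: le_SucI)
    \<comment> \<open>The three new entries occupy the next three cells above a stack of height at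
      most \<open>2 * (l - 1)\<close>, hence have indices up to \<open>2 * l\<close>.\<close>
    have "p \<le> 2 * (fst ([(Suc l, a), (Suc l, b), (Suc l, c)] ! (p - length st)) - 1)"
      if "\<not> p < length st" "p < length st + 3" for p
    proof -
      have "p - length st \<in> {0, 1, 2}" using that by auto
      then have "fst ([(Suc l, a), (Suc l, b), (Suc l, c)] ! (p - length st)) = Suc l" by auto
      then show ?thesis using that search_inv_popD(1,6)[OF inv] by auto
    qed
    then show "\<forall>p<length (st @ [(Suc l, a), (Suc l, b), (Suc l, c)]).
        p \<le> 2 * (fst ((st @ [(Suc l, a), (Suc l, b), (Suc l, c)]) ! p) - 1)"
      using idx unfolding nth_append by simp
    show "\<forall>X. deletion_set (set as) X \<and> card X < K \<longrightarrow>
        (\<exists>(l', e') \<in> set (st @ [(Suc l, a), (Suc l, b), (Suc l, c)]).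
          \<exists>X'. deletion_set (set as) X' \<and> card X' < K \<and> node d' l' e' \<subseteq> X')"
    proof (intro allI impI)
      fix X assume "deletion_set (set as) X \<and> card X < K"
      then show "\<exists>(l', e') \<in> set (st @ [(Suc l, a), (Suc l, b), (Suc l, c)]).
          \<exists>X'. deletion_set (set as) X' \<and> card X' < K \<and> node d' l' e' \<subseteq> X'"
        using sol[of X] by (elim conjE disjE) (simp; blast)+
    qed
  qed (use low in blast)
qed

end

text \<open>A potential bounding the remaining iterations: an entry of level \<open>l\<close> may
  root a full ternary tree of depth \<open>K - l\<close>, and the rounds with budgets
  \<open>K\<close> to \<open>D\<close> are still to come, each with one extra iteration to start it.
  For \<open>D\<close> the size of a solution is taken.\<close>

definition work :: "nat \<Rightarrow> nat \<Rightarrow> (nat \<times> nat) list \<Rightarrow> nat" where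
  "work D K st = (\<Sum>(l, e)\<leftarrow>st. tree_size (K - l)) + (\<Sum>j = K..D. 1 + tree_size j)"

lemma work_refill: "K \<le> D \<Longrightarrow> work D K [] = work D (Suc K) [(1, e)] + 1"
  by (simp add: work_def sum.atLeast_Suc_atMost)

lemma work_pop: "work D K st < work D K (st @ [(l, e)])"
  by (cases "K - l") (auto simp: work_def)

lemma work_branch:
  assumes "l < K"
  shows "work D K (st @ [(l, e)]) = work D K (st @ [(Suc l, a), (Suc l, b), (Suc l, c)]) + 1"
proof -
  have "K - l = Suc (K - Suc l)" using assms by simp
  then show ?thesis by (simp add: work_def)
qed

lemma work_init: "work D 0 [] \<le> 3 * 3 ^ D"
  using sum_tree_size_le[of "Suc D"] by (simp add: work_def atLeast0AtMost lessThan_Suc_atMost)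

end

text \<open>For the root, the level is stored in cell \<open>m\<close> of the deletion array, which
  belongs to no arc.\<close>

definition pop_node :: acom where
  "pop_node =
     ASub rSp rSp rOne ;; ALoad rL aLEVEL rSp ;; ALoad rE aARC rSp ;;
     AConst rI 0 ;; undo_loop ;; AStore aDEL rE rL ;;
     AConst rI 0 ;; reset_loop ;; AConst rI 0 ;; AConst rHit 0 ;; scan_loop"

definition push_arc :: "nat \<Rightarrow> nat \<Rightarrow> acom" where
  "push_arc r q = AStore aLEVEL rSp r ;; AStore aARC rSp q ;; AAdd rSp rSp rOne"

definition search_loop :: acom where
  "search_loop = AWhile (Equal rFound rZero)
    (AIf (Equal rSp rZero)
      (AAdd rK rK rOne ;; push_arc rOne rM)
      (pop_node ;;
       AIf (Equal rHit rZero) (AConst rFound 1)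
         (AIf (Less rL rK)
           (AAdd rL rL rOne ;; push_arc rL rTa ;; push_arc rL rTb ;; push_arc rL rTc)
           ASkip)))"

section \<open>Correctness and running time of the search program\<close>

context sorted_arcs begin

lemma pop_node_correct:
  assumes "std_regs n m R" "arcs_stored A" "R rSp = Suc s" "s < S" "A aARC s \<le> m"
    and Q: "\<And>R' A' t'. std_regs n m R' \<Longrightarrow> R' rK = R rK \<Longrightarrow> R' rSp = s \<Longrightarrow> R' rL = A aLEVEL s \<Longrightarrow>
      R' rFound = R rFound \<Longrightarrow> \<forall>k. k \<notin> {aIN, aLAST, aENTRY, aDEL} \<longrightarrow> A' k = A k \<Longrightarrow>
      A' aDEL = undo (A aDEL) (A aLEVEL s) (A aARC s) \<Longrightarrow>
      (if R' rHit = 0 then merge_branch_free (alive_arcs (A' aDEL))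
       else good_triple (A' aDEL) (R' rTa) (R' rTb) (R' rTc)) \<Longrightarrow>
      t' \<le> t + 100 * (n + m + 1) \<Longrightarrow> Q R' A' t'"
  shows "pre W S pop_node Q R A t"
proof -
  let ?R = "R(rSp := s, rL := A aLEVEL s, rE := A aARC s, rI := 0)"
  have "pre W S undo_loop (pre W S (AStore aDEL rE rL) (pre W S (AConst rI 0) (pre W S reset_loop
     (pre W S (AConst rI 0) (pre W S (AConst rHit 0) (pre W S scan_loop Q)))))) ?R A (t + 6)"
  proof (rule undo_loop_correct)
    fix R1 A1 t1
    assume 1: "std_regs n m R1" "\<forall>r>rD. R1 r = ?R r"
      "A1 = A(aDEL := (\<lambda>i. if i < m \<and> ?R rL \<le> A aDEL i then 0 else A aDEL i))"
      "t1 \<le> t + 6 + 30 * m + 1"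
    let ?A = "A1(aDEL := (A1 aDEL)(R1 rE := R1 rL))"
    have del: "?A aDEL = undo (A aDEL) (A aLEVEL s) (A aARC s)"
      using 1 by (simp add: undo_def)
    have "pre W S reset_loop (pre W S (AConst rI 0) (pre W S (AConst rHit 0) (pre W S scan_loop Q)))
       (R1(rI := 0)) ?A (t1 + 3)"
    proof (rule reset_loop_correct)
      fix R2 A2 t2
      assume 2: "std_regs n m R2" "\<forall>r>rD. R2 r = (R1(rI := 0)) r" "\<forall>k. k \<notin> {aIN, aLAST} \<longrightarrow> A2 k = ?A k"
        "\<forall>v<n. A2 aIN v = 0 \<and> A2 aLAST v = 0" "t2 \<le> t1 + 3 + 30 * n + 1"
      have "pre W S scan_loop Q (R2(rI := 0, rHit := 0)) A2 (t2 + 2)"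
      proof (rule scan_loop_correct)
        show "arcs_stored A2" using assms(2) 1 2 by (simp add: arcs_stored_def)
        fix R3 A3 t3
        assume 3: "std_regs n m R3" "\<forall>r\<in>{rK, rSp, rL, rE, rFound}. R3 r = (R2(rI := 0, rHit := 0)) r"
          "\<forall>k. k \<notin> {aIN, aLAST, aENTRY} \<longrightarrow> A3 k = A2 k"
          "if R3 rHit = 0 then merge_branch_free (alive_arcs (A2 aDEL))
           else good_triple (A2 aDEL) (R3 rTa) (R3 rTb) (R3 rTc)"
          "t3 \<le> t2 + 2 + 40 * m + 1"
        have del3: "A3 aDEL = undo (A aDEL) (A aLEVEL s) (A aARC s)" "A2 aDEL = A3 aDEL"
          using 2 3 del by auto
        show "Q R3 A3 t3"
        proof (rule Q)
          show "\<forall>k. k \<notin> {aIN, aLAST, aENTRY, aDEL} \<longrightarrow> A3 k = A k" using 1(3) 2(3) 3(3) by simp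
          show "t3 \<le> t + 100 * (n + m + 1)" using 1(4) 2(5) 3(5) by simp
          show "if R3 rHit = 0 then merge_branch_free (alive_arcs (A3 aDEL))
             else good_triple (A3 aDEL) (R3 rTa) (R3 rTb) (R3 rTc)"
            using 3(4) unfolding del3(2) .
        qed (use 1(1,2) 2(1,2) 3(1,2) del3 in simp_all)
      qed (use 2 in \<open>auto simp: std_regs_def\<close>)
      then show "pre W S (AConst rI 0) (pre W S (AConst rHit 0) (pre W S scan_loop Q)) R2 A2 t2"
        by simp
    qed (use 1 in \<open>auto simp: std_regs_def\<close>)
    moreover have "R1 rE < S" using 1 assms(5) size by simp
    ultimately show "pre W S (AStore aDEL rE rL) (pre W S (AConst rI 0) (pre W S reset_loop
       (pre W S (AConst rI 0) (pre W S (AConst rHit 0) (pre W S scan_loop Q))))) R1 A1 t1"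
      by (simp add: numeral_3_eq_3)
  qed (use assms(1) in \<open>auto simp: std_regs_def\<close>)
  then show ?thesis
    using assms(1,3,4) by (simp add: pop_node_def pre_Seq std_regs_def numeral_eq_Suc)
qed

definition stack :: "(nat \<Rightarrow> nat \<Rightarrow> nat) \<Rightarrow> nat \<Rightarrow> (nat \<times> nat) list" where
  "stack A s = map (\<lambda>p. (A aLEVEL p, A aARC p)) [0..<s]"

lemma stack_0 [simp]: "stack A 0 = []"
  by (simp add: stack_def)

lemma stack_Suc: "stack A (Suc s) = stack A s @ [(A aLEVEL s, A aARC s)]"
  by (simp add: stack_def)

lemma length_stack [simp]: "length (stack A s) = s"
  by (simp add: stack_def)

lemma stack_cong:
  assumes "\<And>p. p < s \<Longrightarrow> A' aLEVEL p = A aLEVEL p" "\<And>p. p < s \<Longrightarrow> A' aARC p = A aARC p"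
  shows "stack A' s = stack A s"
  using assms by (simp add: stack_def)

definition deleted :: "(nat \<Rightarrow> nat) \<Rightarrow> nat list" where
  "deleted d = filter (\<lambda>i. d i \<noteq> 0) [0..<m]"

lemma node_deleted:
  assumes "search_inv K (st @ [(l, e)]) d"
  shows "node d l e = (!) as ` set (deleted (undo d l e))"
proof -
  have "i \<in> ctx (undo d l e) (Suc l) \<longleftrightarrow> i \<in> set (deleted (undo d l e))" for i
  proof -
    have "i \<in> alive (undo d l e) m \<longleftrightarrow> i \<in> {..<m} - ctx (undo d l e) (Suc l)"
      using alive_undo[OF assms refl] by simp
    then show ?thesis using ctx_less[of i "undo d l e" "Suc l"] by (auto simp: alive_def deleted_def)
  qed
  then have "ctx (undo d l e) (Suc l) = set (deleted (undo d l e))" by blast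
  then show ?thesis using node_eq[OF assms refl] by simp
qed

lemma search_loop_correct:
  assumes "std_regs n m R" "arcs_stored A" "R rK = 0" "R rSp = 0" "R rFound = 0"
    and X: "deletion_set (set as) X"
    and Q: "\<And>R' A' t'. std_regs n m R' \<Longrightarrow> arcs_stored A' \<Longrightarrow>
      deletion_set (set as) ((!) as ` set (deleted (A' aDEL))) \<Longrightarrow>
      (\<forall>Y. deletion_set (set as) Y \<longrightarrow> card ((!) as ` set (deleted (A' aDEL))) \<le> card Y) \<Longrightarrow>
      t' \<le> t + 200 * (n + m + 1) * (3 * 3 ^ card X + 1) + 1 \<Longrightarrow> Q R' A' t'"
  shows "pre W S search_loop Q R A t"
proof -
  define c where "c = 200 * (n + m + 1)"
  have "card X \<le> card (set as)" using X by (intro card_mono) (auto simp: deletion_set_def)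
  also have "\<dots> = m" using dist len by (simp add: distinct_card)
  finally have Xm: "card X \<le> m" .
  \<comment> \<open>Time is charged to the variant: one iteration costs at most \<open>c\<close> and
    lowers \<open>z\<close>. After success \<open>z\<close> occurs in the time bound only, so 0 can
    be chosen for it.\<close>
  define I where "I z R' A' t' \<longleftrightarrow> std_regs n m R' \<and> arcs_stored A' \<and>
      (if R' rFound = 0
       then search_inv (R' rK) (stack A' (R' rSp)) (A' aDEL) \<and>
         z = work (card X) (R' rK) (stack A' (R' rSp)) + 1
       else deletion_set (set as) ((!) as ` set (deleted (A' aDEL))) \<and>
         (\<forall>Y. deletion_set (set as) Y \<longrightarrow> card ((!) as ` set (deleted (A' aDEL))) \<le> card Y)) \<and>
      t' + c * z \<le> t + c * (work (card X) 0 [] + 1)" for z R' A' t'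
  show ?thesis
    unfolding search_loop_def
  proof (rule pre_While[of I "work (card X) 0 [] + 1"])
    show "I (work (card X) 0 [] + 1) R A t"
      using assms(1-5) search_inv_init by (simp add: I_def)
  next
    fix z R' A' t' assume I: "I z R' A' t'" and h: "holds (Equal rFound rZero) R'"
    have f0: "R' rFound = 0" "std_regs n m R'" "arcs_stored A'" using h I by (auto simp: I_def std_regs_def)
    have inv: "search_inv (R' rK) (stack A' (R' rSp)) (A' aDEL)"
      and z: "z = work (card X) (R' rK) (stack A' (R' rSp)) + 1"
      and t': "t' + c * z \<le> t + c * (work (card X) 0 [] + 1)"
      using I f0 by (auto simp: I_def)
    \<comment> \<open>As \<open>card X\<close> is at most \<open>m\<close>, this bounds all levels
      by \<open>m + 1\<close>, and thereby the height of the stack by what \<open>S\<close>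
      allows.\<close>
    have K: "R' rK \<le> card X + 1" using inv X by (simp add: search_inv_def)
    show "pre W S (AIf (Equal rSp rZero)
      (AAdd rK rK rOne ;; push_arc rOne rM)
      (pop_node ;;
       AIf (Equal rHit rZero) (AConst rFound 1)
         (AIf (Less rL rK)
           (AAdd rL rL rOne ;; push_arc rL rTa ;; push_arc rL rTb ;; push_arc rL rTc)
           ASkip))) (\<lambda>R A t. \<exists>z'<z. I z' R A t) R' A' (t' + 1)"
    proof (cases "R' rSp")
      case 0
      then have inv0: "search_inv (R' rK) [] (A' aDEL)" using inv by simp
      then have "R' rK \<le> card X" using X by (fastforce simp: search_inv_def)
      then have zz: "z = work (card X) (Suc (R' rK)) [(1, m)] + 2"
        using z 0 work_refill by simp
      define A1 where "A1 = A'(aLEVEL := (A' aLEVEL)(0 := 1), aARC := (A' aARC)(0 := m))"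
      define R1 where "R1 = R'(rK := Suc (R' rK), rSp := 1)"
      have "I (z - 1) R1 A1 (t' + 8)"
      proof -
        have "stack A1 1 = [(1, m)]" by (simp add: stack_def A1_def)
        moreover have "t' + 8 + c * (z - 1) \<le> t + c * (work (card X) 0 [] + 1)"
          using t' zz by (simp add: c_def algebra_simps)
        ultimately show ?thesis
          using f0 zz search_inv_refill[OF inv0]
          by (simp add: I_def R1_def std_regs_def arcs_stored_def A1_def)
      qed
      then show ?thesis
        using 0 f0 zz K Xm size unfolding push_arc_def
        by (auto simp: std_regs_def R1_def A1_def numeral_eq_Suc intro!: exI[of _ "z - 1"])
    next
      case (Suc s)
      define l e where le: "l = A' aLEVEL s" "e = A' aARC s"
      have st: "stack A' (R' rSp) = stack A' s @ [(l, e)]" using Suc le by (simp add: stack_Suc)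
      note inv' = inv[unfolded st]
      note D = search_inv_popD[OF inv']
      have s: "s \<le> 2 * (l - 1)" using D(6) by simp
      have lm: "l \<le> m + 1" using D(2) K Xm by simp
      have em: "e \<le> m" using D(4) by (auto split: if_splits)
      have sS: "s < S" using s lm size by simp
      let ?Q = "\<lambda>R A t. \<exists>z'<z. I z' R A t"
      have "pre W S pop_node
        (pre W S (AIf (Equal rHit rZero) (AConst rFound 1)
         (AIf (Less rL rK)
           (AAdd rL rL rOne ;; push_arc rL rTa ;; push_arc rL rTb ;; push_arc rL rTc)
           ASkip)) ?Q) R' A' (t' + 2)"
      proof (rule pop_node_correct)
        fix R1 A1 t1
        assume 1: "std_regs n m R1" "R1 rK = R' rK" "R1 rSp = s" "R1 rL = A' aLEVEL s"
          "R1 rFound = R' rFound" "\<forall>k. k \<notin> {aIN, aLAST, aENTRY, aDEL} \<longrightarrow> A1 k = A' k"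
          "A1 aDEL = undo (A' aDEL) (A' aLEVEL s) (A' aARC s)"
          "if R1 rHit = 0 then merge_branch_free (alive_arcs (A1 aDEL))
           else good_triple (A1 aDEL) (R1 rTa) (R1 rTb) (R1 rTc)"
          "t1 \<le> t' + 2 + 100 * (n + m + 1)"
        have d1: "A1 aDEL = undo (A' aDEL) l e" using 1(7) le by simp
        have as1: "arcs_stored A1" using f0 1(6) by (simp add: arcs_stored_def)
        have st1: "stack A1 s = stack A' s" using 1(6) by (intro stack_cong) auto
        have z1: "work (card X) (R' rK) (stack A' s) + 2 \<le> z"
          using z work_pop[of "card X" "R' rK" "stack A' s" l e] st by simp
        have tc: "t1 + 40 + c * z' \<le> t + c * (work (card X) 0 [] + 1)" if "z' < z" for z'
        proof -
          have "t1 + 40 + c * z' \<le> t' + c * (z' + 1)" using 1(9) by (simp add: c_def algebra_simps)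
          also have "\<dots> \<le> t' + c * z" using that by (intro add_left_mono mult_le_mono2) simp
          finally show ?thesis using t' by simp
        qed
        show "pre W S (AIf (Equal rHit rZero) (AConst rFound 1)
         (AIf (Less rL rK)
           (AAdd rL rL rOne ;; push_arc rL rTa ;; push_arc rL rTb ;; push_arc rL rTc)
           ASkip)) ?Q R1 A1 t1"
        proof (cases "R1 rHit = 0")
          case True
          then have mbf: "merge_branch_free (alive_arcs (A1 aDEL))" using 1(8) by simp
          have "I 0 (R1(rFound := 1)) A1 (t1 + 2)"
            using search_inv_found[OF inv' d1 mbf] node_deleted[OF inv'] d1 1(1) as1 tc[of 0] z1
            by (simp add: I_def std_regs_def)
          then show ?thesis
            using True 1(1) z1 size by (auto simp: std_regs_def intro!: exI[of _ 0])
        next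
          case False
          then have tri: "good_triple (A1 aDEL) (R1 rTa) (R1 rTb) (R1 rTc)" using 1(8) by simp
          note br = search_inv_branch[OF inv' d1 tri]
          show ?thesis
          proof (cases "l < R' rK")
            case True
            define A2 where "A2 = A1(aLEVEL := (A1 aLEVEL)(s := Suc l, Suc s := Suc l, Suc (Suc s) := Suc l),
              aARC := (A1 aARC)(s := R1 rTa, Suc s := R1 rTb, Suc (Suc s) := R1 rTc))"
            define R2 where "R2 = R1(rL := Suc l, rSp := Suc (Suc (Suc s)))"
            have "stack A2 s = stack A1 s" by (intro stack_cong) (simp_all add: A2_def)
            then have st2: "stack A2 (Suc (Suc (Suc s))) =
                stack A' s @ [(Suc l, R1 rTa), (Suc l, R1 rTb), (Suc l, R1 rTc)]"
              using st1 by (simp add: stack_Suc A2_def)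
            have z2: "work (card X) (R' rK) (stack A2 (Suc (Suc (Suc s)))) + 1 < z"
              using z st st2
                work_branch[OF True, of "card X" "stack A' s" e "R1 rTa" "R1 rTb" "R1 rTc"] by simp
            have "I (work (card X) (R' rK) (stack A2 (Suc (Suc (Suc s)))) + 1) R2 A2 (t1 + 18)"
              using br(1)[OF True] st2 1(1-5) as1 tc[OF z2] f0 d1
              by (simp add: I_def std_regs_def arcs_stored_def A2_def R2_def)
            then have "?Q R2 A2 (t1 + 18)" using z2 by blast
            moreover have "Suc (Suc s) < S" "l + 1 \<le> W" "Suc (Suc (Suc s)) \<le> W"
              using s True K Xm D(1) size by auto
            ultimately show ?thesis
              using \<open>R1 rHit \<noteq> 0\<close> 1(1-5) True le(1)
              by (simp add: std_regs_def push_arc_def A2_def R2_def fun_upd_twist numeral_eq_Suc)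
          next
            case not_less: False
            have "I (work (card X) (R' rK) (stack A' s) + 1) R1 A1 (t1 + 3)"
              using br(2)[OF not_less] st1 1(1-5) as1 z1 f0
                tc[of "work (card X) (R' rK) (stack A' s) + 1"]
              by (simp add: I_def)
            then show ?thesis
              using False 1(1-5) not_less z1 le(1)
              by (auto simp: std_regs_def numeral_eq_Suc intro!: exI[of _ "work (card X) (R' rK) (stack A' s) + 1"])
          qed
        qed
      qed (use f0 Suc sS em le in simp_all)
      then show ?thesis using Suc f0 by (simp add: std_regs_def)
    qed
  next
    fix z R' A' t' assume I: "I z R' A' t'" and h: "\<not> holds (Equal rFound rZero) R'"
    have "c * (work (card X) 0 [] + 1) \<le> c * (3 * 3 ^ card X + 1)"
      using work_init[of "card X"] by (intro mult_le_mono2) simp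
    moreover have "t' + c * z \<le> t + c * (work (card X) 0 [] + 1)" using I unfolding I_def by blast
    ultimately have "t' + 1 \<le> t + c * (3 * 3 ^ card X + 1) + 1" by linarith
    moreover have "R' rFound \<noteq> 0" using I h by (simp add: I_def std_regs_def)
    ultimately show "Q R' A' (t' + 1)" using I unfolding I_def c_def by (intro Q) auto
  qed simp
qed

text \<open>The arcs are read from the sorted copy, so overwriting the input in array 0 does no
  harm. Writing starts at cell 1; cell 0 is reserved for the length.\<close>

lemma write_loop_correct:
  assumes "std_regs n m R" "arcs_stored A" "R rI = 0" "R rA = 1" "R rC = 0"
    and Q: "\<And>R' A' t'. std_regs n m R' \<Longrightarrow> R' rC = length (deleted (A aDEL)) \<Longrightarrow>
      (\<forall>j<length (deleted (A aDEL)). A' 0 (Suc (2 * j)) = fst (as ! (deleted (A aDEL) ! j)) \<and>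
        A' 0 (Suc (Suc (2 * j))) = snd (as ! (deleted (A aDEL) ! j))) \<Longrightarrow>
      t' \<le> t + 40 * m + 1 \<Longrightarrow> Q R' A' t'"
  shows "pre W S write_loop Q R A t"
proof -
  define bs where "bs i = filter (\<lambda>j. A aDEL j \<noteq> 0) [0..<i]" for i
  have bs_Suc: "bs (Suc i) = (if A aDEL i = 0 then bs i else bs i @ [i])" for i
    by (simp add: bs_def)
  have bs_le: "length (bs i) \<le> i" for i
    using length_filter_le[of _ "[0..<i]"] by (simp add: bs_def)
  define I where "I z R' A' t' \<longleftrightarrow> z = m - R' rI \<and> R' rI \<le> m \<and> std_regs n m R' \<and>
      (\<forall>k. k \<noteq> 0 \<longrightarrow> A' k = A k) \<and> R' rC = length (bs (R' rI)) \<and>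
      R' rA = Suc (2 * length (bs (R' rI))) \<and>
      (\<forall>j<length (bs (R' rI)). A' 0 (Suc (2 * j)) = fst (as ! (bs (R' rI) ! j)) \<and>
        A' 0 (Suc (Suc (2 * j))) = snd (as ! (bs (R' rI) ! j))) \<and>
      t' \<le> t + 40 * R' rI" for z R' A' t'
  show ?thesis
    unfolding write_loop_def
  proof (rule pre_While[of I m])
    show "I m R A t" using assms(1-5) by (simp add: I_def bs_def)
  next
    fix z R' A' t' assume I: "I z R' A' t'" and h: "holds (Less rI rM) R'"
    define i where "i = R' rI"
    have i: "i < m" "R' rI = i" using h I by (auto simp: I_def std_regs_def i_def)
    have ld: "A' aTAIL i = fst (as ! i)" "A' aHEAD i = snd (as ! i)" "A' aDEL = A aDEL"
      using I assms(2) i by (auto simp: I_def arcs_stored_def)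
    show "pre W S (ALoad rD aDEL rI ;;
     AIf (Equal rD rZero) ASkip
       (ALoad rX aTAIL rI ;; AStore 0 rA rX ;; AAdd rA rA rOne ;;
        ALoad rX aHEAD rI ;; AStore 0 rA rX ;; AAdd rA rA rOne ;; AAdd rC rC rOne) ;;
     AAdd rI rI rOne) (\<lambda>R A t. \<exists>z'<z. I z' R A t) R' A' (t' + 1)"
      using I i ld size bs_le[of i] by (auto simp: I_def std_regs_def bs_Suc nth_append less_Suc_eq)
  next
    fix z R' A' t' assume I: "I z R' A' t'" and h: "\<not> holds (Less rI rM) R'"
    then have "R' rI = m" by (auto simp: I_def std_regs_def)
    moreover have "bs m = deleted (A aDEL)" by (simp add: bs_def deleted_def)
    ultimately show "Q R' A' (t' + 1)" using I unfolding I_def by (intro Q) auto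
  qed simp
qed

end

section \<open>Encoding of input and output, memory layout, and the final bound\<close>

section \<open>The algorithm\<close>

lemma length_arc_list_code: "length (arc_list_code es) = Suc (2 * length es)"
  by (induction es) (auto simp: arc_list_code_def)

lemma nth_concat_pairs:
  assumes "i < length es"
  shows "concat (map (\<lambda>(u, v). [u, v]) es) ! (2 * i) = fst (es ! i)"
    "concat (map (\<lambda>(u, v). [u, v]) es) ! Suc (2 * i) = snd (es ! i)"
  using assms
proof (induction es arbitrary: i)
  case (Cons a es)
  {
    case 1
    then show ?case using Cons.IH(1)[of "i - 1"] by (cases i) (auto split: prod.split)
  next
    case 2
    then show ?case using Cons.IH(2)[of "i - 1"] by (cases i) (auto split: prod.split)
  }
qed simp_all

lemma memory_starts_with_arc_list_code:
  assumes "M 0 = length bs"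
    and "\<And>j. j < length bs \<Longrightarrow> M (Suc (2 * j)) = fst (bs ! j) \<and> M (Suc (Suc (2 * j))) = snd (bs ! j)"
  shows "memory_starts_with M (arc_list_code bs)"
  unfolding memory_starts_with_def
proof (intro allI impI)
  fix i assume i: "i < length (arc_list_code bs)"
  show "M i = arc_list_code bs ! i"
  proof (cases i)
    case (Suc k)
    have k: "k div 2 < length bs" using i Suc by (simp add: length_arc_list_code)
    show ?thesis
    proof (cases "even k")
      case True
      then have "k = 2 * (k div 2)" by simp
      then show ?thesis
        using assms(2)[OF k] nth_concat_pairs(1)[OF k] Suc by (simp add: arc_list_code_def)
    next
      case False
      then have "k = Suc (2 * (k div 2))" by simp
      then show ?thesis
        using assms(2)[OF k] nth_concat_pairs(2)[OF k] Suc
        by (metis arc_list_code_def nth_Cons_Suc)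
    qed
  qed (use assms in \<open>simp add: arc_list_code_def\<close>)
qed

text \<open>The machine has no multiplication, so the start addresses \<open>k * S\<close> are
  obtained by repeatedly adding register 41, which holds \<open>S\<close>. Register 40 remains 0 for
  array 0.\<close>

primrec multiples :: "nat \<Rightarrow> com" where
  "multiples 0 = Skip"
| "multiples (Suc j) = Seq (multiples j) (Add (42 + j) (41 + j) 41)"

lemma multiples_correct:
  assumes "R 41 = S" "Suc j * S \<le> W"
    and "\<And>R'. \<forall>r<41. R' r = R r \<Longrightarrow> \<forall>k\<le>j. R' (41 + k) = Suc k * S \<Longrightarrow> Q R' M (t + Suc j)"
  shows "wp W (multiples j) Q R M t"
  using assms
proof (induction j arbitrary: Q)
  case 0
  then show ?case by (auto intro!: wp_Skip)
next
  case (Suc j)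
  show ?case
    unfolding multiples.simps
  proof (rule wp_Seq, rule Suc.IH)
    fix R' assume R': "\<forall>r<41. R' r = R r" "\<forall>k\<le>j. R' (41 + k) = Suc k * S"
    have "R' (41 + j) = Suc j * S" "R' 41 = S" using R'(2) by (auto dest: spec[of _ 0])
    then have sum: "R' (41 + j) + R' 41 = Suc (Suc j) * S" by simp
    have "Q (R'(42 + j := Suc (Suc j) * S)) M (t + Suc (Suc j))"
      using R' by (intro Suc.prems(3)) (auto simp: le_Suc_eq)
    then show "wp W (Add (42 + j) (41 + j) 41) Q R' M (t + Suc j)"
      using sum Suc.prems(2) by (intro wp_Add) simp_all
  qed (use Suc.prems in simp_all)
qed

text \<open>Register 5 is still 0 and register 4 holds 1, so they serve as the addresses of
  \<open>n\<close> and \<open>m\<close>. The additions then compute \<open>S\<close> in register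
  41.\<close>

definition set_up :: com where
  "set_up = foldr Seq
    [SetConst 4 1, Load 2 5, Load 3 4, SetConst 41 8, Add 41 41 2, Add 41 41 3, Add 41 41 3,
     Add 41 41 3] (multiples 10)"

definition main_prog :: acom where
  "main_prog = topo_sort ;; AConst rK 0 ;; AConst rSp 0 ;; AConst rFound 0 ;; search_loop ;;
     AConst rI 0 ;; AConst rA 1 ;; AConst rC 0 ;; write_loop ;; AStore 0 rZero rC"

text \<open>The 19 steps are 8 instructions and the 11 steps of \<open>multiples 10\<close>, whose
  innermost \<open>Skip\<close> also counts.\<close>

lemma set_up_correct:
  assumes S: "S = n + 3 * m + 8" "12 * S \<le> W" and M: "M 0 = n" "M 1 = m"
    and Q: "\<And>R' t'. represents S ((\<lambda>_. 0)(2 := n, 3 := m, 4 := 1)) (\<lambda>k i. M (k * S + i)) R' M \<Longrightarrow>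
      t' = t + 19 \<Longrightarrow> Q R' M t'"
  shows "wp W set_up Q (\<lambda>_. 0) M t"
proof -
  have bases: "wp W (multiples 10) Q R1 M t1"
    if R1: "R1 = (\<lambda>_. 0)(4 := 1, 2 := n, 3 := m, 41 := S)" and t1: "t1 = t + 8" for R1 t1
  proof (rule multiples_correct[of _ S])
    fix R' assume R': "\<forall>r<41. R' r = R1 r" "\<forall>k\<le>10. R' (41 + k) = Suc k * S"
    have "R' (40 + k) = k * S" if "k < 12" for k
      using R'(1) R'(2)[rule_format, of "k - 1"] that R1 by (cases k) auto
    then show "Q R' M (t1 + Suc 10)"
      using R'(1) R1 t1 by (intro Q) (auto simp: represents_def)
  qed (use S R1 in simp_all)
  show ?thesis
    unfolding set_up_def foldr.simps comp_def id_def
  proof (intro wp_Seq wp_SetConst wp_Load wp_Add, goal_cases)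
    case 7
    show ?case by (rule bases) (simp_all add: fun_eq_iff M[simplified] S)
  qed (use S M in simp_all)
qed

lemma main_prog_correct:
  assumes D: "dag D" and P: "presents n es D" and W: "12 * (n + 3 * length es + 8) \<le> W"
    and R: "R = (\<lambda>_. 0)(2 := n, 3 := length es, 4 := 1)"
    and A: "\<And>i. i < length es \<Longrightarrow> A 0 (Suc (Suc (i + i))) = fst (es ! i) \<and> A 0 (Suc (Suc (Suc (i + i)))) = snd (es ! i)"
    and A0: "\<And>k i. 0 < k \<Longrightarrow> A k i = 0"
    and Q: "\<And>R' A' t' bs. distinct bs \<Longrightarrow> min_funnel_deletion_set D (set bs) \<Longrightarrow>
      length bs = funnel_distance D \<Longrightarrow> A' 0 0 = length bs \<Longrightarrow>
      (\<And>j. j < length bs \<Longrightarrow> A' 0 (Suc (2 * j)) = fst (bs ! j) \<and> A' 0 (Suc (Suc (2 * j))) = snd (bs ! j)) \<Longrightarrow>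
      t' \<le> t + 1000 * (n + length es + 1) * 3 ^ funnel_distance D \<Longrightarrow> Q R' A' t'"
  shows "pre W (n + 3 * length es + 8) main_prog Q R A t"
proof -
  define m S where "m = length es" and "S = n + 3 * m + 8"
  have es: "pverts D = {..<n}" "distinct es" "set es = parcs D"
    using P by (auto simp: presents_def)
  have wf: "u < n \<and> v < n" if "(u, v) \<in> set es" for u v
  proof -
    interpret pair_fin_digraph D using D by (simp add: dag_def)
    show ?thesis using that es in_arcsD1 in_arcsD2 by blast
  qed
  have dd: "funnel_deletion_set D X \<longleftrightarrow> deletion_set (set es) X" for X
    using funnel_deletion_set_iff[OF D] es by simp
  define d where "d = funnel_distance D"
  have "\<exists>d X. funnel_deletion_set D X \<and> card X = d" using ex_funnel_deletion_set[OF D] by blast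
  from LeastI_ex[OF this] obtain X where X: "deletion_set (set es) X" "card X = d"
    unfolding dd d_def funnel_distance_def by blast
  have least: "d \<le> card Y" if "deletion_set (set es) Y" for Y
    unfolding d_def funnel_distance_def dd using that by (intro Least_le) blast
  interpret rd: ram_dag n m W S es
    using wf es dag_imp_acyclic[OF D] W by unfold_locales (auto simp: m_def S_def)
  have "pre W S topo_sort (pre W S (AConst rK 0) (pre W S (AConst rSp 0) (pre W S (AConst rFound 0)
     (pre W S search_loop (pre W S (AConst rI 0) (pre W S (AConst rA 1) (pre W S (AConst rC 0)
     (pre W S write_loop (pre W S (AStore 0 rZero rC) Q))))))))) R A t"
  proof (rule rd.topo_sort_correct)
    show "std_regs n m R" unfolding std_regs_def by (simp add: R m_def)
    show "rd.input_arcs (A 0)" using A unfolding rd.input_arcs_def by (simp add: m_def)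
  next
    fix R1 A1 t1
    assume 1: "std_regs n m R1" "\<forall>k>aHEAD. A1 k = A k" "distinct (rd.arc_array A1 m)"
      "set (rd.arc_array A1 m) = set es" "\<exists>pos. topo_sorted (rd.arc_array A1 m) pos"
      "t1 \<le> t + 100 * (n + m + 1)"
    define as where "as = rd.arc_array A1 m"
    obtain pos where pos: "topo_sorted as pos" using 1(5) as_def by blast
    interpret sa: sorted_arcs n m W S as pos
      using wf 1(3,4) pos rd.size by unfold_locales (auto simp: as_def)
    have set: "set as = set es" using 1(4) as_def by simp
    let ?R = "R1(rK := 0, rSp := 0, rFound := 0)"
    have "pre W S search_loop (pre W S (AConst rI 0) (pre W S (AConst rA 1) (pre W S (AConst rC 0)
     (pre W S write_loop (pre W S (AStore 0 rZero rC) Q))))) ?R A1 (t1 + 3)"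
    proof (rule sa.search_loop_correct)
      show "std_regs n m ?R" using 1(1) by (simp add: std_regs_def std_regs_def)
      show "sa.arcs_stored A1"
        unfolding sa.arcs_stored_def by (simp add: as_def rd.arc_array_def)
      show "deletion_set (set as) X" using X set by simp
    next
      fix R2 :: "nat \<Rightarrow> nat" and A2 :: "nat \<Rightarrow> nat \<Rightarrow> nat" and t2 :: nat
      define bs where "bs = map ((!) as) (sa.deleted (A2 aDEL))"
      assume 2: "std_regs n m R2" "sa.arcs_stored A2"
        "deletion_set (set as) ((!) as ` set (sa.deleted (A2 aDEL)))"
        "\<forall>Y. deletion_set (set as) Y \<longrightarrow> card ((!) as ` set (sa.deleted (A2 aDEL))) \<le> card Y"
        "t2 \<le> t1 + 3 + 200 * (n + m + 1) * (3 * 3 ^ card X + 1) + 1"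
      have bs: "set bs = (!) as ` set (sa.deleted (A2 aDEL))" by (simp add: bs_def)
      have dist: "distinct bs"
        by (auto simp: bs_def distinct_map sa.deleted_def inj_on_def sa.nth_inj)
      have min: "min_funnel_deletion_set D (set bs)"
        using 2(3,4) set dd by (simp add: min_funnel_deletion_set_def bs)
      have "length bs = d"
      proof (rule antisym)
        have "length bs = card (set bs)" using dist by (simp add: distinct_card)
        then show "length bs \<le> d" "d \<le> length bs"
          using 2(3,4) X set bs least by auto
      qed
      have "pre W S write_loop (pre W S (AStore 0 rZero rC) Q) (R2(rI := 0, rA := 1, rC := 0)) A2 (t2 + 3)"
      proof (rule sa.write_loop_correct)
        fix R3 :: "nat \<Rightarrow> nat" and A3 :: "nat \<Rightarrow> nat \<Rightarrow> nat" and t3 :: nat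
        assume 3: "std_regs n m R3" "R3 rC = length (sa.deleted (A2 aDEL))"
         "\<forall>j<length (sa.deleted (A2 aDEL)). A3 0 (Suc (2 * j)) = fst (as ! (sa.deleted (A2 aDEL) ! j)) \<and>
            A3 0 (Suc (Suc (2 * j))) = snd (as ! (sa.deleted (A2 aDEL) ! j))"
         "t3 \<le> t2 + 3 + 40 * m + 1"
        define T :: nat where "T = 3 ^ d"
        have "1 \<le> T" by (simp add: T_def)
        \<comment> \<open>Per unit of \<open>n + m + 1\<close>, sorting contributes 100, the search
          \<open>200 * (3 * T + 1)\<close>, and writing with the glue code at most 50. As
          \<open>T\<close> is at least 1, it absorbs the part without \<open>T\<close>.\<close>
        have "t3 + 2 \<le> t + 1000 * (n + m + 1) * T"
        proof -
          have "t3 + 2 \<le> t + 100 * (n + m + 1) + 10 + 40 * m + 200 * (n + m + 1) * (3 * T + 1)"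
            using 1(6) 2(5) 3(4) X(2) by (simp add: T_def)
          also have "\<dots> \<le> t + 350 * (n + m + 1) + 600 * ((n + m + 1) * T)"
            by (simp add: algebra_simps)
          also have "(n + m + 1) * 1 \<le> (n + m + 1) * T" using \<open>1 \<le> T\<close> by (intro mult_le_mono2)
          then have "t + 350 * (n + m + 1) + 600 * ((n + m + 1) * T) \<le> t + 1000 * ((n + m + 1) * T)"
            by linarith
          also have "\<dots> = t + 1000 * (n + m + 1) * T" by (simp only: mult.assoc)
          finally show ?thesis .
        qed
        then have "Q R3 (A3(0 := (A3 0)(0 := R3 rC))) (t3 + 2)"
          using 3 dist min \<open>length bs = d\<close>
          by (intro Q[of bs]) (auto simp: bs_def d_def T_def m_def)
        then show "pre W S (AStore 0 rZero rC) Q R3 A3 t3"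
          using 3(1) by (simp add: std_regs_def S_def)
      qed (use 2 in \<open>auto simp: std_regs_def\<close>)
      then show "pre W S (AConst rI 0) (pre W S (AConst rA 1) (pre W S (AConst rC 0)
          (pre W S write_loop (pre W S (AStore 0 rZero rC) Q)))) R2 A2 t2"
        using rd.size by (simp add: numeral_eq_Suc)
    qed simp_all
    then show "pre W S (AConst rK 0) (pre W S (AConst rSp 0) (pre W S (AConst rFound 0)
     (pre W S search_loop (pre W S (AConst rI 0) (pre W S (AConst rA 1) (pre W S (AConst rC 0)
     (pre W S write_loop (pre W S (AStore 0 rZero rC) Q)))))))) R1 A1 t1"
      by (simp add: numeral_eq_Suc)
  qed (use R A0 in auto)
  then show ?thesis unfolding main_prog_def pre_Seq S_def m_def .
qed

theorem theorem4:
  shows "\<exists>P w k c. \<forall>D n es. dag D \<and> presents n es D \<longrightarrow>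
    (\<exists>t R M bs.
       exec (w * (n + length es + 1) ^ k) P (initial_state (n # arc_list_code es)) t (R, M) \<and>
       memory_starts_with M (arc_list_code bs) \<and>
       distinct bs \<and>
       min_funnel_deletion_set D (set bs) \<and>
       length bs = funnel_distance D \<and>
       t \<le> c * (3 ^ funnel_distance D * (card (pverts D) + card (parcs D))) + c)"
proof (rule exI[of _ "Seq set_up (compile main_prog)"], rule exI[of _ 96], rule exI[of _ 1],
    rule exI[of _ 3000], intro allI impI)
  fix D n es assume "dag D \<and> presents n es D"
  then have D: "dag D" and P: "presents n es D" by auto
  define m S W where "m = length es" and "S = n + 3 * m + 8" and "W = 96 * (n + length es + 1) ^ 1"
  define M where "M = snd (initial_state (n # arc_list_code es))"
  let ?A = "\<lambda>k i. M (k * S + i)"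
  \<comment> \<open>The factor 96 is \<open>12 * 8\<close>, because 8 is the largest coefficient in
    \<open>S\<close>. Words of size linear in the input thus suffice.\<close>
  have W: "12 * S \<le> W" by (simp add: W_def S_def m_def)
  have len: "length (n # arc_list_code es) = 2 * m + 2"
    by (simp add: length_arc_list_code m_def)
  have M: "M i = (if i < 2 * m + 2 then (n # arc_list_code es) ! i else 0)" for i
    by (simp add: M_def initial_state_def length_arc_list_code m_def)
  have arcs: "M (Suc (Suc (i + i))) = fst (es ! i) \<and> M (Suc (Suc (Suc (i + i)))) = snd (es ! i)"
    if "i < length es" for i
    using nth_concat_pairs[OF that] that unfolding M
    by (auto simp: arc_list_code_def m_def mult_2)
  \<comment> \<open>The input fits into array 0, so all other arrays start out as zero.\<close>
  have zero: "?A k i = 0" if "0 < k" for k i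
  proof -
    have "S \<le> k * S" using that by simp
    moreover have "2 * m + 2 \<le> S" by (simp add: S_def)
    ultimately have "\<not> k * S + i < 2 * m + 2" by linarith
    then show ?thesis by (simp only: M if_False)
  qed
  let ?post = "\<lambda>R M t. \<exists>bs. memory_starts_with M (arc_list_code bs) \<and> distinct bs \<and>
       min_funnel_deletion_set D (set bs) \<and> length bs = funnel_distance D \<and>
       t \<le> 19 + 1000 * (n + m + 1) * 3 ^ funnel_distance D"
  have "wp W (Seq set_up (compile main_prog)) ?post (\<lambda>_. 0) M 0"
  proof (rule wp_Seq, rule set_up_correct[OF S_def W, where t = 0])
    show "M 0 = n" "M 1 = m" by (simp_all add: M arc_list_code_def m_def)
  next
    fix R' t' assume R': "represents S ((\<lambda>_. 0)(2 := n, 3 := m, 4 := 1)) ?A R' M"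
      and t': "t' = 0 + (19::nat)"
    let ?Q = "\<lambda>R A t. \<exists>bs. distinct bs \<and> min_funnel_deletion_set D (set bs) \<and>
      length bs = funnel_distance D \<and> A 0 0 = length bs \<and>
      (\<forall>j<length bs. A 0 (Suc (2 * j)) = fst (bs ! j) \<and> A 0 (Suc (Suc (2 * j))) = snd (bs ! j)) \<and>
      t \<le> 19 + 1000 * (n + m + 1) * 3 ^ funnel_distance D"
    have "pre W S main_prog ?Q ((\<lambda>_. 0)(2 := n, 3 := m, 4 := 1)) ?A 19"
      unfolding S_def m_def
      by (rule main_prog_correct[OF D P]) (use W arcs zero in \<open>auto simp: S_def m_def\<close>)
    from compile_sound[OF this R' W]
    have "wp W (compile main_prog) ?post R' M 19"
    proof (rule wp_mono)
      fix R1 M1 t1 assume "\<exists>R A. represents S R A R1 M1 \<and> ?Q R A t1"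
      then obtain R A bs where r: "represents S R A R1 M1" and q: "distinct bs"
        "min_funnel_deletion_set D (set bs)"
        "length bs = funnel_distance D" "A 0 0 = length bs"
        "\<forall>j<length bs. A 0 (Suc (2 * j)) = fst (bs ! j) \<and> A 0 (Suc (Suc (2 * j))) = snd (bs ! j)"
        "t1 \<le> 19 + 1000 * (n + m + 1) * 3 ^ funnel_distance D" by blast
      \<comment> \<open>This shows that the encoded result fits into array 0, where
        \<open>represents\<close> determines the memory.\<close>
      have "length bs = card (set bs)" using q(1) by (simp add: distinct_card)
      also have "\<dots> \<le> card (parcs D)"
        using q(2) D by (intro card_mono) (auto simp: min_funnel_deletion_set_def funnel_deletion_set_def
            dag_def pair_fin_digraph_def pair_fin_digraph_axioms_def)
      also have "\<dots> \<le> m" using P card_length[of es] by (simp add: presents_def m_def)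
      finally have "2 * length bs + 2 < S" by (simp add: S_def)
      moreover have M1: "M1 i = A 0 i" if "i < S" for i
      proof -
        have "\<forall>k<12. \<forall>i<S. M1 (k * S + i) = A k i" using r by (simp add: represents_def)
        from this[rule_format, of 0 i] that show ?thesis by simp
      qed
      ultimately have "memory_starts_with M1 (arc_list_code bs)"
        using q(4,5) by (intro memory_starts_with_arc_list_code) auto
      then show "?post R1 M1 t1" using q by blast
    qed
    then show "wp W (compile main_prog) ?post R' M t'" using t' by simp
  qed
  then obtain t R1 M1 where e: "exec W (Seq set_up (compile main_prog)) (\<lambda>_. 0, M) t (R1, M1)"
    "?post R1 M1 t" unfolding wp_def by auto
  have ini: "initial_state (n # arc_list_code es) = (\<lambda>_. 0, M)"
    by (simp add: M_def initial_state_def)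
  define T where "T = (3::nat) ^ funnel_distance D"
  have cards: "card (pverts D) = n" "card (parcs D) = m"
    using P by (auto simp: presents_def m_def distinct_card[symmetric])
  \<comment> \<open>The bound to be reached has \<open>n + m\<close> in place of
    \<open>n + m + 1\<close>. If the digraph has a vertex or an arc, doubling the factor makes up
    for this; the empty digraph has distance 0 and is covered by the additive constant.\<close>
  have "19 + 1000 * (n + m + 1) * T \<le> 3000 * (T * (n + m)) + 3000"
  proof (cases "n + m = 0")
    case True
    then have "parcs D = {}" using P by (auto simp: presents_def m_def)
    obtain bs where "min_funnel_deletion_set D (set bs)" "distinct bs" "length bs = funnel_distance D"
      using e(2) by blast
    then have "funnel_distance D = 0"
      using \<open>parcs D = {}\<close> by (auto simp: min_funnel_deletion_set_def funnel_deletion_set_def)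
    then show ?thesis using True by (simp add: T_def)
  next
    case False
    then have "1 \<le> n + m" by linarith
    then have "1 * T \<le> (n + m) * T" by (rule mult_le_mono1)
    then show ?thesis by (simp add: algebra_simps)
  qed
  then have "t \<le> 3000 * (3 ^ funnel_distance D * (card (pverts D) + card (parcs D))) + 3000"
    using e(2) unfolding cards T_def by (meson le_trans)
  then show "\<exists>t R M bs.
       exec (96 * (n + length es + 1) ^ 1) (Seq set_up (compile main_prog))
         (initial_state (n # arc_list_code es)) t (R, M) \<and>
       memory_starts_with M (arc_list_code bs) \<and>
       distinct bs \<and>
       min_funnel_deletion_set D (set bs) \<and>
       length bs = funnel_distance D \<and>
       t \<le> 3000 * (3 ^ funnel_distance D * (card (pverts D) + card (parcs D))) + 3000"
    using e unfolding ini W_def by blast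
qed

end
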